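(* Let $p>1$. Let $(r_n)_{n\in\mathbb{N}}$ be a sequence of deterministic radii with $0\le r_n<1$, at most one of which equals $0$, let $(\theta_n)_{n\in\mathbb{N}}$ be independent random variables uniformly distributed in $[0,2\pi)$, and let $\Lambda=\Lambda(\omega)=(\lambda_n(\omega))_{n\in\mathbb{N}}$ with $\lambda_n(\omega)=r_ne^{i\theta_n(\omega)}$. Then $\Lambda$ is almost surely free interpolating for the big Hardy-Orlicz space $\mathcal{H}_p$ if and only if $\Lambda$ is a Blaschke sequence, i.e. $\sum_{n}(1-|\lambda_n|)=\sum_n(1-r_n)<\infty$.
   Context: $\mathbb{D}=\{z\in\mathbb{C}:|z|<1\}$, $\mathbb{T}=\partial\mathbb{D}$, $m$ is normalized Lebesgue measure on $\mathbb{T}$, and $\mathrm{Hol}(\mathbb{D})$ is the set of holomorphic functions on $\mathbb{D}$. The Nevanlinna class is $$\mathcal{N}=\Big\{f\in\mathrm{Hol}(\mathbb{D}):\lim_{r\to1}\frac1{2\pi}\int_0^{2\pi}\log^+|f(re^{i\theta})|\,d\theta<\infty\Big\}.$$ Functions in $\mathcal{N}$ have non-tangential boundary values $f(\zeta)$ for almost every $\zeta\in\mathbb{T}$. The Smirnov class is $$\mathcal{N}^+=\Big\{f\in\mathcal{N}:\lim_{r\to1}\frac1{2\pi}\int_0^{2\pi}\log^+|f(re^{i\theta})|\,d\theta=\frac1{2\pi}\int_0^{2\pi}\log^+|f(e^{i\theta})|\,d\theta<\infty\Big\}.$$ For $p>1$, $\mathcal{H}_p$ is the Hardy-Orlicz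 space with defining function $\varphi(t)=t^p$ for $t\ge0$ and $\varphi(t)=0$ for $t<0$, that is $$\mathcal{H}_p=\Big\{f\in\mathcal{N}^+:\int_{\mathbb{T}}\big(\log^+|f(\zeta)|\big)^p\,dm(\zeta)<\infty\Big\}.$$ For a space $X$ of holomorphic functions on $\mathbb{D}$ and a sequence $\Lambda=(\lambda_n)_n$ in $\mathbb{D}$, the trace space is $X|_\Lambda=\{(f(\lambda_n))_n: f\in X\}$. The sequence $\Lambda$ is free interpolating for $X$ if $\ell^\infty\cdot X|_\Lambda\subset X|_\Lambda$ (pointwise products). When $X$ is an algebra containing the constants (as is the case for $\mathcal{H}_p$), this is equivalent to $\ell^\infty\subset X|_\Lambda$. *)

theory Defs
  imports "HOL-Probability.Probability" "HOL-Complex_Analysis.Complex_Analysis"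
begin

abbreviation unit_disc :: "complex set" where
  "unit_disc \<equiv> ball 0 1"

text \<open>
  Normalized Lebesgue measure on the unit circle is rendered through the parametrization by
  the angle. The completed measure is used, since boundary functions are only determined
  almost everywhere.
\<close>

definition circle_integrable :: "(complex \<Rightarrow> real) \<Rightarrow> bool" where
  "circle_integrable g \<longleftrightarrow> set_integrable lebesgue {0..2 * pi} (\<lambda>\<theta>. g (cis \<theta>))"

definition circle_mean :: "(complex \<Rightarrow> real) \<Rightarrow> real" where
  "circle_mean g = 1 / (2 * pi) * (LINT \<theta>:{0..2 * pi}|lebesgue. g (cis \<theta>))"

text \<open>Since \<open>ln 0 = 0\<close> in the library, \<open>log_plus 0 = 0\<close>, as it should be.\<close>

definition log_plus :: "real \<Rightarrow> real" where
  "log_plus x = max 0 (ln x)"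

definition stolz_region :: "real \<Rightarrow> complex \<Rightarrow> complex set" where
  "stolz_region \<alpha> \<zeta> = {z \<in> unit_disc. norm (z - \<zeta>) < \<alpha> * (1 - norm z)}"

definition has_nontangential_limit :: "(complex \<Rightarrow> complex) \<Rightarrow> complex \<Rightarrow> complex \<Rightarrow> bool" where
  "has_nontangential_limit f \<zeta> l \<longleftrightarrow>
     (\<forall>\<alpha>>1. (f \<longlongrightarrow> l) (at \<zeta> within stolz_region \<alpha> \<zeta>))"

text \<open>
  For \<open>norm \<zeta> = 1\<close> the limit is unique if it exists; where there is none, the value
  is an unspecified constant. For functions of the Nevanlinna class this concerns a null set
  of the circle only.
\<close>

definition boundary_value :: "(complex \<Rightarrow> complex) \<Rightarrow> complex \<Rightarrow> complex" where
  "boundary_value f \<zeta> = (THE l. has_nontangential_limit f \<zeta> l)"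

text \<open>
  Elements of the following spaces are total functions on the complex plane of which only
  the restriction to the unit disc matters. Existence of a real limit expresses finiteness.
\<close>

definition nevanlinna_class :: "(complex \<Rightarrow> complex) set" where
  "nevanlinna_class = {f. f holomorphic_on unit_disc \<and>
     (\<exists>L. ((\<lambda>r. circle_mean (\<lambda>\<zeta>. log_plus (norm (f (of_real r * \<zeta>))))) \<longlongrightarrow> L) (at_left 1))}"

definition smirnov_class :: "(complex \<Rightarrow> complex) set" where
  "smirnov_class = {f \<in> nevanlinna_class.
     circle_integrable (\<lambda>\<zeta>. log_plus (norm (boundary_value f \<zeta>))) \<and>
     ((\<lambda>r. circle_mean (\<lambda>\<zeta>. log_plus (norm (f (of_real r * \<zeta>))))) \<longlongrightarrow>
        circle_mean (\<lambda>\<zeta>. log_plus (norm (boundary_value f \<zeta>)))) (at_left 1)}"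

definition hardy_orlicz :: "real \<Rightarrow> (complex \<Rightarrow> complex) set" where
  "hardy_orlicz p = {f \<in> smirnov_class.
     circle_integrable (\<lambda>\<zeta>. log_plus (norm (boundary_value f \<zeta>)) powr p)}"

definition trace_space :: "(complex \<Rightarrow> complex) set \<Rightarrow> (nat \<Rightarrow> complex) \<Rightarrow> (nat \<Rightarrow> complex) set" where
  "trace_space X \<Lambda> = (\<lambda>f n. f (\<Lambda> n)) ` X"

definition free_interpolating :: "(complex \<Rightarrow> complex) set \<Rightarrow> (nat \<Rightarrow> complex) \<Rightarrow> bool" where
  "free_interpolating X \<Lambda> \<longleftrightarrow>
     (\<forall>a v. bounded (range a) \<longrightarrow> v \<in> trace_space X \<Lambda> \<longrightarrow> (\<lambda>n. a n * v n) \<in> trace_space X \<Lambda>)"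

end

theory Submission imports Defs begin

text \<open>
  Sufficiency: let \<open>B\<^sub>n\<close> be the Blaschke product with zeros \<open>\<lambda>\<^sub>k\<close>, \<open>k \<noteq> n\<close>. For fixed \<open>\<lambda>\<^sub>n\<close> the mean of the
  inverse square root of the pseudohyperbolic distance from \<open>\<lambda>\<^sub>n\<close> to \<open>\<lambda>\<^sub>k\<close> over the angle of \<open>\<lambda>\<^sub>k\<close> is at
  most \<open>1 + C (1 - r\<^sub>k)\<close>. By independence the expectation of \<open>\<bar>B\<^sub>n(\<lambda>\<^sub>n)\<bar>\<close> to the power \<open>-1/2\<close> is bounded
  in \<open>n\<close>, so that \<open>\<Sum>\<^sub>n (1 - r\<^sub>n) \<bar>B\<^sub>n(\<lambda>\<^sub>n)\<bar>\<close> to the power \<open>-1/2\<close> converges almost surely. Then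
  \<open>h(z) = \<Sum>\<^sub>n a\<^sub>n B\<^sub>n(z) / B\<^sub>n(\<lambda>\<^sub>n) ((1 - \<bar>\<lambda>\<^sub>n\<bar>\<^sup>2) / (1 - cnj \<lambda>\<^sub>n z))\<^sup>4\<close> interpolates a bounded sequence \<open>a\<close> and lies
  in the Hardy space of exponent \<open>1/2\<close>, hence in every \<open>\<H>\<^sub>p\<close>. As \<open>\<H>\<^sub>p\<close> is closed under products,
  multiplying by \<open>h\<close> solves the free interpolation problem.

  Necessity: some function of the Nevanlinna class is \<open>1\<close> at \<open>\<lambda>\<^sub>0\<close> and vanishes at all other \<open>\<lambda>\<^sub>n\<close>.
  Such a function is a quotient of bounded functions, obtained by approximating \<open>log\<^sup>+ \<bar>f\<bar>\<close> on
  circles by trigonometric polynomials, and the zeros of bounded functions satisfy the Blaschke condition.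

  Closure of \<open>\<H>\<^sub>p\<close> under products needs Fatou's theorem. For bounded \<open>f\<close> with Taylor
  polynomials \<open>P\<^sub>N\<close>, a weak type estimate for the nontangential maximal function of \<open>f - P\<^sub>N\<close> follows
  from Vitali's covering lemma applied to difference quotients of a primitive on the circle.
\<close>

subsection \<open>Means over the circle\<close>

text \<open>The exponent 1/2 answers an obstacle. Nothing separates the radii, and for two nodes on
  a common circle the mean over the angle of the inverse pseudohyperbolic distance itself diverges
  logarithmically; an exponent below 1 restores integrability. This choice fixes the shape of h:
  with D_n the supremum of the -1/2 powers over finite products, the n-th term is bounded by a
  constant times D_n squared times the fourth power of the normalized kernel. Its square root is D_n
  times a multiple of a Poisson kernel, with integral of order (1 - r_n) D_n. So the series that
  converges almost surely is the one that puts h into the Hardy space of exponent 1/2. The Smirnov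
  class is defined by convergence of means and not by a factorization. Closure under products
  therefore needs two things: boundary values of a product have to be products of boundary values,
  which is where Fatou's theorem enters, and integrals have to converge under majorants that vary
  with the radius.\<close>

abbreviation circle_angle :: "real measure" where
  "circle_angle \<equiv> lebesgue_on {0..2 * pi}"

lemma circle_mean_eq: "circle_mean g = (LINT t|circle_angle. g (cis t)) / (2 * pi)"
proof -
  have "{0..2 * pi} \<inter> space lebesgue \<in> sets lebesgue" by simp
  from integral_restrict_space[OF this]
  have "(LINT t|circle_angle. g (cis t)) = (LINT t:{0..2 * pi}|lebesgue. g (cis t))"
    unfolding set_lebesgue_integral_def .
  then show ?thesis
    unfolding circle_mean_def by (simp only: mult_1_left times_divide_eq_left)
qed

lemma circle_integrable_iff:
  "circle_integrable g \<longleftrightarrow> integrable circle_angle (\<lambda>t. g (cis t))"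
proof -
  have "{0..2 * pi} \<inter> space lebesgue \<in> sets lebesgue" by simp
  from integrable_restrict_space[OF this, of "\<lambda>t. g (cis t)", symmetric] show ?thesis
    unfolding circle_integrable_def set_integrable_def .
qed

lemma finite_measure_circle_angle: "finite_measure circle_angle"
  by (rule finite_measureI) (auto simp: emeasure_restrict_space)

lemma measure_circle_angle: "measure circle_angle (space circle_angle) = 2 * pi"
proof -
  have "measure circle_angle {0..2 * pi} = measure lebesgue {0..2 * pi}"
    by (rule measure_restrict_space) auto
  then show ?thesis by (simp only: space_restrict_space) simp
qed

lemma continuous_imp_integrable_circle_angle:
  fixes f :: "real \<Rightarrow> 'a::euclidean_space"
  assumes "continuous_on {0..2 * pi} f"
  shows "integrable circle_angle f"
proof -
  have "f absolutely_integrable_on {0..2 * pi}"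
    using absolutely_integrable_continuous_real assms by blast
  then show ?thesis
    unfolding set_integrable_def by (subst integrable_restrict_space) simp_all
qed

lemma lebesgue_integral_circle_angle_eq_integral:
  fixes f :: "real \<Rightarrow> 'a::euclidean_space"
  assumes "continuous_on {0..2 * pi} f"
  shows "(LINT t|circle_angle. f t) = integral {0..2 * pi} f"
  by (rule lebesgue_integral_eq_integral[OF continuous_imp_integrable_circle_angle[OF assms]]) simp

lemma mean_value_cis:
  fixes f :: "complex \<Rightarrow> complex"
  assumes "continuous_on (cball 0 1) f" "f holomorphic_on ball 0 1"
  shows "(LINT t|circle_angle. f (cis t)) = of_real (2 * pi) * f 0"
proof -
  have cont: "continuous_on {0..2 * pi} (\<lambda>t. f (cis t))"
    by (rule continuous_on_compose2[OF assms(1)]) (auto intro!: continuous_intros)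
  have "((\<lambda>u. f u / (u - 0)) has_contour_integral 2 * of_real pi * \<i> * f 0) (circlepath 0 1)"
    by (rule Cauchy_integral_circlepath) (use assms in auto)
  then have "((\<lambda>t. f (0 + of_real 1 * cis t) / (0 + of_real 1 * cis t - 0) * of_real 1 * \<i> * cis t)
     has_integral 2 * of_real pi * \<i> * f 0) {0..2 * pi}"
    unfolding circlepath_def
    by (subst (asm) has_contour_integral_part_circlepath_iff) auto
  then have "((\<lambda>t. \<i> * f (cis t)) has_integral 2 * of_real pi * \<i> * f 0) {0..2 * pi}"
    by (simp add: mult.commute)
  then have "((\<lambda>t. (-\<i>) * (\<i> * f (cis t))) has_integral (-\<i>) * (2 * of_real pi * \<i> * f 0)) {0..2 * pi}"
    by (rule has_integral_mult_right)
  then have "((\<lambda>t. f (cis t)) has_integral of_real (2 * pi) * f 0) {0..2 * pi}"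
    by (simp add: algebra_simps)
  then show ?thesis
    using lebesgue_integral_circle_angle_eq_integral[OF cont] by (simp add: integral_unique)
qed

lemma continuous_on_circle_dilate:
  assumes "continuous_on (ball 0 1) f" "\<bar>r\<bar> < 1"
  shows "continuous_on A (\<lambda>t. f (of_real r * cis t))"
  by (rule continuous_on_compose2[OF assms(1)])
     (use assms(2) in \<open>auto intro!: continuous_intros simp: norm_mult\<close>)

lemma holomorphic_on_dilate:
  assumes "f holomorphic_on ball 0 1" "\<bar>r\<bar> < 1"
  shows "(\<lambda>z. f (of_real r * z)) holomorphic_on ball 0 (1 / \<bar>r\<bar>)"
    and "(\<lambda>z. f (of_real r * z)) holomorphic_on cball 0 1"
proof -
  have "\<bar>r\<bar> * norm z < 1" if "norm z < 1 / \<bar>r\<bar>" for z :: complex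
    using that by (cases "r = 0") (auto simp: field_simps)
  then show "(\<lambda>z. f (of_real r * z)) holomorphic_on ball 0 (1 / \<bar>r\<bar>)"
    by (intro holomorphic_on_compose_gen[OF _ assms(1), unfolded o_def] holomorphic_intros)
       (auto simp: norm_mult)
  have "\<bar>r\<bar> * norm z < 1" if "norm z \<le> 1" for z :: complex
    using assms(2) that mult_left_le[of "norm z" "\<bar>r\<bar>"] by linarith
  then show "(\<lambda>z. f (of_real r * z)) holomorphic_on cball 0 1"
    by (intro holomorphic_on_compose_gen[OF _ assms(1), unfolded o_def] holomorphic_intros)
       (auto simp: norm_mult)
qed

lemma log_plus_eq: "x \<ge> 0 \<Longrightarrow> log_plus x = ln (max 1 x)"
  unfolding log_plus_def by (cases "x = 0") (auto simp: max_def)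

lemma log_plus_nonneg [simp]: "log_plus x \<ge> 0"
  by (simp add: log_plus_def)

lemma log_plus_mono: "0 \<le> x \<Longrightarrow> x \<le> y \<Longrightarrow> log_plus x \<le> log_plus y"
  by (auto simp: log_plus_eq max_def)

lemma le_exp_log_plus: "x \<ge> 0 \<Longrightarrow> x \<le> exp (log_plus x)"
  by (auto simp: log_plus_eq max_def)

lemma log_plus_mult_le:
  assumes "x \<ge> 0" "y \<ge> 0"
  shows "log_plus (x * y) \<le> log_plus x + log_plus y"
proof -
  have "max 1 (x * y) \<le> max 1 x * max 1 y"
    using mult_mono[of x "max 1 x" y "max 1 y"] mult_mono[of 1 "max 1 x" 1 "max 1 y"] assms by auto
  then have "ln (max 1 (x * y)) \<le> ln (max 1 x * max 1 y)"
    by (subst ln_le_cancel_iff) (auto intro: mult_pos_pos)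
  also have "\<dots> = ln (max 1 x) + ln (max 1 y)"
    by (rule ln_mult_pos) auto
  finally show ?thesis
    using assms by (simp add: log_plus_eq)
qed

lemma continuous_on_log_plus_norm:
  fixes f :: "'a::topological_space \<Rightarrow> 'b::real_normed_vector"
  assumes "continuous_on A f"
  shows "continuous_on A (\<lambda>x. log_plus (norm (f x)))"
proof -
  have "continuous_on A (\<lambda>x. ln (max 1 (norm (f x))))"
    by (intro continuous_intros assms) (auto simp: max_def)
  then show ?thesis by (simp add: log_plus_eq)
qed

lemma tendsto_log_plus_norm:
  fixes f :: "'a \<Rightarrow> 'b::real_normed_vector"
  assumes "(f \<longlongrightarrow> l) F"
  shows "((\<lambda>x. log_plus (norm (f x))) \<longlongrightarrow> log_plus (norm l)) F"
proof -
  have "((\<lambda>x. ln (max 1 (norm (f x)))) \<longlongrightarrow> ln (max 1 (norm l))) F"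
    by (intro tendsto_intros assms) (auto simp: max_def)
  then show ?thesis by (simp add: log_plus_eq)
qed

subsection \<open>Nevanlinna functions as quotients of bounded functions\<close>

lemma Re_mult_Re: "Re x * Re y = Re (x * y / 2) + Re (x * cnj y / 2)"
  by (simp add: field_simps)

text \<open>The product-to-sum formula: on the circle \<open>cnj z\<close> is the inverse of
  \<open>z\<close>, so \<open>z ^ m * cnj z ^ n\<close> is again a power when
  \<open>n \<le> m\<close>, and the other case is symmetric. Hence real parts of polynomials form an
  algebra on the circle.\<close>

lemma Re_monomial_mult_on_circle:
  fixes a b :: complex
  shows "\<exists>p. \<forall>z\<in>sphere 0 1. Re (a * z ^ m) * Re (b * z ^ n) = Re (poly p z)"
proof -
  have *: "\<exists>p. \<forall>z\<in>sphere 0 1. Re (a * z ^ m) * Re (b * z ^ n) = Re (poly p z)" if "n \<le> m" for a b m n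
  proof (intro exI ballI)
    fix z :: complex assume "z \<in> sphere 0 1"
    then have z: "z * cnj z = 1"
      using complex_norm_square[of z] by simp
    have "z ^ m * cnj z ^ n = z ^ (m - n) * (z * cnj z) ^ n"
      using that by (simp add: power_mult_distrib power_add[symmetric] flip: mult.assoc)
    then have eq: "z ^ m * cnj z ^ n = z ^ (m - n)" by (simp add: z)
    have "Re (a * z ^ m) * Re (b * z ^ n) =
        Re ((a * z ^ m) * (b * z ^ n) / 2) + Re ((a * z ^ m) * cnj (b * z ^ n) / 2)"
      unfolding Re_mult_Re ..
    also have "(a * z ^ m) * cnj (b * z ^ n) = a * cnj b * z ^ (m - n)"
      using eq by (simp add: algebra_simps)
    also have "(a * z ^ m) * (b * z ^ n) = a * b * z ^ (m + n)"
      by (simp add: power_add algebra_simps)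
    finally show "Re (a * z ^ m) * Re (b * z ^ n)
        = Re (poly (monom (a * b / 2) (m + n) + monom (a * cnj b / 2) (m - n)) z)"
      by (simp add: poly_monom)
  qed
  show ?thesis
  proof (cases "n \<le> m")
    case False
    then show ?thesis using *[of m n b a] by (simp add: mult.commute)
  qed (rule *)
qed

text \<open>Stone-Weierstrass for that algebra, in which \<open>Re\<close> and \<open>Im\<close>
  separate points. Writing trigonometric polynomials as real parts of polynomials gives each a
  holomorphic completion on the disc, ready to be exponentiated.\<close>

lemma trigonometric_approximation:
  fixes u :: "complex \<Rightarrow> real"
  assumes "continuous_on (sphere 0 1) u" "0 < e"
  shows "\<exists>p. \<forall>z\<in>sphere 0 1. \<bar>u z - Re (poly p z)\<bar> < e"
proof -
  define P :: "(complex \<Rightarrow> real) \<Rightarrow> bool"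
    where "P = (\<lambda>u. \<exists>p. \<forall>z\<in>sphere 0 1. u z = Re (poly p z))"
  have P_add: "P (\<lambda>z. f z + g z)" if f: "P f" and g: "P g" for f g
  proof -
    obtain p where "\<forall>z\<in>sphere 0 1. f z = Re (poly p z)"
      using f unfolding P_def by blast
    moreover obtain q where "\<forall>z\<in>sphere 0 1. g z = Re (poly q z)"
      using g unfolding P_def by blast
    ultimately show ?thesis
      unfolding P_def by (intro exI[of _ "p + q"]) simp
  qed
  have P_const: "P (\<lambda>z. c)" for c
    unfolding P_def by (intro exI[of _ "[:of_real c:]"]) simp
  have P_sum: "P (\<lambda>z. \<Sum>i\<in>I. f i z)" if "\<And>i. i \<in> I \<Longrightarrow> P (f i)" for I :: "nat set" and f
    using that
  proof (induction I rule: infinite_finite_induct)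
    case (insert i I)
    then show ?case by (simp add: P_add)
  qed (simp_all add: P_const)
  have P_mult: "P (\<lambda>z. f z * g z)" if f: "P f" and g: "P g" for f g
  proof -
    obtain p q where p: "\<And>z. z \<in> sphere 0 1 \<Longrightarrow> f z = Re (poly p z)"
      and q: "\<And>z. z \<in> sphere 0 1 \<Longrightarrow> g z = Re (poly q z)"
      using f g unfolding P_def by blast
    have "P (\<lambda>z. Re (coeff p i * z ^ i) * Re (coeff q j * z ^ j))" for i j
      unfolding P_def by (rule Re_monomial_mult_on_circle)
    then have "P (\<lambda>z. \<Sum>i\<le>degree p. \<Sum>j\<le>degree q. Re (coeff p i * z ^ i) * Re (coeff q j * z ^ j))"
      by (intro P_sum)
    moreover have "f z * g z = (\<Sum>i\<le>degree p. \<Sum>j\<le>degree q. Re (coeff p i * z ^ i) * Re (coeff q j * z ^ j))"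
      if "z \<in> sphere 0 1" for z
      unfolding p[OF that] q[OF that] poly_altdef Re_sum sum_product ..
    ultimately show ?thesis
      unfolding P_def by simp
  qed
  have "\<exists>g. P g \<and> (\<forall>x\<in>sphere 0 1. \<bar>u x - g x\<bar> < e)"
  proof (rule Stone_Weierstrass_HOL)
    show "continuous_on (sphere 0 1) f" if f: "P f" for f
    proof -
      obtain p where p: "\<forall>z\<in>sphere 0 1. f z = Re (poly p z)"
        using f unfolding P_def by blast
      have "continuous_on (sphere 0 1) (\<lambda>z. Re (poly p z))"
        by (intro continuous_intros)
      then show ?thesis
        using p continuous_on_cong[of "sphere 0 1" "sphere 0 1" f "\<lambda>z. Re (poly p z)"] by simp
    qed
    show "\<exists>f. P f \<and> f x \<noteq> f y" if "x \<in> sphere 0 1 \<and> y \<in> sphere 0 1 \<and> x \<noteq> y" for x y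
    proof -
      have "P Re" unfolding P_def by (intro exI[of _ "[:0, 1:]"]) simp
      moreover have "P Im" unfolding P_def by (intro exI[of _ "[:0, -\<i>:]"]) simp
      ultimately show ?thesis using that complex_eqI by blast
    qed
  qed (use assms P_add P_mult P_const in auto)
  then obtain g where g: "P g" "\<forall>x\<in>sphere 0 1. \<bar>u x - g x\<bar> < e" by blast
  then obtain p where "\<forall>z\<in>sphere 0 1. g z = Re (poly p z)" unfolding P_def by blast
  then show ?thesis using g(2) by auto
qed

text \<open>\<open>G\<close> stands in for the outer function whose modulus on the circle is the
  exponential of \<open>- log_plus (norm (f z))\<close>. As the exponential of a polynomial it has
  no zeros. The upper bounds pass from the circle to the disc by the maximum principle; the lower
  bound at 0 comes from the mean value property of \<open>poly p\<close>.\<close>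

lemma bounded_multiplier_on_disc:
  fixes f :: "complex \<Rightarrow> complex"
  assumes "continuous_on (cball 0 1) f" "f holomorphic_on ball 0 1"
  obtains G where "G holomorphic_on UNIV" "\<And>z. G z \<noteq> 0" "\<And>z. norm z \<le> 1 \<Longrightarrow> norm (G z) \<le> 1"
    "\<And>z. norm z \<le> 1 \<Longrightarrow> norm (f z * G z) \<le> 1"
    "norm (G 0) \<ge> exp (- circle_mean (\<lambda>\<zeta>. log_plus (norm (f \<zeta>))) - 1)"
proof -
  define u where "u = (\<lambda>z. log_plus (norm (f z)))"
  have u: "continuous_on (cball 0 1) u"
    unfolding u_def by (rule continuous_on_log_plus_norm[OF assms(1)])
  then have "continuous_on (sphere 0 1) u"
    by (rule continuous_on_subset) auto
  then obtain p where p: "\<And>z. z \<in> sphere 0 1 \<Longrightarrow> \<bar>u z - Re (poly p z)\<bar> < 1/2"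
    using trigonometric_approximation[of u "1/2"] by (metis half_gt_zero_iff zero_less_one)
  \<comment> \<open>The shift by 1/2 absorbs the approximation error on the circle. Together with
    the 1/2 lost in estimating \<open>Re (poly p 0)\<close> it accounts for the \<open>- 1\<close>
    in the lower bound at 0.\<close>
  define G where "G = (\<lambda>z. exp (- poly p z - 1/2))"
  have hol: "G holomorphic_on A" for A
    unfolding G_def by (intro holomorphic_intros)
  have G_sphere: "norm (G z) \<le> exp (- u z)" if "z \<in> sphere 0 1" for z
    using p[OF that] unfolding G_def norm_exp_eq_Re by (auto simp: abs_if split: if_splits)
  have u_nonneg: "u z \<ge> 0" for z by (simp add: u_def)
  have norm_G: "norm (G z) \<le> 1" if "norm z \<le> 1" for z
  proof (rule maximum_modulus_frontier[of G "cball 0 1"])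
    show "norm (G w) \<le> 1" if "w \<in> frontier (cball 0 1)" for w
      using G_sphere[of w] u_nonneg[of w] that by (simp add: order_trans[OF _ exp_le_one_iff[THEN iffD2]])
  qed (use that hol holomorphic_on_imp_continuous_on[OF hol] in auto)
  have norm_fG: "norm (f z * G z) \<le> 1" if "norm z \<le> 1" for z
  proof (rule maximum_modulus_frontier[of "\<lambda>z. f z * G z" "cball 0 1"])
    show "norm (f w * G w) \<le> 1" if "w \<in> frontier (cball 0 1)" for w
    proof -
      have "norm (f w * G w) \<le> exp (u w) * exp (- u w)"
        unfolding norm_mult u_def
        by (intro mult_mono le_exp_log_plus) (use G_sphere[of w] that in \<open>auto simp: u_def\<close>)
      then show ?thesis by (simp flip: exp_add)
    qed
    show "continuous_on (closure (cball 0 1)) (\<lambda>z. f z * G z)"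
      using assms(1) holomorphic_on_imp_continuous_on[OF hol] by (auto intro!: continuous_intros)
    show "(\<lambda>z. f z * G z) holomorphic_on interior (cball 0 1)"
      using assms(2) hol by (auto intro!: holomorphic_intros)
  qed (use that in auto)
  have "Re (poly p 0) \<le> circle_mean u + 1/2"
  proof -
    have cont_p: "continuous_on {0..2*pi} (\<lambda>t. poly p (cis t))"
      by (intro continuous_intros)
    have cont_u: "continuous_on {0..2*pi} (\<lambda>t. u (cis t))"
      by (rule continuous_on_compose2[OF u]) (auto intro!: continuous_intros)
    interpret finite_measure circle_angle by (rule finite_measure_circle_angle)
    have "(LINT t|circle_angle. poly p (cis t)) = of_real (2 * pi) * poly p 0"
      by (rule mean_value_cis) (auto intro!: continuous_intros holomorphic_intros)
    then have "2 * pi * Re (poly p 0) = Re (LINT t|circle_angle. poly p (cis t))"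
      by simp
    also have "\<dots> = (LINT t|circle_angle. Re (poly p (cis t)))"
      by (rule integral_Re[symmetric]) (rule continuous_imp_integrable_circle_angle[OF cont_p])
    also have "\<dots> \<le> (LINT t|circle_angle. u (cis t) + 1/2)"
    proof (rule integral_mono)
      show "integrable circle_angle (\<lambda>t. Re (poly p (cis t)))"
        by (intro continuous_imp_integrable_circle_angle continuous_intros)
      show "integrable circle_angle (\<lambda>t. u (cis t) + 1/2)"
        by (intro continuous_imp_integrable_circle_angle continuous_intros cont_u)
      show "Re (poly p (cis t)) \<le> u (cis t) + 1/2" for t
        using p[of "cis t"] by (simp add: abs_if split: if_splits)
    qed
    also have "\<dots> = (LINT t|circle_angle. u (cis t)) + 2 * pi * (1/2)"
      using continuous_imp_integrable_circle_angle[OF cont_u] measure_circle_angle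
      by (subst Bochner_Integration.integral_add) (simp_all del: measure_restrict_space)
    finally show ?thesis
      unfolding circle_mean_eq by (simp add: field_simps)
  qed
  then have "norm (G 0) \<ge> exp (- circle_mean u - 1)"
    unfolding G_def norm_exp_eq_Re by simp
  then show ?thesis
    using that[of G] hol norm_G norm_fG by (auto simp: G_def u_def)
qed


text \<open>The multipliers of the dilates of \<open>f\<close> form a normal family. Their lower
  bound at 0 is uniform in the radius, so the limit does not vanish identically, and Hurwitz's
  theorem then excludes all zeros.\<close>

lemma nevanlinna_bounded_multiplier:
  assumes holf: "f holomorphic_on unit_disc"
    and R: "\<And>n. 0 < R n" "\<And>n. R n < 1" "R \<longlonglongrightarrow> 1"
    and L: "\<And>n. circle_mean (\<lambda>\<zeta>. log_plus (norm (f (of_real (R n) * \<zeta>)))) \<le> L"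
  obtains g where "g holomorphic_on unit_disc"
    "\<And>z. z \<in> unit_disc \<Longrightarrow> g z \<noteq> 0"
    "\<And>z. z \<in> unit_disc \<Longrightarrow> norm (g z) \<le> 1"
    "\<And>z. z \<in> unit_disc \<Longrightarrow> norm (f z * g z) \<le> 1"
proof -
  have "\<exists>G. G holomorphic_on UNIV \<and> (\<forall>z. G z \<noteq> 0) \<and> (\<forall>z. norm z \<le> 1 \<longrightarrow> norm (G z) \<le> 1) \<and>
     (\<forall>z. norm z \<le> 1 \<longrightarrow> norm (f (of_real (R n) * z) * G z) \<le> 1) \<and> norm (G 0) \<ge> exp (- L - 1)" for n
  proof -
    have hol: "(\<lambda>z. f (of_real (R n) * z)) holomorphic_on cball 0 1"
      by (rule holomorphic_on_dilate(2)[OF holf]) (use R in \<open>auto simp: abs_of_pos\<close>)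
    obtain G where G: "G holomorphic_on UNIV" "\<And>z. G z \<noteq> 0" "\<And>z. norm z \<le> 1 \<Longrightarrow> norm (G z) \<le> 1"
      "\<And>z. norm z \<le> 1 \<Longrightarrow> norm (f (of_real (R n) * z) * G z) \<le> 1"
      "norm (G 0) \<ge> exp (- circle_mean (\<lambda>\<zeta>. log_plus (norm (f (of_real (R n) * \<zeta>)))) - 1)"
      using bounded_multiplier_on_disc[OF holomorphic_on_imp_continuous_on[OF hol]
        holomorphic_on_subset[OF hol ball_subset_cball]] by metis
    have "exp (- L - 1) \<le> norm (G 0)"
      by (rule order_trans[OF _ G(5)]) (use L[of n] in simp)
    then show ?thesis using G(1-4) by blast
  qed
  then obtain G where G: "\<And>n. G n holomorphic_on UNIV" "\<And>n z. G n z \<noteq> 0"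
    "\<And>n z. norm z \<le> 1 \<Longrightarrow> norm (G n z) \<le> 1"
    "\<And>n z. norm z \<le> 1 \<Longrightarrow> norm (f (of_real (R n) * z) * G n z) \<le> 1"
    "\<And>n. norm (G n 0) \<ge> exp (- L - 1)"
    by metis
  obtain g k where g: "g holomorphic_on unit_disc" "strict_mono (k :: nat \<Rightarrow> nat)"
    "\<And>x. x \<in> unit_disc \<Longrightarrow> ((\<lambda>n. G (k n) x) \<longlonglongrightarrow> g x)"
    "\<And>K. \<lbrakk>compact K; K \<subseteq> unit_disc\<rbrakk> \<Longrightarrow> uniform_limit K (G \<circ> k) g sequentially"
  proof (rule Montel[of unit_disc "range G" G])
    show "\<exists>B. \<forall>h\<in>range G. \<forall>z\<in>K. norm (h z) \<le> B" if "compact K" "K \<subseteq> unit_disc" for K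
      using that G(3) by (intro exI[of _ 1]) (force simp: subset_iff)
    show "h holomorphic_on unit_disc" if "h \<in> range G" for h
      using that G(1) holomorphic_on_subset by blast
  qed auto
  have zero_in: "0 \<in> unit_disc" by simp
  have "exp (- L - 1) \<le> norm (g 0)"
    by (rule tendsto_lowerbound[OF tendsto_norm[OF g(3)[OF zero_in]]]) (use G(5) in auto)
  then have g0: "g 0 \<noteq> 0" by auto
  have nz: "g z \<noteq> 0" if "z \<in> unit_disc" for z
  proof (cases "g constant_on unit_disc")
    case True
    then show ?thesis using that g0 zero_in unfolding constant_on_def by metis
  next
    case False
    show ?thesis
    proof (rule Hurwitz_no_zeros[of unit_disc "G \<circ> k" g])
      show "(G \<circ> k) n holomorphic_on unit_disc" for n
        using G(1) holomorphic_on_subset by (metis comp_apply subset_UNIV)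
    qed (use g that False G(2) in auto)
  qed
  have le1: "norm (g z) \<le> 1" if "z \<in> unit_disc" for z
    by (rule tendsto_upperbound[OF tendsto_norm[OF g(3)[OF that]]]) (use G(3) that in auto)
  have "norm (f z * g z) \<le> 1" if "z \<in> unit_disc" for z
  proof -
    have "(\<lambda>n. of_real (R (k n)) * z) \<longlonglongrightarrow> of_real 1 * z"
      using LIMSEQ_subseq_LIMSEQ[OF R(3) g(2)] by (intro tendsto_intros) (simp add: o_def)
    moreover have "isCont f z"
      using that holf holomorphic_on_imp_continuous_on continuous_on_interior
      by (metis interior_ball)
    ultimately have "(\<lambda>n. f (of_real (R (k n)) * z)) \<longlonglongrightarrow> f z"
      by (metis isCont_tendsto_compose mult_1 of_real_1)
    then have "(\<lambda>n. norm (f (of_real (R (k n)) * z) * G (k n) z)) \<longlonglongrightarrow> norm (f z * g z)"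
      by (intro tendsto_intros g(3) that)
    then show ?thesis
      by (rule tendsto_upperbound) (use G(4) that in auto)
  qed
  then show ?thesis using that[of g] g(1) nz le1 by blast
qed

subsection \<open>Zeros of Nevanlinna functions\<close>

abbreviation blaschke :: "complex \<Rightarrow> complex \<Rightarrow> complex" where
  "blaschke \<equiv> Moebius_function 0"

lemma one_minus_cnj_mult_nonzero:
  assumes "norm a < 1" "norm z \<le> 1"
  shows "1 - cnj a * z \<noteq> 0"
proof
  assume "1 - cnj a * z = 0"
  then have "norm (cnj a * z) = 1" by simp
  moreover have "norm (cnj a * z) < 1"
    using assms mult_mono[of "norm z" 1 "norm a" "norm a"] by (simp add: norm_mult mult.commute)
  ultimately show False by simp
qed

lemma blaschke_eq_0_iff:
  assumes "norm a < 1" "norm z < 1"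
  shows "blaschke a z = 0 \<longleftrightarrow> z = a"
  using one_minus_cnj_mult_nonzero[of a z] assms by (auto simp: Moebius_function_simple)

lemma one_minus_norm_blaschke_squared:
  assumes "norm a < 1" "norm z < 1"
  shows "1 - (norm (blaschke a z))\<^sup>2 = (1 - (norm a)\<^sup>2) * (1 - (norm z)\<^sup>2) / (norm (1 - cnj a * z))\<^sup>2"
proof -
  have nz: "1 - cnj a * z \<noteq> 0" using one_minus_cnj_mult_nonzero assms by simp
  have "(norm (1 - cnj a * z))\<^sup>2 - (norm (z - a))\<^sup>2 = (1 - (norm a)\<^sup>2) * (1 - (norm z)\<^sup>2)"
    unfolding cmod_power2 by (simp add: power2_eq_square algebra_simps)
  then show ?thesis
    using nz by (simp add: Moebius_function_simple norm_divide field_simps)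
qed

text \<open>A disc automorphism moves the zero to the origin, where the Schwarz lemma bounds the
  quotient by \<open>z\<close>.\<close>

lemma bounded_zero_factor:
  assumes hol: "f holomorphic_on unit_disc" and le: "\<And>z. z \<in> unit_disc \<Longrightarrow> norm (f z) \<le> 1"
    and a: "a \<in> unit_disc" "f a = 0"
  obtains h where "h holomorphic_on unit_disc" "\<And>z. z \<in> unit_disc \<Longrightarrow> norm (h z) \<le> 1"
    "\<And>z. z \<in> unit_disc \<Longrightarrow> f z = blaschke a z * h z"
proof -
  have blaschke_image: "blaschke b ` unit_disc \<subseteq> unit_disc" if "b \<in> unit_disc" for b
    using Moebius_function_norm_lt_1[of b _ 0] that by auto
  have blaschke_in: "blaschke b z \<in> unit_disc" if "b \<in> unit_disc" "z \<in> unit_disc" for b z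
    using Moebius_function_norm_lt_1[of b z 0] that by simp
  have ma: "- a \<in> unit_disc" using a by simp
  define F where "F = (\<lambda>z. f (blaschke (- a) z))"
  have holF: "F holomorphic_on unit_disc"
    unfolding F_def
    using holomorphic_on_compose_gen[OF Moebius_function_holomorphic hol, of "- a" 0] blaschke_image[OF ma] a
    by (auto simp: o_def)
  have F0: "F 0 = 0"
    using a by (simp add: F_def Moebius_function_simple)
  have F_le: "norm (F z) \<le> 1" if "norm z < 1" for z
    using le blaschke_in[OF ma, of z] that by (simp add: F_def)
  obtain h where h: "h holomorphic_on unit_disc" "\<And>z. norm z < 1 \<Longrightarrow> F z = z * h z" "deriv F 0 = h 0"
    using Schwarz3[OF holF F0] by blast
  have h_le: "norm (h z) \<le> 1" if z: "norm z < 1" for z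
  proof (rule field_le_epsilon)
    fix e :: real assume e: "e > 0"
    \<comment> \<open>The Schwarz lemma is applied to functions of modulus strictly below 1, while
      only \<open>norm (F z) \<le> 1\<close> is known. Scaling by \<open>c\<close> makes the bound
      strict and costs a factor \<open>1 + e\<close>.\<close>
    define c where "c = 1 / (1 + e)"
    have c: "0 < c" "c < 1" using e by (auto simp: c_def)
    define Fc where "Fc = (\<lambda>z. of_real c * F z)"
    have Fc: "Fc holomorphic_on ball 0 1" "Fc 0 = 0" 
      using holF F0 by (auto simp: Fc_def intro!: holomorphic_intros)
    have Fc_lt: "norm (Fc z) < 1" if "norm z < 1" for z
    proof -
      have "c * norm (F z) \<le> c * 1" using F_le[OF that] c by (intro mult_left_mono) auto
      then have "c * norm (F z) < 1" using c by linarith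
      then show ?thesis using c by (simp add: Fc_def norm_mult)
    qed
    have "c * norm (h z) \<le> 1"
    proof (cases "z = 0")
      case True
      have "deriv Fc 0 = of_real c * deriv F 0"
        unfolding Fc_def using holF by (intro deriv_cmult holomorphic_on_imp_differentiable_at[of _ unit_disc]) auto
      then show ?thesis
        using Schwarz_Lemma(2)[OF Fc Fc_lt z] True h(3) c by (simp add: norm_mult)
    next
      case False
      then show ?thesis
        using Schwarz_Lemma(1)[OF Fc Fc_lt z] h(2)[OF z] c
        by (simp add: norm_mult Fc_def)
    qed
    then show "norm (h z) \<le> 1 + e" using e by (simp add: c_def field_simps)
  qed
  show ?thesis
  proof (rule that[of "\<lambda>z. h (blaschke a z)"])
    show "(\<lambda>z. h (blaschke a z)) holomorphic_on unit_disc"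
      using holomorphic_on_compose_gen[OF Moebius_function_holomorphic h(1), of a 0] blaschke_image[OF a(1)] a
      by (auto simp: o_def)
    fix z assume z: "z \<in> unit_disc"
    have b: "norm (blaschke a z) < 1" using blaschke_in[OF a(1) z] by simp
    show "norm (h (blaschke a z)) \<le> 1" by (rule h_le[OF b])
    have "blaschke (- a) (blaschke a z) = z"
      by (rule Moebius_function_compose) (use a z in auto)
    then show "f z = blaschke a z * h (blaschke a z)"
      using h(2)[OF b] by (simp add: F_def)
  qed
qed

text \<open>Zeros are divided out one at a time. The quotient keeps the remaining ones because a
  Blaschke factor vanishes only at its own point, so the induction has to run over all
  \<open>f\<close>.\<close>

lemma norm_le_prod_blaschke:
  assumes "finite Z" "Z \<subseteq> unit_disc" "f holomorphic_on unit_disc"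
    "\<And>z. z \<in> unit_disc \<Longrightarrow> norm (f z) \<le> 1" "\<And>a. a \<in> Z \<Longrightarrow> f a = 0" "z \<in> unit_disc"
  shows "norm (f z) \<le> (\<Prod>a\<in>Z. norm (blaschke a z))"
  using assms
proof (induction Z arbitrary: f rule: finite_induct)
  case empty
  then show ?case by simp
next
  case (insert a Z)
  obtain h where h: "h holomorphic_on unit_disc" "\<And>z. z \<in> unit_disc \<Longrightarrow> norm (h z) \<le> 1"
    "\<And>z. z \<in> unit_disc \<Longrightarrow> f z = blaschke a z * h z"
    using bounded_zero_factor[of f a] insert.prems by auto
  have "norm (h z) \<le> (\<Prod>a\<in>Z. norm (blaschke a z))"
  proof (rule insert.IH)
    show "h b = 0" if "b \<in> Z" for b
    proof -
      have "b \<in> unit_disc" "a \<in> unit_disc" "b \<noteq> a" "f b = 0"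
        using that insert by auto
      then show ?thesis using h(3)[of b] blaschke_eq_0_iff[of a b] by auto
    qed
  qed (use h insert.prems in auto)
  then show ?case
    using h(3)[of z] insert by (simp add: norm_mult mult_left_mono)
qed

text \<open>Evaluating at a point \<open>w\<close> with \<open>f w \<noteq> 0\<close> instead of at
  0 covers the case \<open>f 0 = 0\<close>. There the finite Blaschke products decay exponentially
  in the partial sums, yet stay above \<open>norm (f w)\<close>.\<close>

lemma bounded_zeros_blaschke:
  fixes l :: "nat \<Rightarrow> complex"
  assumes hol: "f holomorphic_on unit_disc" and le: "\<And>z. z \<in> unit_disc \<Longrightarrow> norm (f z) \<le> 1"
    and l: "\<And>n. l n \<in> unit_disc" "inj l" "\<And>n. f (l n) = 0"
    and w: "w \<in> unit_disc" "f w \<noteq> 0"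
  shows "summable (\<lambda>n. 1 - norm (l n))"
proof (rule summableI_nonneg_bounded)
  \<comment> \<open>The 8 is the square of the bound 2 for \<open>norm (1 - cnj (l n) * w)\<close>,
    times the 2 in \<open>1 - b\<^sup>2 \<le> 2 * (1 - b)\<close>.\<close>
  define c where "c = (1 - (norm w)\<^sup>2) / 8"
  have c: "c > 0" using w by (simp add: c_def power_less_one_iff abs_square_less_1)
  show "1 - norm (l n) \<ge> 0" for n using l(1)[of n] by simp
  have b: "c * (1 - norm (l n)) \<le> 1 - norm (blaschke (l n) w)" for n
  proof -
    let ?a = "l n"
    have a: "norm ?a < 1" and w1: "norm w < 1" using l(1)[of n] w by auto
    let ?b = "norm (blaschke ?a w)"
    have b1: "?b \<le> 1" using Moebius_function_norm_lt_1[OF a w1, of 0] by simp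
    have d: "norm (1 - cnj ?a * w) \<le> 2"
    proof -
      have "norm (cnj ?a * w) \<le> 1 * 1"
        unfolding norm_mult using a w1 by (intro mult_mono) auto
      then show ?thesis using norm_triangle_ineq4[of 1 "cnj ?a * w"] by simp
    qed
    have d0: "norm (1 - cnj ?a * w) > 0" using one_minus_cnj_mult_nonzero[OF a, of w] w1 by simp
    have "(norm (1 - cnj ?a * w))\<^sup>2 \<le> 2\<^sup>2" using d by (intro power_mono) auto
    moreover have "(norm ?a)\<^sup>2 \<le> norm ?a"
      using a by (simp add: power2_eq_square mult_left_le)
    moreover have "1 - (norm w)\<^sup>2 \<ge> 0" using w1 by (simp add: abs_square_le_1)
    ultimately have "(1 - norm ?a) * (1 - (norm w)\<^sup>2) / 4 \<le> 1 - ?b\<^sup>2"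
      unfolding one_minus_norm_blaschke_squared[OF a w1]
      using a d0 by (intro frac_le mult_right_mono mult_nonneg_nonneg) auto
    also have "\<dots> \<le> 2 * (1 - ?b)"
      using b1 zero_le_power2[of "1 - ?b"] by (simp add: power2_eq_square algebra_simps)
    finally show ?thesis by (simp add: c_def field_simps)
  qed
  show "(\<Sum>i<N. 1 - norm (l i)) \<le> - ln (norm (f w)) / c" for N
  proof -
    have "norm (f w) \<le> (\<Prod>a\<in>l ` {..<N}. norm (blaschke a w))"
      by (rule norm_le_prod_blaschke) (use assms in auto)
    also have "\<dots> = (\<Prod>n<N. norm (blaschke (l n) w))"
      using l(2) by (simp add: prod.reindex inj_on_subset)
    also have "\<dots> \<le> (\<Prod>n<N. exp (- (c * (1 - norm (l n)))))"
    proof (rule prod_mono)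
      fix n
      show "0 \<le> norm (blaschke (l n) w) \<and> norm (blaschke (l n) w) \<le> exp (- (c * (1 - norm (l n))))"
        using b[of n] exp_ge_add_one_self[of "- (c * (1 - norm (l n)))"] by simp
    qed
    also have "\<dots> = exp (- c * (\<Sum>n<N. 1 - norm (l n)))"
      by (simp add: sum_distrib_left flip: exp_sum sum_negf)
    finally have "ln (norm (f w)) \<le> - c * (\<Sum>n<N. 1 - norm (l n))"
      using w(2) ln_le_cancel_iff[of "norm (f w)" "exp (- c * (\<Sum>n<N. 1 - norm (l n)))"] by simp
    then show ?thesis using c by (simp add: field_simps)
  qed
qed

text \<open>A fixed sequence tending to 1 that replaces radial limits by sequential ones, as
  measurability of limits and Fatou's lemma require. The offset 2 keeps \<open>radius 0\<close>
  positive.\<close>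

definition radius :: "nat \<Rightarrow> real" where
  "radius n = 1 - 1 / real (n + 2)"

lemma radius_bounds: "0 < radius n" "radius n < 1"
  by (auto simp: radius_def field_simps)

lemma radius_tendsto: "radius \<longlonglongrightarrow> 1"
proof -
  have "(\<lambda>n. 1 - 1 / real (n + 2)) \<longlonglongrightarrow> 1 - 0"
    by (intro tendsto_diff tendsto_const LIMSEQ_ignore_initial_segment[OF lim_const_over_n])
  then show ?thesis by (simp add: radius_def[abs_def])
qed

lemma radius_filterlim: "filterlim radius (at_left 1) sequentially"
  unfolding filterlim_at using radius_tendsto radius_bounds
  by (auto simp: less_imp_neq)

lemma nevanlinna_radii:
  assumes f: "f \<in> nevanlinna_class"
  obtains R L where "\<And>n::nat. 0 < R n" "\<And>n. R n < 1" "R \<longlonglongrightarrow> 1"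
    "\<And>n. circle_mean (\<lambda>\<zeta>. log_plus (norm (f (of_real (R n) * \<zeta>)))) \<le> (L::real)"
proof -
  let ?m = "\<lambda>r. circle_mean (\<lambda>\<zeta>. log_plus (norm (f (of_real r * \<zeta>))))"
  obtain L where "(?m \<longlongrightarrow> L) (at_left 1)"
    using f by (auto simp: nevanlinna_class_def)
  then have "(\<lambda>n. ?m (radius n)) \<longlonglongrightarrow> L"
    by (rule filterlim_compose[OF _ radius_filterlim])
  then have "\<forall>\<^sub>F n in sequentially. ?m (radius n) < L + 1"
    by (rule order_tendstoD) simp
  then obtain N where N: "\<And>n. n \<ge> N \<Longrightarrow> ?m (radius n) < L + 1"
    by (auto simp: eventually_sequentially)
  show ?thesis
  proof (rule that[of "\<lambda>n. radius (n + N)" "L + 1"])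
    show "(\<lambda>n. radius (n + N)) \<longlonglongrightarrow> 1"
      by (rule LIMSEQ_ignore_initial_segment[OF radius_tendsto])
    show "?m (radius (n + N)) \<le> L + 1" for n
      using N[of "n + N"] by simp
  qed (rule radius_bounds)+
qed

lemma nevanlinna_zeros_blaschke:
  fixes l :: "nat \<Rightarrow> complex"
  assumes f: "f \<in> nevanlinna_class"
    and l: "\<And>n. l n \<in> unit_disc" "inj l" "\<And>n. f (l n) = 0"
    and w: "w \<in> unit_disc" "f w \<noteq> 0"
  shows "summable (\<lambda>n. 1 - norm (l n))"
proof -
  obtain R L where R: "\<And>n. 0 < R n" "\<And>n. R n < 1" "R \<longlonglongrightarrow> 1"
    and L: "\<And>n. circle_mean (\<lambda>\<zeta>. log_plus (norm (f (of_real (R n) * \<zeta>)))) \<le> (L::real)"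
    by (rule nevanlinna_radii[OF f]) blast
  have hol: "f holomorphic_on unit_disc" using f by (simp add: nevanlinna_class_def)
  obtain g where g: "g holomorphic_on unit_disc" "\<And>z. z \<in> unit_disc \<Longrightarrow> g z \<noteq> 0"
    "\<And>z. z \<in> unit_disc \<Longrightarrow> norm (f z * g z) \<le> 1"
    using nevanlinna_bounded_multiplier[OF hol R L] by metis
  show ?thesis
    by (rule bounded_zeros_blaschke[of "\<lambda>z. f z * g z" l w])
       (use g l w hol in \<open>auto intro!: holomorphic_intros\<close>)
qed

subsection \<open>The nontangential maximal function\<close>

text \<open>Only comparability of chord and arc is needed later, so 1/2 replaces the sharp constant.
  It follows from \<open>y * cos y \<le> sin y\<close> at half the angle and the double angle
  formulas.\<close>

lemma sin_ge_half:
  fixes x :: real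
  assumes "0 \<le> x" "x \<le> pi / 2"
  shows "x / 2 \<le> sin x"
proof -
  have *: "y * cos y \<le> sin y" if "0 \<le> y" "y \<le> pi / 2" for y :: real
  proof -
    have "sin 0 - 0 * cos 0 \<le> sin y - y * cos y"
    proof (rule DERIV_nonneg_imp_nondecreasing[OF that(1)])
      fix u assume u: "0 \<le> u" "u \<le> y"
      have "((\<lambda>y. sin y - y * cos y) has_real_derivative u * sin u) (at u)"
        by (auto intro!: derivative_eq_intros)
      moreover have "0 \<le> u * sin u"
        using u that pi_gt_zero by (intro mult_nonneg_nonneg sin_ge_zero) linarith+
      ultimately show "\<exists>d. ((\<lambda>y. sin y - y * cos y) has_real_derivative d) (at u) \<and> 0 \<le> d"
        by blast
    qed
    then show ?thesis by simp
  qed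
  have c: "cos (x / 2) \<ge> 0" using assms pi_gt_zero by (intro cos_ge_zero) linarith+
  have cx: "cos x \<ge> 0" using assms pi_gt_zero by (intro cos_ge_zero) linarith+
  have "cos x = 2 * (cos (x / 2))\<^sup>2 - 1" using cos_double_cos[of "x / 2"] by simp
  then have "(cos (x / 2))\<^sup>2 - cos x / 2 = 1 / 2" by linarith
  then have "x / 2 = x * ((cos (x / 2))\<^sup>2 - cos x / 2)" by simp
  also have "\<dots> \<le> x * (cos (x / 2))\<^sup>2"
    using assms cx by (intro mult_left_mono) auto
  also have "\<dots> = 2 * (x / 2 * cos (x / 2)) * cos (x / 2)"
    by (simp add: power2_eq_square)
  also have "\<dots> \<le> 2 * sin (x / 2) * cos (x / 2)"
    using assms c *[of "x / 2"] by (intro mult_right_mono) auto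
  also have "\<dots> = sin x"
    using sin_double[of "x / 2"] by simp
  finally show ?thesis .
qed

lemma norm_cis_diff: "norm (cis s - cis t) = 2 * \<bar>sin ((s - t) / 2)\<bar>"
proof -
  have "(norm (cis s - cis t))\<^sup>2 = 2 - 2 * cos (s - t)"
    unfolding cmod_power2
    using sin_cos_squared_add[of s] sin_cos_squared_add[of t]
    by (simp add: cos_diff power2_eq_square algebra_simps)
  also have "\<dots> = (2 * \<bar>sin ((s - t) / 2)\<bar>)\<^sup>2"
  proof -
    have "2 * ((s - t) / 2) = s - t" by simp
    then have "cos (s - t) = 1 - 2 * (sin ((s - t) / 2))\<^sup>2"
      using cos_double_sin[of "(s - t) / 2"] by presburger
    then show ?thesis by (simp add: power_mult_distrib)
  qed
  finally show ?thesis by (rule power2_eq_imp_eq) simp_all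
qed

lemma norm_cis_diff_ge:
  assumes "\<bar>s - t\<bar> \<le> pi"
  shows "\<bar>s - t\<bar> / 2 \<le> norm (cis s - cis t)"
proof -
  have "\<bar>s - t\<bar> / 2 / 2 \<le> sin (\<bar>s - t\<bar> / 2)"
    by (rule sin_ge_half) (use assms in auto)
  also have "\<dots> \<le> \<bar>sin ((s - t) / 2)\<bar>"
  proof -
    have "\<bar>s - t\<bar> / 2 = (s - t) / 2 \<or> \<bar>s - t\<bar> / 2 = - ((s - t) / 2)"
      by (cases "s - t < 0") (simp_all only: abs_if if_True if_False minus_divide_left simp_thms)
    then show ?thesis by (metis sin_minus abs_ge_self abs_minus_cancel)
  qed
  finally show ?thesis by (simp add: norm_cis_diff)
qed

text \<open>The difference quotient \<open>Q\<close> of \<open>F\<close> at \<open>\<zeta>\<close>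
  is bounded by \<open>\<mu>\<close> on the circle, hence on the disc by the maximum principle.
  Cauchy's inequality on the disc of radius \<open>1 - norm z\<close> around \<open>z\<close> then
  bounds the derivative, since points of that disc are within
  \<open>(\<alpha> + 1) * (1 - norm z)\<close> of \<open>\<zeta>\<close>. It is used in
  contrapositive form: a large derivative in the Stolz region forces a large difference quotient
  along the circle.\<close>

lemma norm_le_on_stolz_region:
  assumes F: "F holomorphic_on ball 0 \<rho>" "\<rho> > 1" and z0: "norm \<zeta> = 1"
    and le: "\<And>w. norm w = 1 \<Longrightarrow> norm (F w - F \<zeta>) \<le> \<mu> * norm (w - \<zeta>)"
    and z: "z \<in> stolz_region \<alpha> \<zeta>"
  shows "norm (deriv F z) \<le> (\<alpha> + 1) * \<mu>"
proof -
  define Q where "Q = (\<lambda>w. if w = \<zeta> then deriv F \<zeta> else (F w - F \<zeta>) / (w - \<zeta>))"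
  have holQ: "Q holomorphic_on ball 0 \<rho>"
    unfolding Q_def by (rule pole_lemma_open) (use F in auto)
  have cb: "cball 0 1 \<subseteq> ball (0 :: complex) \<rho>" using F(2) by auto
  have Q_sphere: "norm (Q w) \<le> \<mu>" if "norm w = 1" "w \<noteq> \<zeta>" for w
    using le[OF that(1)] that by (simp add: Q_def norm_divide field_simps)
  have Q_sphere': "norm (Q w) \<le> \<mu>" if "norm w = 1" for w
  proof (cases "w = \<zeta>")
    case True
    \<comment> \<open>At \<open>\<zeta>\<close> itself the bound holds by continuity, as the point
      is not isolated in the circle.\<close>
    have "\<zeta> islimpt sphere 0 1"
    proof (rule connected_imp_perfect)
      show "connected (sphere 0 1 :: complex set)" by (rule connected_sphere) simp
      have "(1::complex) \<in> sphere 0 1" "(- 1::complex) \<in> sphere 0 1" "(1::complex) \<noteq> - 1" by auto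
      then show "sphere (0::complex) 1 \<noteq> {x}" for x by (metis singletonD)
    qed (use z0 in simp)
    then have "at \<zeta> within sphere 0 1 \<noteq> bot"
      by (simp add: trivial_limit_within)
    moreover have "continuous_on (sphere 0 1) Q"
      using holomorphic_on_imp_continuous_on[OF holQ] by (rule continuous_on_subset) (use F(2) in auto)
    then have "((\<lambda>w. norm (Q w)) \<longlongrightarrow> norm (Q \<zeta>)) (at \<zeta> within sphere 0 1)"
      using z0 by (intro tendsto_norm) (simp add: continuous_on_def)
    moreover have "\<forall>\<^sub>F w in at \<zeta> within sphere 0 1. norm (Q w) \<le> \<mu>"
      using Q_sphere by (auto simp: eventually_at_filter)
    ultimately show ?thesis
      unfolding True by (intro tendsto_upperbound[where F = "at \<zeta> within sphere 0 1"])
  qed (rule Q_sphere[OF that])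
  have Q_le: "norm (Q w) \<le> \<mu>" if "norm w \<le> 1" for w
  proof (rule maximum_modulus_frontier[of Q "cball 0 1"])
    show "Q holomorphic_on interior (cball 0 1)"
      using holQ F(2) by (auto intro: holomorphic_on_subset)
    show "continuous_on (closure (cball 0 1)) Q"
      using holomorphic_on_imp_continuous_on[OF holQ] cb by (auto intro: continuous_on_subset)
  qed (use that Q_sphere' in auto)
  have F_le: "norm (F w - F \<zeta>) \<le> \<mu> * norm (w - \<zeta>)" if "norm w \<le> 1" for w
    using Q_le[OF that] by (cases "w = \<zeta>") (auto simp: Q_def norm_divide field_simps)
  have mu: "\<mu> \<ge> 0" using order_trans[OF norm_ge_zero Q_le[of 0]] by simp
  define d where "d = 1 - norm z"
  have d: "d > 0" "norm (z - \<zeta>) \<le> \<alpha> * d" using z by (auto simp: stolz_region_def d_def)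
  have sub: "cball z d \<subseteq> cball 0 1"
  proof
    fix x assume "x \<in> cball z d"
    then show "x \<in> cball 0 1"
      using norm_triangle_ineq2[of x z] by (simp add: d_def dist_norm norm_minus_commute)
  qed
  have "norm ((deriv ^^ 1) (\<lambda>w. F w - F \<zeta>) z) \<le> fact 1 * (\<mu> * ((\<alpha> + 1) * d)) / d ^ 1"
  proof (rule Cauchy_inequality)
    have hol: "(\<lambda>w. F w - F \<zeta>) holomorphic_on cball z d"
      using F sub cb by (intro holomorphic_intros) (auto intro: holomorphic_on_subset)
    show "(\<lambda>w. F w - F \<zeta>) holomorphic_on ball z d" "continuous_on (cball z d) (\<lambda>w. F w - F \<zeta>)"
      using hol holomorphic_on_imp_continuous_on by (auto intro: holomorphic_on_subset)
    fix x assume x: "norm (z - x) = d"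
    then have "x \<in> cball z d" by (simp add: dist_norm)
    then have "norm x \<le> 1" using sub by auto
    then have "norm (F x - F \<zeta>) \<le> \<mu> * norm (x - \<zeta>)" by (rule F_le)
    also have "norm (x - \<zeta>) \<le> norm (z - \<zeta>) + norm (z - x)"
      using norm_triangle_ineq4[of "z - \<zeta>" "z - x"] by simp
    also have "norm (z - \<zeta>) + norm (z - x) \<le> (\<alpha> + 1) * d"
      using x d by (simp add: distrib_right)
    finally show "norm (F x - F \<zeta>) \<le> \<mu> * ((\<alpha> + 1) * d)"
      using mu by (simp add: mult_left_mono)
  qed fact
  moreover have "deriv (\<lambda>w. F w - F \<zeta>) z = deriv F z"
  proof -
    have "z \<in> ball 0 \<rho>" using z F(2) by (auto simp: stolz_region_def)
    then have "F field_differentiable at z"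
      using F(1) by (intro holomorphic_on_imp_differentiable_at) auto
    then show ?thesis by simp
  qed
  ultimately show ?thesis using d by (simp add: mult.commute)
qed

section \<open>Weak type estimate by a Vitali covering\<close>

text \<open>Vitali's lemma selects a countable family indexed by real numbers, so subadditivity is
  phrased with an integral over counting measure instead of a series.\<close>

lemma emeasure_UN_countable_le:
  assumes "countable I" "\<And>i. i \<in> I \<Longrightarrow> X i \<in> sets M"
  shows "emeasure M (\<Union>i\<in>I. X i) \<le> (\<integral>\<^sup>+i. emeasure M (X i) \<partial>count_space I)"
proof -
  have meas: "(\<Union>i\<in>I. X i) \<in> sets M" using assms by auto
  have "emeasure M (\<Union>i\<in>I. X i) = (\<integral>\<^sup>+x. indicator (\<Union>i\<in>I. X i) x \<partial>M)"
    using meas by simp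
  also have "\<dots> \<le> (\<integral>\<^sup>+x. \<integral>\<^sup>+i. indicator (X i) x \<partial>count_space I \<partial>M)"
  proof (rule nn_integral_mono)
    fix x
    show "indicator (\<Union>i\<in>I. X i) x \<le> (\<integral>\<^sup>+i. indicator (X i) x \<partial>count_space I)"
    proof (cases "x \<in> (\<Union>i\<in>I. X i)")
      case True
      then obtain j where j: "j \<in> I" "x \<in> X j" by blast
      have "1 = (\<integral>\<^sup>+i. indicator {j} i \<partial>count_space I)"
        using j by simp
      also have "\<dots> \<le> (\<integral>\<^sup>+i. indicator (X i) x \<partial>count_space I)"
        using j by (intro nn_integral_mono) (auto simp: indicator_def)
      finally show ?thesis using True by simp
    qed simp
  qed
  also have "\<dots> = (\<integral>\<^sup>+i. \<integral>\<^sup>+x. indicator (X i) x \<partial>M \<partial>count_space I)"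
    by (rule nn_integral_count_space_nn_integral) (use assms in auto)
  also have "\<dots> = (\<integral>\<^sup>+i. emeasure M (X i) \<partial>count_space I)"
    using assms by (intro nn_integral_cong) auto
  finally show ?thesis .
qed

text \<open>An arc from a point of \<open>{0..2 * pi}\<close> to a point at distance at most
  \<open>pi\<close> stays within these three periods.\<close>

lemma nn_integral_circle_three_periods:
  fixes W :: "real \<Rightarrow> ennreal"
  assumes [measurable]: "W \<in> borel_measurable borel" and per: "\<And>u. W (u + 2 * pi) = W u"
  shows "(\<integral>\<^sup>+u. W u * indicator {- (2 * pi)..4 * pi} u \<partial>lborel) \<le> 3 * (\<integral>\<^sup>+u. W u * indicator {0..2 * pi} u \<partial>lborel)"
proof -
  let ?I = "\<integral>\<^sup>+u. W u * indicator {0..2 * pi} u \<partial>lborel"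
  have per': "W (u - 2 * pi) = W u" for u using per[of "u - 2 * pi"] by simp
  have shift: "(\<integral>\<^sup>+u. W u * indicator {0..2 * pi} (u + c) \<partial>lborel) = ?I" if "\<And>u. W (u + c) = W u" for c
    using nn_integral_real_affine[of "\<lambda>u. W u * indicator {0..2 * pi} u" 1 c] that
    by (simp add: add.commute)
  have "(\<integral>\<^sup>+u. W u * indicator {- (2 * pi)..4 * pi} u \<partial>lborel)
     \<le> (\<integral>\<^sup>+u. (W u * indicator {0..2 * pi} (u + 2 * pi) + W u * indicator {0..2 * pi} (u + 0)) +
           W u * indicator {0..2 * pi} (u + - (2 * pi)) \<partial>lborel)"
    by (intro nn_integral_mono) (auto simp: indicator_def)
  also have "\<dots> = (?I + ?I) + ?I"
    by (subst nn_integral_add; (subst nn_integral_add)?; (subst shift)?; simp add: per per' shift)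
  also have "\<dots> = 3 * ?I"
  proof -
    have "3 * ?I = (2 + 1) * ?I" by simp
    then show ?thesis by (simp only: distrib_right mult_1_left mult_2)
  qed
  finally show ?thesis .
qed

lemma nn_integral_norm_ge_increment:
  assumes F: "\<And>z. z \<in> ball 0 \<rho> \<Longrightarrow> (F has_field_derivative g z) (at z)"
    and g: "continuous_on (ball 0 \<rho>) g" and "\<rho> > 1" "a \<le> b"
  shows "ennreal (norm (F (cis b) - F (cis a))) \<le> (\<integral>\<^sup>+u. ennreal (norm (g (cis u))) * indicator {a..b} u \<partial>lborel)"
proof -
  have cont: "continuous_on A (\<lambda>u. g (cis u))" for A
    by (rule continuous_on_compose2[OF g]) (use assms in \<open>auto intro!: continuous_intros\<close>)
  have contn: "continuous_on {a..b} (\<lambda>u. norm (g (cis u)))"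
    by (intro continuous_intros cont)
  have FTC: "((\<lambda>u. g (cis u) * (\<i> * cis u)) has_integral F (cis b) - F (cis a)) {a..b}"
  proof (rule fundamental_theorem_of_calculus[OF \<open>a \<le> b\<close>, where f = "\<lambda>u. F (cis u)"])
    fix u :: real
    have "((\<lambda>u. F (exp (\<i> * of_real u))) has_vector_derivative (\<i> * exp (\<i> * of_real u)) * g (exp (\<i> * of_real u))) (at u)"
    proof (rule field_vector_diff_chain_at[where f = "\<lambda>u. exp (\<i> * of_real u)" and g = F, unfolded o_def])
      show "((\<lambda>u. exp (\<i> * of_real u)) has_vector_derivative \<i> * exp (\<i> * of_real u)) (at u)"
        by (auto intro!: derivative_eq_intros has_vector_derivative_real_field)
      show "(F has_field_derivative g (exp (\<i> * of_real u))) (at (exp (\<i> * of_real u)))"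
        by (rule F) (use assms in \<open>simp add: norm_exp_i_times\<close>)
    qed
    then show "((\<lambda>u. F (cis u)) has_vector_derivative g (cis u) * (\<i> * cis u)) (at u within {a..b})"
      by (auto simp: cis_conv_exp mult.commute intro: has_vector_derivative_at_within)
  qed
  have int: "((\<lambda>u. norm (g (cis u))) has_integral integral {a..b} (\<lambda>u. norm (g (cis u)))) {a..b}"
    using integrable_continuous_real[OF contn] by (rule integrable_integral)
  have "norm (F (cis b) - F (cis a)) \<le> integral {a..b} (\<lambda>u. norm (g (cis u)))"
    unfolding integral_unique[OF FTC, symmetric]
    by (rule integral_norm_bound_integral[OF has_integral_integrable[OF FTC] has_integral_integrable[OF int]])
       (simp add: norm_mult)
  also have "ennreal (integral {a..b} (\<lambda>u. norm (g (cis u)))) =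
     (\<integral>\<^sup>+u. ennreal (if u \<in> {a..b} then norm (g (cis u)) else 0) \<partial>lborel)"
  proof (rule nn_integral_has_integral_lborel[symmetric])
    have [measurable]: "(\<lambda>u. g (cis u)) \<in> borel_measurable borel"
      by (rule borel_measurable_continuous_onI[OF cont])
    show "(\<lambda>u. if u \<in> {a..b} then norm (g (cis u)) else 0) \<in> borel_measurable borel"
      by measurable
  qed (use int in \<open>simp_all only: has_integral_restrict_UNIV\<close>, simp)
  also have "\<dots> = (\<integral>\<^sup>+u. ennreal (norm (g (cis u))) * indicator {a..b} u \<partial>lborel)"
    by (intro nn_integral_cong) (auto simp: indicator_def)
  finally show ?thesis by (simp add: ennreal_leI)
qed

text \<open>Let \<open>F\<close> be a primitive of \<open>g\<close>. If \<open>norm (g z)\<close>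
  exceeds \<open>c\<close> somewhere in the Stolz region at \<open>cis t\<close>, then some
  difference quotient of \<open>F\<close> along the circle from \<open>cis t\<close> exceeds
  \<open>\<mu>\<close>, so the integral of \<open>norm g\<close> over the arc from \<open>t\<close>
  to \<open>s t\<close> is at least \<open>\<mu>\<close> times half its length. Disjoint arcs among
  these, enlarged five times, cover the exceptional set.\<close>

lemma stolz_maximal_estimate:
  assumes g: "g holomorphic_on ball 0 \<rho>" "\<rho> > 1" and lam: "c > 0" and alpha: "\<alpha> \<ge> 0"
  shows "emeasure lborel {t \<in> {0..2 * pi}. \<exists>z\<in>stolz_region \<alpha> (cis t). norm (g z) > c}
    \<le> ennreal (30 * (\<alpha> + 1) / c) * (\<integral>\<^sup>+u. ennreal (norm (g (cis u))) * indicator {0..2 * pi} u \<partial>lborel)"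
proof -
  define S where "S = {t \<in> {0..2 * pi}. \<exists>z\<in>stolz_region \<alpha> (cis t). norm (g z) > c}"
  \<comment> \<open>Chosen so that difference quotients bounded by \<open>\<mu>\<close> would bound
    the derivative in the Stolz region by \<open>(\<alpha> + 1) * \<mu> = c\<close>.\<close>
  define \<mu> where "\<mu> = c / (\<alpha> + 1)"
  have mu: "\<mu> > 0" "(\<alpha> + 1) * \<mu> = c" using lam alpha by (auto simp: \<mu>_def)
  define W where "W = (\<lambda>u. ennreal (norm (g (cis u))))"
  have "continuous_on UNIV (\<lambda>u. norm (g (cis u)))"
    by (intro continuous_intros continuous_on_compose2[OF holomorphic_on_imp_continuous_on[OF g(1)]])
       (use g(2) in auto)
  then have [measurable]: "W \<in> borel_measurable borel"
    unfolding W_def by (intro measurable_compose[OF borel_measurable_continuous_onI measurable_ennreal])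
  let ?I = "\<integral>\<^sup>+u. W u * indicator {0..2 * pi} u \<partial>lborel"
  obtain F where F0: "\<And>x. x \<in> ball 0 \<rho> \<Longrightarrow> (F has_field_derivative g x) (at x within ball 0 \<rho>)"
    using holomorphic_convex_primitive'[OF convex_ball open_ball g(1)] by blast
  have F: "(F has_field_derivative g x) (at x)" if "x \<in> ball 0 \<rho>" for x
    using F0[OF that] that by (simp add: at_within_open[OF _ open_ball])
  have holF: "F holomorphic_on ball 0 \<rho>"
    unfolding holomorphic_on_def field_differentiable_def using F0 by blast
  have ex: "\<exists>s. s \<noteq> t \<and> \<bar>s - t\<bar> \<le> pi \<and> \<mu> * \<bar>s - t\<bar> / 2 \<le> norm (F (cis s) - F (cis t))" if t: "t \<in> S" for t
  proof -
    obtain z where z: "z \<in> stolz_region \<alpha> (cis t)" "norm (g z) > c"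
      using t unfolding S_def by blast
    have "z \<in> ball 0 \<rho>" using z g(2) by (auto simp: stolz_region_def)
    then have "deriv F z = g z" by (intro DERIV_imp_deriv F)
    then have "\<not> (\<forall>w. norm w = 1 \<longrightarrow> norm (F w - F (cis t)) \<le> \<mu> * norm (w - cis t))"
      using norm_le_on_stolz_region[OF holF g(2), of "cis t" \<mu> z \<alpha>] z mu by auto
    then obtain w where w: "norm w = 1" "norm (F w - F (cis t)) > \<mu> * norm (w - cis t)"
      by (auto simp: not_le)
    define x where "x = Arg (w / cis t)"
    have "w / cis t \<noteq> 0" using w by auto
    then have "cis x = w / cis t"
      unfolding x_def using w by (simp add: cis_Arg sgn_div_norm norm_divide)
    then have cw: "w = cis (t + x)" by (simp add: cis_mult[symmetric])
    have x: "\<bar>x\<bar> \<le> pi" using Arg_bounded[of "w / cis t"] by (simp add: x_def abs_le_iff)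
    have "\<mu> * (\<bar>(t + x) - t\<bar> / 2) \<le> \<mu> * norm (cis (t + x) - cis t)"
      using mu norm_cis_diff_ge[of "t + x" t] x by (intro mult_left_mono) auto
    moreover have "x \<noteq> 0" using w cw by auto
    ultimately show ?thesis
      using w x by (intro exI[of _ "t + x"]) (simp add: cw)
  qed
  obtain s where s: "\<And>t. t \<in> S \<Longrightarrow> s t \<noteq> t" "\<And>t. t \<in> S \<Longrightarrow> \<bar>s t - t\<bar> \<le> pi"
    "\<And>t. t \<in> S \<Longrightarrow> \<mu> * \<bar>s t - t\<bar> / 2 \<le> norm (F (cis (s t)) - F (cis t))"
    using ex by metis
  define a where "a = (\<lambda>t. (s t + t) / 2)"
  define r where "r = (\<lambda>t. \<bar>s t - t\<bar> / 2)"
  have cb: "cball (a t) (r t) = {min (s t) t..max (s t) t}" for t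
    unfolding cball_eq_atLeastAtMost a_def r_def by (auto simp: abs_if min_def max_def field_simps)
  obtain C where C: "countable C" "C \<subseteq> S"
     "pairwise (\<lambda>i j. disjnt (cball (a i) (r i)) (cball (a j) (r j))) C"
     "S \<subseteq> (\<Union>i\<in>C. cball (a i) (5 * r i))"
  proof (rule Vitali_covering_lemma_cballs[where S = S and K = S and a = a and r = r and B = pi])
    show "S \<subseteq> (\<Union>i\<in>S. cball (a i) (r i))" unfolding cb by force
    show "0 < r i \<and> r i \<le> pi" if "i \<in> S" for i
      using s(1,2)[OF that] pi_gt_zero by (auto simp: r_def)
  qed
  \<comment> \<open>Treating the integral of \<open>norm g\<close> as a measure turns the sum over
    disjoint arcs into the measure of their union.\<close>
  define \<nu> where "\<nu> = density lborel (\<lambda>u. W u * indicator {- (2 * pi)..4 * pi} u)"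
  have nu: "emeasure \<nu> (cball (a t) (r t)) = (\<integral>\<^sup>+u. W u * indicator (cball (a t) (r t)) u \<partial>lborel)" if "t \<in> S" for t
  proof -
    have "cball (a t) (r t) \<subseteq> {- (2 * pi)..4 * pi}"
      using that s(2)[OF that] pi_gt_zero unfolding cb S_def by (auto simp: abs_le_iff)
    then show ?thesis
      unfolding \<nu>_def by (subst emeasure_density) (auto intro!: nn_integral_cong simp: indicator_def)
  qed
  \<comment> \<open>The 10 is the fivefold enlargement divided by the 1/2 in the increment bound.
    The three periods raise it to the 30 of the statement.\<close>
  have key: "emeasure lborel (cball (a t) (5 * r t)) \<le> ennreal (10 / \<mu>) * emeasure \<nu> (cball (a t) (r t))" if t: "t \<in> S" for t
  proof -
    have "emeasure lborel (cball (a t) (5 * r t)) = ennreal (5 * \<bar>s t - t\<bar>)"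
      unfolding cball_eq_atLeastAtMost by (subst emeasure_lborel_Icc) (auto simp: r_def)
    also have "\<dots> \<le> ennreal (10 / \<mu> * norm (F (cis (s t)) - F (cis t)))"
      using s(3)[OF t] mu by (intro ennreal_leI) (simp add: field_simps)
    also have "\<dots> = ennreal (10 / \<mu>) * ennreal (norm (F (cis (s t)) - F (cis t)))"
      using mu by (intro ennreal_mult) auto
    also have "norm (F (cis (s t)) - F (cis t)) = norm (F (cis (max (s t) t)) - F (cis (min (s t) t)))"
      by (auto simp: max_def min_def norm_minus_commute)
    also have "ennreal \<dots> \<le> (\<integral>\<^sup>+u. W u * indicator {min (s t) t..max (s t) t} u \<partial>lborel)"
      unfolding W_def
      by (rule nn_integral_norm_ge_increment[OF F holomorphic_on_imp_continuous_on[OF g(1)] g(2)]) auto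
    also have "\<dots> = emeasure \<nu> (cball (a t) (r t))"
      using nu[OF t] unfolding cb by simp
    finally show ?thesis by (simp add: mult_left_mono)
  qed
  have "emeasure lborel S \<le> emeasure lborel (\<Union>i\<in>C. cball (a i) (5 * r i))"
    by (rule emeasure_mono[OF C(4)]) (use C(1) in auto)
  also have "\<dots> \<le> (\<integral>\<^sup>+i. emeasure lborel (cball (a i) (5 * r i)) \<partial>count_space C)"
    by (rule emeasure_UN_countable_le) (use C(1) in auto)
  also have "\<dots> \<le> (\<integral>\<^sup>+i. ennreal (10 / \<mu>) * emeasure \<nu> (cball (a i) (r i)) \<partial>count_space C)"
    using key C(2) by (intro nn_integral_mono) auto
  also have "\<dots> = ennreal (10 / \<mu>) * (\<integral>\<^sup>+i. emeasure \<nu> (cball (a i) (r i)) \<partial>count_space C)"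
    by (rule nn_integral_cmult) simp
  also have "(\<integral>\<^sup>+i. emeasure \<nu> (cball (a i) (r i)) \<partial>count_space C) = emeasure \<nu> (\<Union>i\<in>C. cball (a i) (r i))"
  proof (rule emeasure_UN_countable[symmetric])
    show "disjoint_family_on (\<lambda>i. cball (a i) (r i)) C"
      using C(3) by (auto simp: disjoint_family_on_def pairwise_def disjnt_def)
  qed (use C(1) in \<open>auto simp: \<nu>_def\<close>)
  also have "\<dots> \<le> emeasure \<nu> (space \<nu>)"
    by (rule emeasure_space)
  also have "\<dots> = (\<integral>\<^sup>+u. W u * indicator {- (2 * pi)..4 * pi} u \<partial>lborel)"
    unfolding \<nu>_def by (subst emeasure_density) (auto simp: space_density)
  also have "\<dots> \<le> 3 * ?I"
  proof (rule nn_integral_circle_three_periods)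
    show "W (u + 2 * pi) = W u" for u by (simp add: W_def flip: cis_mult)
  qed simp
  also have "ennreal (10 / \<mu>) * (3 * ?I) = ennreal (30 * (\<alpha> + 1) / c) * ?I"
  proof -
    have "ennreal (10 / \<mu>) * 3 = ennreal (10 / \<mu> * 3)"
      using mu by (subst ennreal_mult) auto
    also have "10 / \<mu> * 3 = 30 * (\<alpha> + 1) / c" by (simp add: \<mu>_def)
    finally show ?thesis by (simp flip: mult.assoc)
  qed
  finally show ?thesis unfolding S_def W_def by (simp add: mult_left_mono)
qed

text \<open>For fixed \<open>z\<close> the condition on \<open>t\<close> is open, so the set is a
  union of open sets whatever \<open>P\<close> is. This makes the exceptional sets
  measurable.\<close>

lemma open_Collect_stolz_region: "open {t. \<exists>z\<in>stolz_region \<alpha> (cis t). P z}"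
proof -
  have "{t. \<exists>z\<in>stolz_region \<alpha> (cis t). P z}
      = (\<Union>z\<in>{z. norm z < 1 \<and> P z}. {t. norm (z - cis t) < \<alpha> * (1 - norm z)})"
    by (auto simp: stolz_region_def)
  moreover have "open {t. norm (z - cis t) < \<alpha> * (1 - norm z)}" for z
    by (intro open_Collect_less continuous_intros)
  ultimately show ?thesis by (auto intro!: open_UN)
qed

lemma open_stolz_region: "open (stolz_region \<alpha> \<zeta>)"
proof -
  have "open {z. norm (z - \<zeta>) < \<alpha> * (1 - norm z)}"
    by (intro open_Collect_less continuous_intros)
  moreover have "stolz_region \<alpha> \<zeta> = unit_disc \<inter> {z. norm (z - \<zeta>) < \<alpha> * (1 - norm z)}"
    by (auto simp: stolz_region_def)
  ultimately show ?thesis by auto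
qed

text \<open>\<open>f\<close> need not extend beyond the disc, so the estimate is applied to dilates.
  Stolz regions are open, so with \<open>z\<close> they contain \<open>z / radius j\<close> for all
  large \<open>j\<close>. The exceptional set therefore lies in the increasing union of the
  \<open>T k\<close>, and each \<open>T k\<close> is contained in the exceptional set of a
  dilate.\<close>

lemma stolz_maximal_estimate_disc:
  assumes f: "f holomorphic_on unit_disc" and c: "c > 0" and alpha: "\<alpha> \<ge> 0"
    and A: "\<And>R. 0 < R \<Longrightarrow> R < 1 \<Longrightarrow>
      (\<integral>\<^sup>+u. ennreal (norm (f (of_real R * cis u))) * indicator {0..2 * pi} u \<partial>lborel) \<le> A"
  shows "emeasure lborel {t \<in> {0..2 * pi}. \<exists>z\<in>stolz_region \<alpha> (cis t). norm (f z) > c}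
    \<le> ennreal (30 * (\<alpha> + 1) / c) * A"
proof -
  define S where "S = (\<lambda>j. {t \<in> {0..2 * pi}. \<exists>z\<in>stolz_region \<alpha> (cis t). norm (f (of_real (radius j) * z)) > c})"
  define T where "T = (\<lambda>k. \<Inter>j\<in>{k..}. S j)"
  have S_sets[measurable]: "S j \<in> sets lborel" for j
  proof -
    have "S j = {0..2 * pi} \<inter> {t. \<exists>z\<in>stolz_region \<alpha> (cis t). norm (f (of_real (radius j) * z)) > c}"
      by (auto simp: S_def)
    then show ?thesis using open_Collect_stolz_region by simp
  qed
  have T_sets: "T k \<in> sets lborel" for k
    unfolding T_def by (intro sets.countable_INT' image_subsetI S_sets) auto
  have S_le: "emeasure lborel (S j) \<le> ennreal (30 * (\<alpha> + 1) / c) * A" for j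
  proof -
    have hol: "(\<lambda>z. f (of_real (radius j) * z)) holomorphic_on ball 0 (1 / \<bar>radius j\<bar>)"
      by (rule holomorphic_on_dilate(1)[OF f]) (use radius_bounds[of j] in auto)
    have "emeasure lborel (S j) \<le> ennreal (30 * (\<alpha> + 1) / c) *
       (\<integral>\<^sup>+u. ennreal (norm (f (of_real (radius j) * cis u))) * indicator {0..2 * pi} u \<partial>lborel)"
      unfolding S_def
      by (rule stolz_maximal_estimate[OF hol _ c alpha]) (use radius_bounds[of j] in auto)
    also have "\<dots> \<le> ennreal (30 * (\<alpha> + 1) / c) * A"
      by (intro mult_left_mono A radius_bounds) auto
    finally show ?thesis .
  qed
  have "{t \<in> {0..2 * pi}. \<exists>z\<in>stolz_region \<alpha> (cis t). norm (f z) > c} \<subseteq> (\<Union>k. T k)"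
  proof
    fix t assume "t \<in> {t \<in> {0..2 * pi}. \<exists>z\<in>stolz_region \<alpha> (cis t). norm (f z) > c}"
    then obtain z where t: "t \<in> {0..2 * pi}" and z: "z \<in> stolz_region \<alpha> (cis t)" "norm (f z) > c"
      by blast
    have "(\<lambda>j. z / of_real (radius j)) \<longlonglongrightarrow> z / of_real 1"
      by (intro tendsto_intros radius_tendsto) simp
    then have "\<forall>\<^sub>F j in sequentially. z / of_real (radius j) \<in> stolz_region \<alpha> (cis t)"
      using z(1) open_stolz_region by (simp add: topological_tendstoD)
    then obtain k where k: "\<And>j. j \<ge> k \<Longrightarrow> z / of_real (radius j) \<in> stolz_region \<alpha> (cis t)"
      by (auto simp: eventually_sequentially)
    have "t \<in> S j" if "j \<ge> k" for j
    proof -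
      have "of_real (radius j) * (z / of_real (radius j)) = z" using radius_bounds[of j] by simp
      then show ?thesis using k[OF that] t z(2) unfolding S_def by force
    qed
    then show "t \<in> (\<Union>k. T k)" unfolding T_def by blast
  qed
  then have "emeasure lborel {t \<in> {0..2 * pi}. \<exists>z\<in>stolz_region \<alpha> (cis t). norm (f z) > c}
      \<le> emeasure lborel (\<Union>k. T k)"
    by (rule emeasure_mono) (use T_sets in auto)
  also have "\<dots> = (SUP k. emeasure lborel (T k))"
  proof (rule SUP_emeasure_incseq[symmetric])
    show "range T \<subseteq> sets lborel" using T_sets by auto
    show "incseq T" unfolding T_def by (rule incseq_SucI) force
  qed
  also have "\<dots> \<le> ennreal (30 * (\<alpha> + 1) / c) * A"
  proof (rule SUP_least)
    fix k
    have "emeasure lborel (T k) \<le> emeasure lborel (S k)"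
      by (rule emeasure_mono) (use S_sets in \<open>auto simp: T_def\<close>)
    then show "emeasure lborel (T k) \<le> ennreal (30 * (\<alpha> + 1) / c) * A"
      using S_le order_trans by blast
  qed
  finally show ?thesis .
qed

section \<open>Orthogonality of monomials and Parseval's identity\<close>

lemma integral_circle_monomials:
  "(LINT t|circle_angle. cis t ^ i * cnj (cis t ^ j)) = (if i = j then of_real (2 * pi) else 0)"
proof -
  have pos: "(LINT t|circle_angle. cis t ^ k) = of_real (2 * pi) * 0 ^ k" for k
    by (rule mean_value_cis) (auto intro!: continuous_intros holomorphic_intros)
  have one: "cis t ^ n * cnj (cis t) ^ n = 1" for t n
    by (simp add: cis_cnj power_mult_distrib[symmetric] cis_mult)
  have le: "cis t ^ i * cnj (cis t ^ j) = cis t ^ (i - j)" if "j \<le> i" for t i j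
  proof -
    have "cis t ^ i * cnj (cis t ^ j) = cis t ^ (i - j) * (cis t ^ j * cnj (cis t) ^ j)"
      using that by (simp flip: power_add mult.assoc)
    then show ?thesis by (simp only: one mult_1_right)
  qed
  show ?thesis
  proof (cases "j \<le> i")
    case True
    have "(LINT t|circle_angle. cis t ^ i * cnj (cis t ^ j)) = (LINT t|circle_angle. cis t ^ (i - j))"
      by (rule Bochner_Integration.integral_cong[OF refl le[OF True]])
    then show ?thesis unfolding pos using True by (auto simp: power_0_left)
  next
    case False
    have "cis t ^ i * cnj (cis t ^ j) = cnj (cis t ^ (j - i))" for t
    proof -
      have "cis t ^ i * cnj (cis t ^ j) = cnj (cis t ^ j * cnj (cis t ^ i))" by (simp add: mult.commute)
      also have "\<dots> = cnj (cis t ^ (j - i))" using False by (subst le) auto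
      finally show ?thesis .
    qed
    then have "(LINT t|circle_angle. cis t ^ i * cnj (cis t ^ j)) = (LINT t|circle_angle. cnj (cis t ^ (j - i)))"
      by (intro Bochner_Integration.integral_cong refl)
    also have "\<dots> = cnj (LINT t|circle_angle. cis t ^ (j - i))"
      by (rule Bochner_Integration.integral_cnj)
    finally show ?thesis unfolding pos using False by (auto simp: power_0_left)
  qed
qed

lemma parseval_polynomial:
  "(LINT t|circle_angle. (norm (\<Sum>n<N. c n * cis t ^ n))\<^sup>2) = 2 * pi * (\<Sum>n<N. (norm (c n))\<^sup>2)"
proof -
  have int: "integrable circle_angle (\<lambda>t. c i * cnj (c j) * (cis t ^ i * cnj (cis t ^ j)))" for i j
    by (intro continuous_imp_integrable_circle_angle continuous_intros)
  have "of_real (LINT t|circle_angle. (norm (\<Sum>n<N. c n * cis t ^ n))\<^sup>2)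
      = (LINT t|circle_angle. complex_of_real ((norm (\<Sum>n<N. c n * cis t ^ n))\<^sup>2))"
    by (rule integral_complex_of_real[symmetric])
  also have "\<dots> = (LINT t|circle_angle. (\<Sum>i<N. \<Sum>j<N. c i * cnj (c j) * (cis t ^ i * cnj (cis t ^ j))))"
  proof (rule Bochner_Integration.integral_cong[OF refl])
    fix t
    have "complex_of_real ((norm (\<Sum>n<N. c n * cis t ^ n))\<^sup>2) = (\<Sum>n<N. c n * cis t ^ n) * cnj (\<Sum>n<N. c n * cis t ^ n)"
      by (rule complex_norm_square)
    also have "\<dots> = (\<Sum>i<N. \<Sum>j<N. (c i * cis t ^ i) * cnj (c j * cis t ^ j))"
      by (simp only: cnj_sum sum_product)
    finally show "complex_of_real ((norm (\<Sum>n<N. c n * cis t ^ n))\<^sup>2) =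
        (\<Sum>i<N. \<Sum>j<N. c i * cnj (c j) * (cis t ^ i * cnj (cis t ^ j)))"
      by (simp add: mult_ac)
  qed
  also have "\<dots> = (\<Sum>i<N. \<Sum>j<N. c i * cnj (c j) * (LINT t|circle_angle. cis t ^ i * cnj (cis t ^ j)))"
    by (subst Bochner_Integration.integral_sum, (intro Bochner_Integration.integrable_sum int),
        subst Bochner_Integration.integral_sum, rule int, simp only: integral_mult_right_zero)
  also have "\<dots> = (\<Sum>i<N. c i * cnj (c i) * of_real (2 * pi))"
    unfolding integral_circle_monomials by (intro sum.cong refl) (simp add: if_distrib cong: if_cong)
  also have "\<dots> = of_real (2 * pi * (\<Sum>n<N. (norm (c n))\<^sup>2))"
    by (simp add: complex_norm_square[symmetric] sum_distrib_left mult.commute)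
  finally show ?thesis by (simp only: of_real_eq_iff)
qed

lemma parseval:
  assumes "summable (\<lambda>n. norm (c n))"
  shows "(\<lambda>n. (norm (c n))\<^sup>2) sums ((LINT t|circle_angle. (norm (\<Sum>n. c n * cis t ^ n))\<^sup>2) / (2 * pi))"
proof -
  interpret finite_measure circle_angle by (rule finite_measure_circle_angle)
  have nc: "norm (c n * cis t ^ n) = norm (c n)" for n t by (simp add: norm_mult norm_power)
  have summ: "summable (\<lambda>n. c n * cis t ^ n)" for t
    by (rule summable_norm_cancel) (simp only: nc assms)
  have lim: "(\<lambda>N. LINT t|circle_angle. (norm (\<Sum>n<N. c n * cis t ^ n))\<^sup>2) \<longlonglongrightarrow>
      (LINT t|circle_angle. (norm (\<Sum>n. c n * cis t ^ n))\<^sup>2)"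
  proof (rule integral_dominated_convergence[where w = "\<lambda>_. (\<Sum>n. norm (c n))\<^sup>2"])
    have meas: "(\<lambda>t. (norm (\<Sum>n<N. c n * cis t ^ n))\<^sup>2) \<in> borel_measurable circle_angle" for N
      by (rule borel_measurable_integrable)
         (intro continuous_imp_integrable_circle_angle continuous_intros)
    show "(\<lambda>t. (norm (\<Sum>n<N. c n * cis t ^ n))\<^sup>2) \<in> borel_measurable circle_angle" for N by (rule meas)
    have conv: "(\<lambda>N. (norm (\<Sum>n<N. c n * cis t ^ n))\<^sup>2) \<longlonglongrightarrow> (norm (\<Sum>n. c n * cis t ^ n))\<^sup>2" for t
      by (intro tendsto_intros summable_LIMSEQ summ)
    show "(\<lambda>t. (norm (\<Sum>n. c n * cis t ^ n))\<^sup>2) \<in> borel_measurable circle_angle"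
      by (rule borel_measurable_LIMSEQ_metric[OF meas conv])
    show "AE t in circle_angle. (\<lambda>N. (norm (\<Sum>n<N. c n * cis t ^ n))\<^sup>2) \<longlonglongrightarrow> (norm (\<Sum>n. c n * cis t ^ n))\<^sup>2"
      using conv by simp
    show "AE t in circle_angle. norm ((norm (\<Sum>n<N. c n * cis t ^ n))\<^sup>2) \<le> (\<Sum>n. norm (c n))\<^sup>2" for N
    proof (rule AE_I2)
      fix t
      have "norm (\<Sum>n<N. c n * cis t ^ n) \<le> (\<Sum>n<N. norm (c n))"
        by (rule order_trans[OF norm_sum]) (simp only: nc)
      also have "\<dots> \<le> (\<Sum>n. norm (c n))"
        by (rule sum_le_suminf[OF assms]) auto
      finally show "norm ((norm (\<Sum>n<N. c n * cis t ^ n))\<^sup>2) \<le> (\<Sum>n. norm (c n))\<^sup>2"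
        by (simp add: power_mono)
    qed
  qed simp
  show ?thesis
    unfolding sums_def
    using tendsto_divide[OF lim tendsto_const[of "2 * pi"]] unfolding parseval_polynomial by simp
qed

subsection \<open>Fatou's theorem\<close>

text \<open>In the application \<open>c n\<close> is a Taylor coefficient times a power of the
  dilation radius, and \<open>d\<close> consists of the squared moduli of the shifted coefficients
  without that power. So the bound does not depend on the radius.\<close>

lemma parseval_remainder:
  assumes "summable (\<lambda>n. norm (c n))" "\<And>n. (norm (c (n + N)))\<^sup>2 \<le> d n" "summable d"
    and f: "\<And>t. f t = (\<Sum>n. c n * cis t ^ n) - (\<Sum>n<N. c n * cis t ^ n)"
  shows "(LINT t|circle_angle. (norm (f t))\<^sup>2) \<le> 2 * pi * suminf d"
proof -
  define e where "e = (\<lambda>n. if n < N then 0 else c n)"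
  have e: "summable (\<lambda>n. norm (e n))"
    by (rule summable_comparison_test'[OF assms(1), of 0]) (auto simp: e_def)
  have nc: "norm (c n * cis t ^ n) = norm (c n)" for n t by (simp add: norm_mult norm_power)
  have summ: "summable (\<lambda>n. c n * cis t ^ n)" for t
    by (rule summable_norm_cancel) (simp only: nc assms)
  have f': "f t = (\<Sum>n. e n * cis t ^ n)" for t
  proof -
    have "(\<lambda>n. c n * cis t ^ n - (if n < N then c n * cis t ^ n else 0)) sums
        ((\<Sum>n. c n * cis t ^ n) - (\<Sum>n<N. c n * cis t ^ n))"
      by (intro sums_diff summable_sums summ)
         (use sums_If_finite[of "\<lambda>n. n < N" "\<lambda>n. c n * cis t ^ n"] in \<open>simp add: lessThan_def\<close>)
    moreover have "c n * cis t ^ n - (if n < N then c n * cis t ^ n else 0) = e n * cis t ^ n" for n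
      by (simp add: e_def)
    ultimately show ?thesis unfolding f by (simp add: sums_iff)
  qed
  have "(\<lambda>n. (norm (e n))\<^sup>2) sums ((LINT t|circle_angle. (norm (f t))\<^sup>2) / (2 * pi))"
    unfolding f' by (rule parseval[OF e])
  then have "(\<lambda>n. (norm (e (n + N)))\<^sup>2) sums ((LINT t|circle_angle. (norm (f t))\<^sup>2) / (2 * pi))"
    using sums_split_initial_segment[of _ _ N] by (force simp: e_def)
  then have "(LINT t|circle_angle. (norm (f t))\<^sup>2) / (2 * pi) \<le> suminf d"
    by (rule sums_le[OF _ _ summable_sums[OF assms(3)], rotated]) (use assms(2) in \<open>simp add: e_def\<close>)
  then show ?thesis by (simp add: field_simps)
qed

text \<open>\<open>P\<close> is a Taylor polynomial. Bessel's inequality makes the squared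
  coefficients summable, so the tail is small in square mean on all circles at once. The conclusion
  is about the mean because the weak type estimate takes that as its input.\<close>

lemma bounded_polynomial_approximation:
  fixes f :: "complex \<Rightarrow> complex"
  assumes hol: "f holomorphic_on unit_disc" and le: "\<And>z. z \<in> unit_disc \<Longrightarrow> norm (f z) \<le> 1" and "e > 0"
  obtains P where "continuous_on UNIV P" "P holomorphic_on UNIV"
    "\<And>R. 0 < R \<Longrightarrow> R < 1 \<Longrightarrow>
      (\<integral>\<^sup>+u. ennreal (norm (f (of_real R * cis u) - P (of_real R * cis u))) * indicator {0..2 * pi} u \<partial>lborel)
        \<le> ennreal (2 * pi * e)"
proof -
  define a where "a = (\<lambda>n. (deriv ^^ n) f 0 / fact n)"
  have sums: "(\<lambda>n. a n * z ^ n) sums f z" if "norm z < 1" for z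
    using holomorphic_power_series[OF hol, of z] that by (simp add: a_def)
  have summ: "summable (\<lambda>n. norm (a n * z ^ n))" if z: "norm z < 1" for z
  proof -
    obtain s where s: "norm z < s" "s < 1" using dense[OF z] by blast
    then have "norm (complex_of_real s) < 1" "norm z < norm (complex_of_real s)"
      using norm_ge_zero[of z] by (auto simp del: norm_ge_zero)
    then show ?thesis by (rule powser_insidea[OF sums_summable[OF sums]])
  qed
  have contf: "continuous_on unit_disc f" by (rule holomorphic_on_imp_continuous_on[OF hol])
  have fint: "integrable circle_angle (\<lambda>t. (norm (f (of_real R * cis t)))\<^sup>2)" if "0 < R" "R < 1" for R
    using that by (intro continuous_imp_integrable_circle_angle continuous_intros
      continuous_on_circle_dilate[OF contf]) auto
  interpret finite_measure circle_angle by (rule finite_measure_circle_angle)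
  have cR: "summable (\<lambda>n. norm (a n * of_real R ^ n))" if "0 < R" "R < 1" for R
    using that by (intro summ) simp
  have series: "f (of_real R * cis t) = (\<Sum>n. (a n * of_real R ^ n) * cis t ^ n)" if "0 < R" "R < 1" for R t
    using sums[of "of_real R * cis t"] that
    by (simp add: sums_iff norm_mult power_mult_distrib mult.assoc)
  have bessel: "(\<Sum>n<N. (norm (a n))\<^sup>2) \<le> 1" for N
  proof -
    have R: "(\<Sum>n<N. (norm (a n * of_real R ^ n))\<^sup>2) \<le> 1" if "0 < R" "R < 1" for R :: real
    proof -
      have "(\<lambda>n. (norm (a n * of_real R ^ n))\<^sup>2) sums
          ((LINT t|circle_angle. (norm (f (of_real R * cis t)))\<^sup>2) / (2 * pi))"
        using parseval[OF cR[OF that]] unfolding series[OF that] .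
      then have "(\<Sum>n<N. (norm (a n * of_real R ^ n))\<^sup>2) \<le> (LINT t|circle_angle. (norm (f (of_real R * cis t)))\<^sup>2) / (2 * pi)"
        unfolding sums_iff using sum_le_suminf[of "\<lambda>n. (norm (a n * of_real R ^ n))\<^sup>2" "{..<N}"] by auto
      also have "(LINT t|circle_angle. (norm (f (of_real R * cis t)))\<^sup>2) \<le> (LINT t|circle_angle. 1)"
        by (rule integral_mono[OF fint[OF that]])
           (use le that in \<open>auto simp: norm_mult power_le_one\<close>)
      also have "\<dots> = 2 * pi"
        using measure_circle_angle by simp
      finally show ?thesis by (simp add: divide_right_mono)
    qed
    have "(\<lambda>k. \<Sum>n<N. (norm (a n * of_real (radius k) ^ n))\<^sup>2) \<longlonglongrightarrow> (\<Sum>n<N. (norm (a n * of_real 1 ^ n))\<^sup>2)"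
      by (intro tendsto_intros radius_tendsto)
    then have "(\<Sum>n<N. (norm (a n * of_real 1 ^ n))\<^sup>2) \<le> 1"
      by (rule tendsto_upperbound) (use R radius_bounds in auto)
    then show ?thesis by simp
  qed
  have sa: "summable (\<lambda>n. (norm (a n))\<^sup>2)"
    by (rule summableI_nonneg_bounded[OF _ bessel]) simp
  have "0 < e\<^sup>2" using \<open>e > 0\<close> by simp
  from suminf_exist_split[OF this sa]
  obtain N where "norm (\<Sum>n. (norm (a (n + N)))\<^sup>2) < e\<^sup>2" by blast
  then have N: "(\<Sum>n. (norm (a (n + N)))\<^sup>2) \<le> e\<^sup>2" by (simp add: abs_less_iff)
  define P where "P = (\<lambda>z. \<Sum>n<N. a n * z ^ n)"
  show ?thesis
  proof (rule that[of P])
    show contP: "continuous_on UNIV P" unfolding P_def by (intro continuous_intros)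
    show "P holomorphic_on UNIV" unfolding P_def by (intro holomorphic_intros)
    fix R :: real assume R: "0 < R" "R < 1"
    define g where "g = (\<lambda>t. f (of_real R * cis t) - P (of_real R * cis t))"
    have contg: "continuous_on A g" for A
      unfolding g_def using R
      by (intro continuous_intros continuous_on_circle_dilate[OF contf] continuous_on_compose2[OF contP]) auto
    have L2: "(LINT t|circle_angle. (norm (g t))\<^sup>2) \<le> 2 * pi * e\<^sup>2"
    proof -
      have "(LINT t|circle_angle. (norm (g t))\<^sup>2) \<le> 2 * pi * (\<Sum>n. (norm (a (n + N)))\<^sup>2)"
      proof (rule parseval_remainder[OF cR[OF R]])
        show "(norm (a (n + N) * of_real R ^ (n + N)))\<^sup>2 \<le> (norm (a (n + N)))\<^sup>2" for n
          using R by (intro power_mono) (auto simp: norm_mult norm_power power_le_one mult_left_le)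
        show "summable (\<lambda>n. (norm (a (n + N)))\<^sup>2)" using summable_ignore_initial_segment[OF sa] .
        show "g t = (\<Sum>n. a n * of_real R ^ n * cis t ^ n) - (\<Sum>n<N. a n * of_real R ^ n * cis t ^ n)" for t
          unfolding g_def series[OF R] P_def by (simp add: power_mult_distrib mult.assoc)
      qed
      also have "\<dots> \<le> 2 * pi * e\<^sup>2" using N by (intro mult_left_mono) auto
      finally show ?thesis .
    qed
    \<comment> \<open>The inequality of arithmetic and geometric means passes from the square mean
      to the mean; each of the two summands contributes at most \<open>pi * e\<close>.\<close>
    have "(LINT t|circle_angle. norm (g t)) \<le> (LINT t|circle_angle. e / 2 + (norm (g t))\<^sup>2 / (2 * e))"
    proof (rule integral_mono)
      show "integrable circle_angle (\<lambda>t. norm (g t))" "integrable circle_angle (\<lambda>t. e / 2 + (norm (g t))\<^sup>2 / (2 * e))"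
        using \<open>e > 0\<close> by (auto intro!: continuous_imp_integrable_circle_angle continuous_intros contg)
      fix t
      have "2 * e * norm (g t) \<le> e\<^sup>2 + (norm (g t))\<^sup>2"
        using sum_squares_bound[of e "norm (g t)"] .
      then show "norm (g t) \<le> e / 2 + (norm (g t))\<^sup>2 / (2 * e)"
        using \<open>e > 0\<close> by (simp add: field_simps power2_eq_square)
    qed
    also have "\<dots> = pi * e + (LINT t|circle_angle. (norm (g t))\<^sup>2) / (2 * e)"
      using measure_circle_angle \<open>e > 0\<close>
      by (subst Bochner_Integration.integral_add)
         (auto intro!: continuous_imp_integrable_circle_angle continuous_intros contg)
    also have "\<dots> \<le> pi * e + (2 * pi * e\<^sup>2) / (2 * e)"
      using L2 \<open>e > 0\<close> by (intro add_left_mono divide_right_mono) auto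
    also have "\<dots> = 2 * pi * e"
      using \<open>e > 0\<close> by (simp add: power2_eq_square)
    finally have L1: "(LINT t|circle_angle. norm (g t)) \<le> 2 * pi * e" .
    have "(\<integral>\<^sup>+u. ennreal (norm (g u)) * indicator {0..2 * pi} u \<partial>lborel)
       = (\<integral>\<^sup>+u. ennreal (norm (g u)) * indicator {0..2 * pi} u \<partial>lebesgue)"
      by (rule nn_integral_completion[symmetric])
    also have "\<dots> = (\<integral>\<^sup>+u. ennreal (norm (g u)) \<partial>circle_angle)"
      by (subst nn_integral_restrict_space) auto
    also have "\<dots> = ennreal (LINT t|circle_angle. norm (g t))"
      by (rule nn_integral_eq_integral) (auto intro!: continuous_imp_integrable_circle_angle continuous_intros contg)
    also have "\<dots> \<le> ennreal (2 * pi * e)" by (rule ennreal_leI[OF L1])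
    finally show "(\<integral>\<^sup>+u. ennreal (norm (f (of_real R * cis u) - P (of_real R * cis u))) * indicator {0..2 * pi} u \<partial>lborel)
        \<le> ennreal (2 * pi * e)" unfolding g_def .
  qed
qed

section \<open>Nontangential limits and boundary values\<close>

text \<open>On the radius the distance to \<open>\<zeta>\<close> is \<open>1 - r\<close>, so an
  aperture above 1 is what puts the radius inside the Stolz region.\<close>

lemma radial_filterlim:
  assumes "norm \<zeta> = 1" "\<alpha> > 1"
  shows "filterlim (\<lambda>r. of_real r * \<zeta>) (at \<zeta> within stolz_region \<alpha> \<zeta>) (at_left 1)"
  unfolding filterlim_at
proof
  show "((\<lambda>r. of_real r * \<zeta>) \<longlongrightarrow> \<zeta>) (at_left 1)"
    by (auto intro!: tendsto_eq_intros)
  have ray: "of_real r * \<zeta> \<in> stolz_region \<alpha> \<zeta> \<and> of_real r * \<zeta> \<noteq> \<zeta>" if "0 < r" "r < 1" for r :: real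
  proof -
    have "norm (of_real r * \<zeta> - \<zeta>) = norm (of_real (r - 1) * \<zeta>)" by (simp add: algebra_simps)
    also have "\<dots> = 1 - r" using that assms(1) by (simp only: norm_mult norm_of_real) simp
    also have "\<dots> < \<alpha> * (1 - r)" using that assms(2) by simp
    finally have "norm (of_real r * \<zeta> - \<zeta>) < \<alpha> * (1 - r)" .
    moreover have "norm (of_real r * \<zeta> - \<zeta>) \<noteq> 0" 
      using \<open>norm (of_real r * \<zeta> - \<zeta>) = norm (of_real (r - 1) * \<zeta>)\<close> that assms(1) by (simp add: norm_mult)
    ultimately show ?thesis using that assms(1) by (auto simp: stolz_region_def norm_mult)
  qed
  have "\<forall>\<^sub>F r in at_left 1. 0 < r \<and> r < (1::real)"
    by (rule eventually_at_leftI[of 0]) auto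
  then show "\<forall>\<^sub>F r in at_left 1. of_real r * \<zeta> \<in> stolz_region \<alpha> \<zeta> \<and> of_real r * \<zeta> \<noteq> \<zeta>"
    by (rule eventually_mono) (use ray in blast)
qed

lemma nontangential_imp_radial:
  assumes "has_nontangential_limit f \<zeta> l" "norm \<zeta> = 1"
  shows "((\<lambda>r. f (of_real r * \<zeta>)) \<longlongrightarrow> l) (at_left 1)"
proof -
  have "(f \<longlongrightarrow> l) (at \<zeta> within stolz_region 2 \<zeta>)"
    using assms(1) by (auto simp: has_nontangential_limit_def)
  then show ?thesis
    by (rule filterlim_compose) (rule radial_filterlim[OF assms(2)], simp)
qed

lemma boundary_value_eq:
  assumes "has_nontangential_limit f \<zeta> l" "norm \<zeta> = 1"
  shows "boundary_value f \<zeta> = l"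
  unfolding boundary_value_def
proof (rule the_equality)
  show "has_nontangential_limit f \<zeta> l" by fact
  fix l' assume "has_nontangential_limit f \<zeta> l'"
  from nontangential_imp_radial[OF this assms(2)] nontangential_imp_radial[OF assms]
  show "l' = l"
    using tendsto_unique[of "at_left (1::real)"] trivial_limit_at_left_real by blast
qed

lemma has_nontangential_limit_cong:
  assumes "\<And>z. z \<in> unit_disc \<Longrightarrow> f z = g z"
  shows "has_nontangential_limit f \<zeta> l \<longleftrightarrow> has_nontangential_limit g \<zeta> l"
proof -
  have "(f \<longlongrightarrow> l) (at \<zeta> within stolz_region \<alpha> \<zeta>) \<longleftrightarrow> (g \<longlongrightarrow> l) (at \<zeta> within stolz_region \<alpha> \<zeta>)" for \<alpha>
    by (intro filterlim_cong refl) (use assms in \<open>auto simp: eventually_at_filter stolz_region_def\<close>)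
  then show ?thesis by (simp add: has_nontangential_limit_def)
qed

lemma has_nontangential_limit_mult:
  assumes "has_nontangential_limit f \<zeta> k" "has_nontangential_limit g \<zeta> l"
  shows "has_nontangential_limit (\<lambda>z. f z * g z) \<zeta> (k * l)"
  using assms unfolding has_nontangential_limit_def by (auto intro: tendsto_mult)

lemma has_nontangential_limit_divide:
  assumes "has_nontangential_limit f \<zeta> k" "has_nontangential_limit g \<zeta> l" "l \<noteq> 0"
  shows "has_nontangential_limit (\<lambda>z. f z / g z) \<zeta> (k / l)"
  using assms unfolding has_nontangential_limit_def by (auto intro: tendsto_divide)

text \<open>A continuous approximant makes \<open>f\<close> almost constant near
  \<open>\<zeta>\<close> in each region. The radius lies in every region of aperture at least 2, so
  the limit along it is the limit in all of them. Apertures are natural numbers here so that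
  countably many exceptional sets suffice later.\<close>

lemma nontangential_limit_if_approximable:
  assumes z0: "norm \<zeta> = 1"
    and ap: "\<And>(k::nat) e. e > 0 \<Longrightarrow>
      \<exists>P. continuous_on UNIV P \<and> (\<forall>z\<in>stolz_region (real k) \<zeta>. norm (f z - P z) \<le> e)"
  shows "\<exists>l. has_nontangential_limit f \<zeta> l"
proof -
  have near: "\<exists>c. (\<forall>\<^sub>F z in at \<zeta> within stolz_region (real k) \<zeta>. norm (f z - c) < e)" if e: "e > 0" for k :: nat and e :: real
  proof -
    obtain P where P: "continuous_on UNIV P" "\<And>z. z \<in> stolz_region (real k) \<zeta> \<Longrightarrow> norm (f z - P z) \<le> e / 2"
      using ap[of "e / 2" k] e by auto
    have "(P \<longlongrightarrow> P \<zeta>) (at \<zeta> within stolz_region (real k) \<zeta>)"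
      using P(1) by (meson UNIV_I continuous_on_def subset_UNIV tendsto_within_subset)
    then have "\<forall>\<^sub>F z in at \<zeta> within stolz_region (real k) \<zeta>. dist (P z) (P \<zeta>) < e / 2"
      using e by (intro tendstoD) auto
    moreover have "\<forall>\<^sub>F z in at \<zeta> within stolz_region (real k) \<zeta>. z \<in> stolz_region (real k) \<zeta>"
      by (simp add: eventually_at_filter)
    ultimately have "\<forall>\<^sub>F z in at \<zeta> within stolz_region (real k) \<zeta>. norm (f z - P \<zeta>) < e"
    proof eventually_elim
      case (elim z)
      have "norm (f z - P \<zeta>) \<le> norm (f z - P z) + norm (P z - P \<zeta>)"
        using norm_triangle_ineq[of "f z - P z" "P z - P \<zeta>"] by simp
      then show ?case using P(2)[OF elim(2)] elim(1) by (simp add: dist_norm)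
    qed
    then show ?thesis by blast
  qed
  have rad: "filterlim (\<lambda>n. of_real (radius n) * \<zeta>) (at \<zeta> within stolz_region (real k) \<zeta>) sequentially"
    if "k \<ge> 2" for k :: nat
    by (rule filterlim_compose[OF radial_filterlim radius_filterlim]) (use z0 that in auto)
  have "Cauchy (\<lambda>n. f (of_real (radius n) * \<zeta>))"
  proof (rule metric_CauchyI)
    fix e :: real assume "e > 0"
    then obtain c where c: "\<forall>\<^sub>F z in at \<zeta> within stolz_region (real 2) \<zeta>. norm (f z - c) < e / 2"
      using near[of "e / 2" 2] by auto
    have "\<forall>\<^sub>F n in sequentially. norm (f (of_real (radius n) * \<zeta>) - c) < e / 2"
      using filterlim_iff[THEN iffD1, OF rad[of 2], rule_format, OF _ c] by simp
    then obtain N where N: "\<And>n. n \<ge> N \<Longrightarrow> dist (f (of_real (radius n) * \<zeta>)) c < e / 2"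
      by (auto simp: eventually_sequentially dist_norm)
    show "\<exists>M. \<forall>m\<ge>M. \<forall>n\<ge>M. dist (f (of_real (radius m) * \<zeta>)) (f (of_real (radius n) * \<zeta>)) < e"
      using N by (intro exI[of _ N] allI impI) (rule dist_triangle_half_l)
  qed
  then obtain l where l: "(\<lambda>n. f (of_real (radius n) * \<zeta>)) \<longlonglongrightarrow> l"
    by (auto simp: Cauchy_convergent_iff convergent_def)
  have "(f \<longlongrightarrow> l) (at \<zeta> within stolz_region \<alpha> \<zeta>)" if "\<alpha> > 1" for \<alpha>
  proof -
    define k where "k = nat \<lceil>\<alpha>\<rceil>"
    have k: "\<alpha> \<le> real k" "k \<ge> 2" using that unfolding k_def by linarith+
    have "(f \<longlongrightarrow> l) (at \<zeta> within stolz_region (real k) \<zeta>)"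
    proof (rule tendstoI)
      fix e :: real assume "e > 0"
      then obtain c where c: "\<forall>\<^sub>F z in at \<zeta> within stolz_region (real k) \<zeta>. norm (f z - c) < e / 3"
        using near[of "e / 3" k] by auto
      have "\<forall>\<^sub>F n in sequentially. norm (f (of_real (radius n) * \<zeta>) - c) < e / 3"
        using filterlim_iff[THEN iffD1, OF rad[OF k(2)], rule_format, OF c] .
      then have lc: "norm (l - c) \<le> e / 3"
        by (intro tendsto_upperbound[OF tendsto_norm[OF tendsto_diff[OF l tendsto_const]]])
           (auto elim: eventually_mono)
      show "\<forall>\<^sub>F z in at \<zeta> within stolz_region (real k) \<zeta>. dist (f z) l < e"
        using c
      proof eventually_elim
        case (elim z)
        have "norm (f z - l) \<le> norm (f z - c) + norm (l - c)"
          using norm_triangle_ineq4[of "f z - c" "l - c"] by simp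
        then show ?case using elim lc \<open>e > 0\<close> by (simp add: dist_norm)
      qed
    qed
    moreover have "stolz_region \<alpha> \<zeta> \<subseteq> stolz_region (real k) \<zeta>"
    proof
      fix z assume z: "z \<in> stolz_region \<alpha> \<zeta>"
      then have le: "\<alpha> * (1 - norm z) \<le> real k * (1 - norm z)"
        using k by (intro mult_right_mono) (auto simp: stolz_region_def)
      have "norm (z - \<zeta>) < real k * (1 - norm z)"
        by (rule less_le_trans[OF _ le]) (use z in \<open>simp add: stolz_region_def\<close>)
      then show "z \<in> stolz_region (real k) \<zeta>" using z by (simp add: stolz_region_def)
    qed
    ultimately show ?thesis by (rule tendsto_within_subset)
  qed
  then show ?thesis by (auto simp: has_nontangential_limit_def)
qed

lemma AE_circle_angleI:
  assumes "AE t in lborel. t \<in> {0..2 * pi} \<longrightarrow> P t"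
  shows "AE t in circle_angle. P t"
proof -
  have "AE t in lebesgue. t \<in> {0..2 * pi} \<longrightarrow> P t"
    using assms by (rule AE_completion)
  then show ?thesis
    by (subst AE_restrict_space_iff) auto
qed

lemma fatou_bounded:
  assumes hol: "f holomorphic_on unit_disc" and le: "\<And>z. z \<in> unit_disc \<Longrightarrow> norm (f z) \<le> 1"
  shows "AE t in circle_angle. \<exists>l. has_nontangential_limit f (cis t) l"
proof (rule AE_circle_angleI)
  define Q where "Q = (\<lambda>i P. continuous_on UNIV P \<and> P holomorphic_on UNIV \<and>
    (\<forall>R. 0 < R \<longrightarrow> R < 1 \<longrightarrow>
      (\<integral>\<^sup>+u. ennreal (norm (f (of_real R * cis u) - P (of_real R * cis u))) * indicator {0..2 * pi} u \<partial>lborel)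
        \<le> ennreal (2 * pi * (1 / real (Suc i)))))"
  have "\<exists>P. Q i P" for i
    unfolding Q_def by (rule bounded_polynomial_approximation[OF hol le, of "1 / real (Suc i)"]) auto
  then obtain P where Q: "\<And>i. Q i (P i)" by metis
  have P: "\<And>i. continuous_on UNIV (P i)" "\<And>i. P i holomorphic_on UNIV"
    "\<And>i R. 0 < R \<Longrightarrow> R < 1 \<Longrightarrow>
      (\<integral>\<^sup>+u. ennreal (norm (f (of_real R * cis u) - P i (of_real R * cis u))) * indicator {0..2 * pi} u \<partial>lborel)
        \<le> ennreal (2 * pi * (1 / real (Suc i)))"
    using Q unfolding Q_def by simp_all
  \<comment> \<open>\<open>k\<close> is the aperture, \<open>1 / real (Suc j)\<close> the tolerance
    and \<open>i\<close> the index of the approximant. For fixed \<open>k\<close> and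
    \<open>j\<close> the measures tend to 0 in \<open>i\<close>, so almost no angle is exceptional
    for every \<open>i\<close>.\<close>
  define S where "S = (\<lambda>k j i. {t \<in> {0..2 * pi}. \<exists>z\<in>stolz_region (real k) (cis t). norm (f z - P i z) > 1 / real (Suc j)})"
  have S_sets: "S k j i \<in> sets lborel" for k j i
  proof -
    have "S k j i = {0..2 * pi} \<inter> {t. \<exists>z\<in>stolz_region (real k) (cis t). norm (f z - P i z) > 1 / real (Suc j)}"
      by (auto simp: S_def)
    then show ?thesis using open_Collect_stolz_region by simp
  qed
  have S_le: "emeasure lborel (S k j i) \<le> ennreal (60 * pi * (real k + 1) * real (Suc j) * (1 / real (Suc i)))" for k j i
  proof -
    have "emeasure lborel (S k j i) \<le> ennreal (30 * (real k + 1) / (1 / real (Suc j))) * ennreal (2 * pi * (1 / real (Suc i)))"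
      unfolding S_def
    proof (rule stolz_maximal_estimate_disc)
      show "(\<lambda>z. f z - P i z) holomorphic_on unit_disc"
        using hol P(2) holomorphic_on_subset by (blast intro: holomorphic_on_diff)
    qed (use P(3) in auto)
    also have "\<dots> = ennreal (60 * pi * (real k + 1) * real (Suc j) * (1 / real (Suc i)))"
      by (subst ennreal_mult[symmetric]) (auto intro!: arg_cong[where f = ennreal])
    finally show ?thesis .
  qed
  have null: "(\<Inter>i. S k j i) \<in> null_sets lborel" for k j
  proof (rule null_setsI)
    show "(\<Inter>i. S k j i) \<in> sets lborel" using S_sets by auto
    have lim: "(\<lambda>i. ennreal (60 * pi * (real k + 1) * real (Suc j) * (1 / real (Suc i)))) \<longlonglongrightarrow>
        ennreal (60 * pi * (real k + 1) * real (Suc j) * 0)"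
      by (intro tendsto_ennrealI tendsto_mult tendsto_const LIMSEQ_Suc[OF lim_const_over_n])
    have "emeasure lborel (\<Inter>i. S k j i) \<le> ennreal (60 * pi * (real k + 1) * real (Suc j) * (1 / real (Suc i)))" for i
      by (rule order_trans[OF emeasure_mono S_le]) (use S_sets in auto)
    then have "\<exists>N. \<forall>i\<ge>N. emeasure lborel (\<Inter>i. S k j i) \<le> ennreal (60 * pi * (real k + 1) * real (Suc j) * (1 / real (Suc i)))"
      by (intro exI[of _ 0] allI impI)
    from LIMSEQ_le_const[OF lim this]
    have "emeasure lborel (\<Inter>i. S k j i) \<le> ennreal (60 * pi * (real k + 1) * real (Suc j) * 0)" .
    then show "emeasure lborel (\<Inter>i. S k j i) = 0" by simp
  qed
  have "AE t in lborel. \<forall>k j. t \<notin> (\<Inter>i. S k j i)"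
    by (subst AE_all_countable, intro allI, subst AE_all_countable, intro allI AE_not_in null)
  then show "AE t in lborel. t \<in> {0..2 * pi} \<longrightarrow> (\<exists>l. has_nontangential_limit f (cis t) l)"
  proof eventually_elim
    case (elim t)
    show ?case
    proof
      assume t: "t \<in> {0..2 * pi}"
      show "\<exists>l. has_nontangential_limit f (cis t) l"
      proof (rule nontangential_limit_if_approximable)
        fix k :: nat and e :: real assume "e > 0"
        then obtain j where j: "1 / real (Suc j) < e"
          using nat_approx_posE by metis
        obtain i where "t \<notin> S k j i" using elim by blast
        then have "\<forall>z\<in>stolz_region (real k) (cis t). norm (f z - P i z) \<le> 1 / real (Suc j)"
          using t unfolding S_def by (auto simp: not_less)
        then show "\<exists>P. continuous_on UNIV P \<and> (\<forall>z\<in>stolz_region (real k) (cis t). norm (f z - P z) \<le> e)"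
          using j P(1) by (intro exI[of _ "P i"]) force
      qed simp
    qed
  qed
qed

text \<open>Completeness of \<open>lebesgue\<close> carries over to the interval. It is needed
  because boundary values are limits of measurable functions only almost everywhere.\<close>

lemma borel_measurable_circle_angle_AE:
  fixes f g :: "real \<Rightarrow> 'b::euclidean_space"
  assumes f: "f \<in> borel_measurable circle_angle" and ae: "AE t in circle_angle. f t = g t"
  shows "g \<in> borel_measurable circle_angle"
proof -
  let ?I = "{0..2 * pi}"
  have I: "?I \<in> sets lebesgue" by simp
  have "(\<lambda>x. if x \<in> ?I then f x else 0) \<in> borel_measurable lebesgue"
    using f borel_measurable_if[OF I, of f] by simp
  moreover have "AE t in lebesgue. t \<in> ?I \<longrightarrow> f t = g t"
    using ae by (subst (asm) AE_restrict_space_iff) auto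
  then have "AE t in lebesgue. (if t \<in> ?I then f t else 0) = (if t \<in> ?I then g t else 0)"
    by eventually_elim auto
  ultimately have "(\<lambda>x. if x \<in> ?I then g x else 0) \<in> borel_measurable lebesgue"
    by (rule borel_measurable_AE)
  then show ?thesis using borel_measurable_if[OF I, of g] by simp
qed

lemma borel_measurable_circle_angle_lim:
  fixes g :: "real \<Rightarrow> 'b::euclidean_space"
  assumes f: "\<And>n::nat. f n \<in> borel_measurable circle_angle"
    and ae: "AE t in circle_angle. (\<lambda>n. f n t) \<longlonglongrightarrow> g t"
  shows "g \<in> borel_measurable circle_angle"
proof (rule borel_measurable_circle_angle_AE[OF borel_measurable_lim_metric[OF f]])
  show "AE t in circle_angle. lim (\<lambda>n. f n t) = g t"
    using ae by eventually_elim (rule limI)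
qed

text \<open>Writing \<open>g\<close> as the exponential of \<open>h\<close>, the function
  \<open>- Re h\<close> is nonnegative and its circle means all equal its value at 0. By Fatou's
  lemma its lower limit along almost every radius is finite, whereas convergence of \<open>g\<close>
  to 0 would make it infinite.\<close>

lemma nonzero_radial_limit:
  assumes hol: "g holomorphic_on unit_disc" and nz: "\<And>z. z \<in> unit_disc \<Longrightarrow> g z \<noteq> 0"
    and le: "\<And>z. z \<in> unit_disc \<Longrightarrow> norm (g z) \<le> 1"
  shows "AE t in circle_angle. \<not> (\<lambda>n. g (of_real (radius n) * cis t)) \<longlonglongrightarrow> 0"
proof -
  obtain h where h: "h holomorphic_on unit_disc" "\<And>z. z \<in> unit_disc \<Longrightarrow> exp (h z) = g z"
    using holomorphic_logarithm_exists[OF convex_ball open_ball hol nz, of 0] by auto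
  have in_disc: "of_real (radius n) * cis t \<in> unit_disc" for n t
    using radius_bounds[of n] by (simp add: norm_mult)
  have norm_g: "norm (g z) = exp (Re (h z))" if "z \<in> unit_disc" for z
    using h(2)[OF that] by (metis norm_exp_eq_Re)
  have Re_le: "Re (h z) \<le> 0" if "z \<in> unit_disc" for z
    using le[OF that] norm_g[OF that] by simp
  define u where "u = (\<lambda>n t. - Re (h (of_real (radius n) * cis t)))"
  have contu: "continuous_on {0..2 * pi} (u n)" for n
    unfolding u_def using radius_bounds[of n]
    by (intro continuous_intros continuous_on_circle_dilate[OF holomorphic_on_imp_continuous_on[OF h(1)]]) auto
  have u_meas[measurable]: "u n \<in> borel_measurable circle_angle" for n
    by (rule borel_measurable_integrable[OF continuous_imp_integrable_circle_angle[OF contu]])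
  have int_u: "(\<integral>\<^sup>+t. ennreal (u n t) \<partial>circle_angle) = ennreal (2 * pi * - Re (h 0))" for n
  proof -
    have r: "\<bar>radius n\<bar> < 1" using radius_bounds[of n] by simp
    have hol2: "(\<lambda>z. h (of_real (radius n) * z)) holomorphic_on cball 0 1"
      by (rule holomorphic_on_dilate(2)[OF h(1) r])
    have "(LINT t|circle_angle. h (of_real (radius n) * cis t)) = of_real (2 * pi) * h (of_real (radius n) * 0)"
      by (rule mean_value_cis[OF holomorphic_on_imp_continuous_on[OF hol2]
            holomorphic_on_subset[OF hol2 ball_subset_cball]])
    moreover have "integrable circle_angle (\<lambda>t. h (of_real (radius n) * cis t))"
      by (intro continuous_imp_integrable_circle_angle
          continuous_on_circle_dilate[OF holomorphic_on_imp_continuous_on[OF h(1)] r])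
    ultimately have "(LINT t|circle_angle. Re (h (of_real (radius n) * cis t))) = 2 * pi * Re (h 0)"
      by simp
    then have "(LINT t|circle_angle. u n t) = 2 * pi * - Re (h 0)"
      unfolding u_def by simp
    moreover have "(\<integral>\<^sup>+t. ennreal (u n t) \<partial>circle_angle) = ennreal (LINT t|circle_angle. u n t)"
      by (rule nn_integral_eq_integral[OF continuous_imp_integrable_circle_angle[OF contu]])
         (use Re_le in_disc in \<open>auto simp: u_def\<close>)
    ultimately show ?thesis by simp
  qed
  have "(\<integral>\<^sup>+t. liminf (\<lambda>n. ennreal (u n t)) \<partial>circle_angle) \<le> liminf (\<lambda>n. \<integral>\<^sup>+t. ennreal (u n t) \<partial>circle_angle)"
    by (rule nn_integral_liminf) measurable
  also have "\<dots> = ennreal (2 * pi * - Re (h 0))"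
    unfolding int_u by (rule Liminf_const) simp
  also have "\<dots> < \<infinity>" by (simp del: ennreal_eq_0_iff)
  finally have fin: "(\<integral>\<^sup>+t. liminf (\<lambda>n. ennreal (u n t)) \<partial>circle_angle) \<noteq> \<infinity>" by simp
  have "AE t in circle_angle. liminf (\<lambda>n. ennreal (u n t)) \<noteq> \<infinity>"
    by (rule nn_integral_PInf_AE[OF _ fin]) measurable
  then show ?thesis
  proof eventually_elim
    case (elim t)
    show ?case
    proof
      assume "(\<lambda>n. g (of_real (radius n) * cis t)) \<longlonglongrightarrow> 0"
      then have lim: "(\<lambda>n. norm (g (of_real (radius n) * cis t))) \<longlonglongrightarrow> 0"
        by (rule tendsto_norm_zero)
      have "ennreal B \<le> liminf (\<lambda>n. ennreal (u n t))" for B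
      proof (rule Liminf_bounded)
        have "\<forall>\<^sub>F n in sequentially. norm (g (of_real (radius n) * cis t)) < exp (- B)"
          using lim by (rule order_tendstoD) simp
        then show "\<forall>\<^sub>F n in sequentially. ennreal B \<le> ennreal (u n t)"
        proof eventually_elim
          case (elim n)
          then have "exp (Re (h (of_real (radius n) * cis t))) < exp (- B)"
            using norm_g[OF in_disc] by simp
          then show ?case unfolding u_def by (intro ennreal_leI) simp
        qed
      qed
      moreover obtain x where "liminf (\<lambda>n. ennreal (u n t)) = ennreal x" "x \<ge> 0"
        using elim by (cases "liminf (\<lambda>n. ennreal (u n t))") auto
      ultimately have "ennreal (x + 1) \<le> ennreal x" by metis
      then show False using \<open>x \<ge> 0\<close> by simp
    qed
  qed
qed

text \<open>\<open>f\<close> is the quotient of the bounded functions \<open>f * g\<close> and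
  \<open>g\<close>, and the limit of the denominator is nonzero almost everywhere. Means are assumed
  bounded along one sequence of radii only, so the result applies before membership in the
  Nevanlinna class is known.\<close>

lemma fatou_nevanlinna:
  assumes hol: "f holomorphic_on unit_disc"
    and R: "\<And>n. 0 < R n" "\<And>n. R n < 1" "R \<longlonglongrightarrow> 1"
    and L: "\<And>n. circle_mean (\<lambda>\<zeta>. log_plus (norm (f (of_real (R n) * \<zeta>)))) \<le> L"
  shows "AE t in circle_angle. \<exists>l. has_nontangential_limit f (cis t) l"
proof -
  obtain g where g: "g holomorphic_on unit_disc" "\<And>z. z \<in> unit_disc \<Longrightarrow> g z \<noteq> 0"
    "\<And>z. z \<in> unit_disc \<Longrightarrow> norm (g z) \<le> 1" "\<And>z. z \<in> unit_disc \<Longrightarrow> norm (f z * g z) \<le> 1"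
    using nevanlinna_bounded_multiplier[OF hol R L] by metis
  have "AE t in circle_angle. \<exists>l. has_nontangential_limit (\<lambda>z. f z * g z) (cis t) l"
    by (rule fatou_bounded) (use g hol in \<open>auto intro!: holomorphic_intros\<close>)
  moreover have "AE t in circle_angle. \<exists>l. has_nontangential_limit g (cis t) l"
    by (rule fatou_bounded[OF g(1,3)])
  moreover have "AE t in circle_angle. \<not> (\<lambda>n. g (of_real (radius n) * cis t)) \<longlonglongrightarrow> 0"
    by (rule nonzero_radial_limit[OF g(1-3)])
  ultimately show ?thesis
  proof eventually_elim
    case (elim t)
    then obtain k l where kl: "has_nontangential_limit (\<lambda>z. f z * g z) (cis t) k" "has_nontangential_limit g (cis t) l"
      by blast
    have "(\<lambda>n. g (of_real (radius n) * cis t)) \<longlonglongrightarrow> l"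
      by (rule filterlim_compose[OF nontangential_imp_radial[OF kl(2)] radius_filterlim]) simp
    then have "l \<noteq> 0" using elim(3) by blast
    then have "has_nontangential_limit (\<lambda>z. f z * g z / g z) (cis t) (k / l)"
      by (rule has_nontangential_limit_divide[OF kl])
    moreover have "has_nontangential_limit (\<lambda>z. f z * g z / g z) (cis t) (k / l) \<longleftrightarrow> has_nontangential_limit f (cis t) (k / l)"
      by (rule has_nontangential_limit_cong) (use g(2) in auto)
    ultimately show ?case by blast
  qed
qed

lemma fatou_nevanlinna_class:
  assumes "f \<in> nevanlinna_class"
  shows "AE t in circle_angle. has_nontangential_limit f (cis t) (boundary_value f (cis t))"
proof -
  obtain R L where R: "\<And>n::nat. 0 < R n" "\<And>n. R n < 1" "R \<longlonglongrightarrow> 1"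
    and L: "\<And>n. circle_mean (\<lambda>\<zeta>. log_plus (norm (f (of_real (R n) * \<zeta>)))) \<le> (L::real)"
    by (rule nevanlinna_radii[OF assms]) blast
  have hol: "f holomorphic_on unit_disc" using assms by (simp add: nevanlinna_class_def)
  have "AE t in circle_angle. \<exists>l. has_nontangential_limit f (cis t) l"
    by (rule fatou_nevanlinna[OF hol R L])
  then show ?thesis
    by eventually_elim (use boundary_value_eq in fastforce)
qed

lemma boundary_value_measurable:
  assumes hol: "f holomorphic_on unit_disc"
    and ae: "AE t in circle_angle. has_nontangential_limit f (cis t) (boundary_value f (cis t))"
  shows "(\<lambda>t. boundary_value f (cis t)) \<in> borel_measurable circle_angle"
proof (rule borel_measurable_circle_angle_lim)
  show "(\<lambda>t. f (of_real (radius n) * cis t)) \<in> borel_measurable circle_angle" for n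
    using radius_bounds[of n]
    by (intro borel_measurable_integrable continuous_imp_integrable_circle_angle
        continuous_on_circle_dilate[OF holomorphic_on_imp_continuous_on[OF hol]]) auto
  show "AE t in circle_angle. (\<lambda>n. f (of_real (radius n) * cis t)) \<longlonglongrightarrow> boundary_value f (cis t)"
    using ae
  proof eventually_elim
    case (elim t)
    show ?case
      by (rule filterlim_compose[OF nontangential_imp_radial[OF elim] radius_filterlim]) simp
  qed
qed

subsection \<open>Membership in Hardy-Orlicz spaces\<close>

text \<open>Truncating at the limit \<open>B\<close> of the majorants reduces this to dominated convergence:
  the truncation error of \<open>a n\<close> is at most that of \<open>b n\<close>, whose integral tends to \<open>0\<close>.\<close>

lemma integral_tendsto_varying_majorants:
  fixes a b :: "nat \<Rightarrow> 'a \<Rightarrow> real" and A B :: "'a \<Rightarrow> real"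
  assumes a[measurable]: "\<And>n. a n \<in> borel_measurable M" and A[measurable]: "A \<in> borel_measurable M"
    and b: "\<And>n. integrable M (b n)" and B: "integrable M B"
    and le: "\<And>n x. 0 \<le> a n x" "\<And>n x. a n x \<le> b n x" "\<And>x. 0 \<le> B x"
    and a_lim: "AE x in M. (\<lambda>n. a n x) \<longlonglongrightarrow> A x" and b_lim: "AE x in M. (\<lambda>n. b n x) \<longlonglongrightarrow> B x"
    and int_lim: "(\<lambda>n. LINT x|M. b n x) \<longlonglongrightarrow> (LINT x|M. B x)"
  shows "integrable M A" "(\<lambda>n. LINT x|M. a n x) \<longlonglongrightarrow> (LINT x|M. A x)"
proof -
  have [measurable]: "B \<in> borel_measurable M" "b n \<in> borel_measurable M" for n
    using b B by auto
  have int_a: "integrable M (a n)" for n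
    by (rule Bochner_Integration.integrable_bound[OF b[of n] a])
       (rule AE_I2, use le(1,2) in \<open>simp add: order_trans[OF _ abs_ge_self]\<close>)
  have int_min_a: "integrable M (\<lambda>x. min (a n x) (B x))" for n
    by (rule Bochner_Integration.integrable_bound[OF B]) (use le in \<open>auto intro!: AE_I2\<close>)
  have b_nonneg: "0 \<le> b n x" for n x using le order_trans by blast
  have int_min_b: "integrable M (\<lambda>x. min (b n x) (B x))" for n
    by (rule Bochner_Integration.integrable_bound[OF B]) (use le b_nonneg in \<open>auto intro!: AE_I2\<close>)
  have min_a: "AE x in M. (\<lambda>n. min (a n x) (B x)) \<longlonglongrightarrow> A x"
    using a_lim b_lim
  proof eventually_elim
    case (elim x)
    have "A x \<le> B x" by (rule LIMSEQ_le[OF elim]) (use le in auto)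
    then show ?case using tendsto_min[OF elim(1) tendsto_const[of "B x"]] by simp
  qed
  have min_b: "AE x in M. (\<lambda>n. min (b n x) (B x)) \<longlonglongrightarrow> B x"
    using b_lim
  proof eventually_elim
    case (elim x)
    show ?case using tendsto_min[OF elim tendsto_const[of "B x"]] by simp
  qed
  have dom_a: "AE x in M. norm (min (a n x) (B x)) \<le> B x" for n
    using le by (auto intro!: AE_I2)
  have dom_b: "AE x in M. norm (min (b n x) (B x)) \<le> B x" for n
    using le b_nonneg by (auto intro!: AE_I2)
  show "integrable M A"
    by (rule integrable_dominated_convergence[OF A _ B min_a dom_a]) simp
  have 1: "(\<lambda>n. LINT x|M. min (a n x) (B x)) \<longlonglongrightarrow> (LINT x|M. A x)"
    by (rule integral_dominated_convergence[OF A _ B min_a dom_a]) simp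
  have 2: "(\<lambda>n. LINT x|M. min (b n x) (B x)) \<longlonglongrightarrow> (LINT x|M. B x)"
    by (rule integral_dominated_convergence[OF _ _ B min_b dom_b]) simp_all
  have 3: "(\<lambda>n. (LINT x|M. b n x) - (LINT x|M. min (b n x) (B x))) \<longlonglongrightarrow> 0"
    using tendsto_diff[OF int_lim 2] by simp
  have "(\<lambda>n. (LINT x|M. a n x) - (LINT x|M. min (a n x) (B x))) \<longlonglongrightarrow> 0"
  proof (rule tendsto_sandwich[OF _ _ tendsto_const 3])
    show "\<forall>\<^sub>F n in sequentially. 0 \<le> (LINT x|M. a n x) - (LINT x|M. min (a n x) (B x))"
      using integral_mono[OF int_min_a int_a] by simp
    have "(LINT x|M. a n x - min (a n x) (B x)) \<le> (LINT x|M. b n x - min (b n x) (B x))" for n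
    proof (rule integral_mono)
      show "a n x - min (a n x) (B x) \<le> b n x - min (b n x) (B x)" for x
        using le(2)[of n x] by (auto simp: min_def)
    qed (use int_a int_min_a b int_min_b in auto)
    then show "\<forall>\<^sub>F n in sequentially. (LINT x|M. a n x) - (LINT x|M. min (a n x) (B x))
         \<le> (LINT x|M. b n x) - (LINT x|M. min (b n x) (B x))"
      using int_a int_min_a b int_min_b by simp
  qed
  from tendsto_add[OF this 1] show "(\<lambda>n. LINT x|M. a n x) \<longlonglongrightarrow> (LINT x|M. A x)"
    by simp
qed

lemma log_plus_dilate_integrable:
  assumes "f holomorphic_on unit_disc" "\<bar>r\<bar> < 1"
  shows "integrable circle_angle (\<lambda>t. log_plus (norm (f (of_real r * cis t))))"
  by (intro continuous_imp_integrable_circle_angle continuous_on_log_plus_norm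
      continuous_on_circle_dilate[OF holomorphic_on_imp_continuous_on[OF assms(1)] assms(2)])

lemma log_plus_radial_limit:
  assumes "has_nontangential_limit f (cis t) l" "\<And>n. S n < 1" "S \<longlonglongrightarrow> 1"
  shows "(\<lambda>n. log_plus (norm (f (of_real (S n) * cis t)))) \<longlonglongrightarrow> log_plus (norm l)"
proof (rule tendsto_log_plus_norm)
  have "filterlim S (at_left 1) sequentially"
    unfolding filterlim_at using assms(2,3) by (auto simp: less_imp_neq)
  then show "(\<lambda>n. f (of_real (S n) * cis t)) \<longlonglongrightarrow> l"
    by (rule filterlim_compose[OF nontangential_imp_radial[OF assms(1)], rotated]) simp
qed

text \<open>Sequences of radii let the convergence theorems for integrals apply. The same limit also
  yields membership in the Nevanlinna class.\<close>

lemma smirnovI: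
  assumes hol: "f holomorphic_on unit_disc"
    and ae: "AE t in circle_angle. has_nontangential_limit f (cis t) (boundary_value f (cis t))"
    and int: "integrable circle_angle (\<lambda>t. log_plus (norm (boundary_value f (cis t))))"
    and lim: "\<And>S. (\<And>n. 0 < S n) \<Longrightarrow> (\<And>n. S n < 1) \<Longrightarrow> S \<longlonglongrightarrow> 1 \<Longrightarrow>
      (\<lambda>n. LINT t|circle_angle. log_plus (norm (f (of_real (S n) * cis t)))) \<longlonglongrightarrow>
        (LINT t|circle_angle. log_plus (norm (boundary_value f (cis t))))"
  shows "f \<in> smirnov_class"
proof -
  have "((\<lambda>r. circle_mean (\<lambda>\<zeta>. log_plus (norm (f (of_real r * \<zeta>))))) \<longlongrightarrow>
        circle_mean (\<lambda>\<zeta>. log_plus (norm (boundary_value f \<zeta>)))) (at_left 1)"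
    unfolding circle_mean_eq
    by (rule tendsto_at_left_sequentially[of 0]) (auto intro!: tendsto_divide lim)
  then show ?thesis
    using hol int unfolding smirnov_class_def nevanlinna_class_def circle_integrable_iff by blast
qed

lemma smirnov_radial_tendsto:
  assumes "f \<in> smirnov_class" "\<And>n. S n < 1" "S \<longlonglongrightarrow> 1"
  shows "(\<lambda>n. LINT t|circle_angle. log_plus (norm (f (of_real (S n) * cis t)))) \<longlonglongrightarrow>
        (LINT t|circle_angle. log_plus (norm (boundary_value f (cis t))))"
proof -
  have "filterlim S (at_left 1) sequentially"
    unfolding filterlim_at using assms(2,3) by (auto simp: less_imp_neq)
  moreover have "((\<lambda>r. circle_mean (\<lambda>\<zeta>. log_plus (norm (f (of_real r * \<zeta>))))) \<longlongrightarrow>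
        circle_mean (\<lambda>\<zeta>. log_plus (norm (boundary_value f \<zeta>)))) (at_left 1)"
    using assms(1) by (simp add: smirnov_class_def)
  ultimately have "(\<lambda>n. circle_mean (\<lambda>\<zeta>. log_plus (norm (f (of_real (S n) * \<zeta>))))) \<longlonglongrightarrow>
        circle_mean (\<lambda>\<zeta>. log_plus (norm (boundary_value f \<zeta>)))"
    by (rule filterlim_compose[rotated])
  from tendsto_mult_right[OF this, of "2 * pi"] show ?thesis
    unfolding circle_mean_eq by simp
qed

text \<open>Subadditivity of \<open>log_plus\<close> on products gives a majorant that changes with
  the radius, and the Smirnov property of the two factors is exactly the convergence of its
  integrals.\<close>

lemma hardy_orlicz_mult:
  assumes f: "f \<in> hardy_orlicz p" and g: "g \<in> hardy_orlicz p" and p: "p > 0"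
  shows "(\<lambda>z. f z * g z) \<in> hardy_orlicz p"
proof -
  have sf: "f \<in> smirnov_class" and sg: "g \<in> smirnov_class"
    using f g by (auto simp: hardy_orlicz_def)
  then have nf: "f \<in> nevanlinna_class" and ng: "g \<in> nevanlinna_class"
    by (auto simp: smirnov_class_def)
  have hf: "f holomorphic_on unit_disc" and hg: "g holomorphic_on unit_disc"
    using nf ng by (auto simp: nevanlinna_class_def)
  let ?h = "\<lambda>z. f z * g z"
  let ?F = "\<lambda>t. log_plus (norm (boundary_value f (cis t)))"
  let ?G = "\<lambda>t. log_plus (norm (boundary_value g (cis t)))"
  let ?H = "\<lambda>t. log_plus (norm (boundary_value ?h (cis t)))"
  have hh: "?h holomorphic_on unit_disc" using hf hg by (intro holomorphic_intros)
  have ae_fg: "AE t in circle_angle. has_nontangential_limit f (cis t) (boundary_value f (cis t)) \<and>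
      has_nontangential_limit g (cis t) (boundary_value g (cis t)) \<and>
      has_nontangential_limit ?h (cis t) (boundary_value ?h (cis t)) \<and>
      boundary_value ?h (cis t) = boundary_value f (cis t) * boundary_value g (cis t)"
    using fatou_nevanlinna_class[OF nf] fatou_nevanlinna_class[OF ng]
  proof eventually_elim
    case (elim t)
    have h: "has_nontangential_limit ?h (cis t) (boundary_value f (cis t) * boundary_value g (cis t))"
      by (rule has_nontangential_limit_mult[OF elim])
    then show ?case using elim boundary_value_eq[OF h] by simp
  qed
  then have ae_h: "AE t in circle_angle. has_nontangential_limit ?h (cis t) (boundary_value ?h (cis t))"
    by eventually_elim blast
  have H_le: "AE t in circle_angle. ?H t \<le> ?F t + ?G t"
    using ae_fg by eventually_elim (simp add: norm_mult log_plus_mult_le)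
  have mH[measurable]: "?H \<in> borel_measurable circle_angle"
    using boundary_value_measurable[OF hh ae_h] unfolding log_plus_def by measurable
  have iF: "integrable circle_angle ?F" and iG: "integrable circle_angle ?G"
    using sf sg by (auto simp: smirnov_class_def circle_integrable_iff)
  then have iFG: "integrable circle_angle (\<lambda>t. ?F t + ?G t)" by simp
  have iH: "integrable circle_angle ?H"
    by (rule Bochner_Integration.integrable_bound[OF iFG mH]) (use H_le in \<open>eventually_elim, simp\<close>)
  have "?h \<in> smirnov_class"
  proof (rule smirnovI[OF hh ae_h iH])
    fix S :: "nat \<Rightarrow> real" assume S: "\<And>n. 0 < S n" "\<And>n. S n < 1" "S \<longlonglongrightarrow> 1"
    have S': "\<bar>S n\<bar> < 1" for n using S(1,2)[of n] by simp
    let ?a = "\<lambda>n t. log_plus (norm (f (of_real (S n) * cis t) * g (of_real (S n) * cis t)))"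
    let ?b = "\<lambda>n t. log_plus (norm (f (of_real (S n) * cis t))) + log_plus (norm (g (of_real (S n) * cis t)))"
    show "(\<lambda>n. LINT t|circle_angle. ?a n t) \<longlonglongrightarrow> (LINT t|circle_angle. ?H t)"
    proof (rule integral_tendsto_varying_majorants(2)[where b = ?b and B = "\<lambda>t. ?F t + ?G t"])
      show "?a n \<in> borel_measurable circle_angle" for n
        by (rule borel_measurable_integrable[OF log_plus_dilate_integrable[OF hh S']])
      show "integrable circle_angle (?b n)" for n
        by (intro Bochner_Integration.integrable_add log_plus_dilate_integrable hf hg S')
      show "?a n t \<le> ?b n t" for n t by (simp add: norm_mult log_plus_mult_le)
      show "AE t in circle_angle. (\<lambda>n. ?a n t) \<longlonglongrightarrow> ?H t"
        using ae_h
      proof eventually_elim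
        case (elim t)
        show ?case by (rule log_plus_radial_limit[OF elim S(2,3)])
      qed
      show "AE t in circle_angle. (\<lambda>n. ?b n t) \<longlonglongrightarrow> ?F t + ?G t"
        using ae_fg
      proof eventually_elim
        case (elim t)
        show ?case
          by (intro tendsto_add log_plus_radial_limit[OF _ S(2,3)]) (use elim in blast)+
      qed
      have "(\<lambda>n. (LINT t|circle_angle. log_plus (norm (f (of_real (S n) * cis t)))) +
          (LINT t|circle_angle. log_plus (norm (g (of_real (S n) * cis t)))))
        \<longlonglongrightarrow> (LINT t|circle_angle. ?F t) + (LINT t|circle_angle. ?G t)"
        by (intro tendsto_add smirnov_radial_tendsto sf sg S)
      then show "(\<lambda>n. LINT t|circle_angle. ?b n t) \<longlonglongrightarrow> (LINT t|circle_angle. ?F t + ?G t)"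
        using iF iG by (simp add: log_plus_dilate_integrable[OF hf S'] log_plus_dilate_integrable[OF hg S'])
    qed (use mH iFG in auto)
  qed
  moreover have "integrable circle_angle (\<lambda>t. ?H t powr p)"
  proof -
    have "integrable circle_angle (\<lambda>t. ?F t powr p)" "integrable circle_angle (\<lambda>t. ?G t powr p)"
      using f g by (auto simp: hardy_orlicz_def circle_integrable_iff)
    then have "integrable circle_angle (\<lambda>t. 2 powr p * (?F t powr p + ?G t powr p))" by simp
    then show ?thesis
    proof (rule Bochner_Integration.integrable_bound)
      show "AE t in circle_angle. norm (?H t powr p) \<le> norm (2 powr p * (?F t powr p + ?G t powr p))"
        using H_le
      proof eventually_elim
        case (elim t)
        have "?H t powr p \<le> (2 * max (?F t) (?G t)) powr p"
          using elim p by (intro powr_mono2) auto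
        also have "\<dots> = 2 powr p * (max (?F t) (?G t)) powr p"
          by (rule powr_mult)
        also have "\<dots> \<le> 2 powr p * (?F t powr p + ?G t powr p)"
          by (intro mult_left_mono) (auto simp: max_def)
        finally show ?case by simp
      qed
    qed measurable
  qed
  ultimately show ?thesis
    unfolding hardy_orlicz_def circle_integrable_iff by simp
qed

lemma log_plus_square_le:
  assumes "0 \<le> x" "0 \<le> s" "x \<le> s\<^sup>2"
  shows "log_plus x \<le> 2 * s"
proof -
  have "max 1 (s\<^sup>2) = (max 1 s)\<^sup>2"
    using assms(2) power_le_one[of s 2] one_le_power[of s 2] by (cases "s \<le> 1") auto
  then have "log_plus (s\<^sup>2) = 2 * ln (max 1 s)"
    by (simp add: log_plus_eq ln_realpow)
  also have "ln (max 1 s) \<le> max 1 s - 1"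
    by (rule ln_le_minus_one) (auto simp: max_def)
  also have "\<dots> \<le> s" using assms(2) by auto
  finally show ?thesis
    using log_plus_mono[OF assms(1,3)] by simp
qed

text \<open>With \<open>y\<close> the \<open>p\<close>-th root of \<open>max 1 s\<close>,
  \<open>log_plus x\<close> is at most \<open>2 * p * ln y\<close>, hence at most
  \<open>2 * p * y\<close>, whose \<open>p\<close>-th power is linear in \<open>max 1 s\<close>.
  Thus integrability of \<open>s\<close> controls every power of the logarithm.\<close>

lemma log_plus_powr_square_le:
  assumes "0 \<le> x" "0 \<le> s" "x \<le> s\<^sup>2" "p > 0"
  shows "log_plus x powr p \<le> (2 * p) powr p * (1 + s)"
proof -
  define y where "y = max 1 s powr (1 / p)"
  have y: "y \<ge> 1" unfolding y_def using assms by (intro ge_one_powr_ge_zero) auto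
  have "max 1 s = y powr p"
    using assms by (simp add: y_def powr_powr)
  have "x \<le> (y powr p)\<^sup>2"
    using assms(2,3) unfolding \<open>max 1 s = y powr p\<close>[symmetric]
    by (auto intro: order_trans power_mono)
  also have "\<dots> = y powr (2 * p)"
    using y by (simp add: power2_eq_square flip: powr_add)
  finally have "log_plus x \<le> log_plus (y powr (2 * p))"
    using assms(1) by (intro log_plus_mono)
  also have "\<dots> = 2 * p * ln y"
  proof -
    have "1 \<le> y powr (2 * p)" using y assms(4) by (intro ge_one_powr_ge_zero) auto
    then show ?thesis using y by (simp add: log_plus_eq max_def ln_powr)
  qed
  also have "\<dots> \<le> 2 * p * y"
    using y assms(4) ln_le_minus_one[of y] by (intro mult_left_mono) auto
  finally have "log_plus x powr p \<le> (2 * p * y) powr p"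
    using assms(4) by (intro powr_mono2) auto
  also have "\<dots> = (2 * p) powr p * max 1 s"
    using y assms(4) \<open>max 1 s = y powr p\<close> by (simp add: powr_mult)
  also have "\<dots> \<le> (2 * p) powr p * (1 + s)"
    using assms(2) by (intro mult_left_mono) auto
  finally show ?thesis .
qed

text \<open>The square expresses that the radial maximal function of \<open>h\<close> has an
  integrable square root. Since the majorant does not depend on \<open>r\<close>, it provides the
  bounded means for Fatou's theorem, the Smirnov limit by dominated convergence, and the
  \<open>p\<close>-th power.\<close>

lemma hardy_orlicz_if_dominated:
  assumes hol: "h holomorphic_on unit_disc" and p: "p > 0"
    and S: "integrable circle_angle S" "\<And>t. 0 \<le> S t"
    and le: "AE t in circle_angle. \<forall>r. 0 < r \<longrightarrow> r < 1 \<longrightarrow> norm (h (of_real r * cis t)) \<le> (S t)\<^sup>2"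
  shows "h \<in> hardy_orlicz p"
proof -
  have dom: "AE t in circle_angle. log_plus (norm (h (of_real r * cis t))) \<le> 2 * S t" if "0 < r" "r < 1" for r
    using le by eventually_elim (use that S(2) in \<open>auto intro: log_plus_square_le\<close>)
  have "AE t in circle_angle. \<exists>l. has_nontangential_limit h (cis t) l"
  proof (rule fatou_nevanlinna[OF hol radius_bounds radius_tendsto])
    fix n
    have "(LINT t|circle_angle. log_plus (norm (h (of_real (radius n) * cis t)))) \<le> (LINT t|circle_angle. 2 * S t)"
      using radius_bounds[of n] S(1) dom
      by (intro integral_mono_AE log_plus_dilate_integrable hol) auto
    then show "circle_mean (\<lambda>\<zeta>. log_plus (norm (h (of_real (radius n) * \<zeta>)))) \<le> (LINT t|circle_angle. 2 * S t) / (2 * pi)"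
      unfolding circle_mean_eq by (intro divide_right_mono) auto
  qed
  then have ae: "AE t in circle_angle. has_nontangential_limit h (cis t) (boundary_value h (cis t))"
    by eventually_elim (use boundary_value_eq in fastforce)
  have ae_le: "AE t in circle_angle. norm (boundary_value h (cis t)) \<le> (S t)\<^sup>2"
    using ae le
  proof eventually_elim
    case (elim t)
    have "(\<lambda>n. h (of_real (radius n) * cis t)) \<longlonglongrightarrow> boundary_value h (cis t)"
      by (rule filterlim_compose[OF nontangential_imp_radial[OF elim(1)] radius_filterlim]) simp
    then show ?case
      by (rule tendsto_upperbound[OF tendsto_norm]) (use elim(2) radius_bounds in auto)
  qed
  let ?H = "\<lambda>t. log_plus (norm (boundary_value h (cis t)))"
  have mH[measurable]: "?H \<in> borel_measurable circle_angle"
    using boundary_value_measurable[OF hol ae] unfolding log_plus_def by measurable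
  have i2: "integrable circle_angle (\<lambda>t. 2 * S t)" using S(1) by simp
  have iH: "integrable circle_angle ?H"
  proof (rule Bochner_Integration.integrable_bound[OF i2 mH])
    show "AE t in circle_angle. norm (?H t) \<le> norm (2 * S t)"
      using ae_le by eventually_elim (use S(2) log_plus_square_le in force)
  qed
  have "h \<in> smirnov_class"
  proof (rule smirnovI[OF hol ae iH])
    fix s :: "nat \<Rightarrow> real" assume s: "\<And>n. 0 < s n" "\<And>n. s n < 1" "s \<longlonglongrightarrow> 1"
    have s': "\<bar>s n\<bar> < 1" for n using s(1,2)[of n] by simp
    show "(\<lambda>n. LINT t|circle_angle. log_plus (norm (h (of_real (s n) * cis t)))) \<longlonglongrightarrow> (LINT t|circle_angle. ?H t)"
    proof (rule integral_dominated_convergence[OF mH _ i2])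
      show "(\<lambda>t. log_plus (norm (h (of_real (s n) * cis t)))) \<in> borel_measurable circle_angle" for n
        by (rule borel_measurable_integrable[OF log_plus_dilate_integrable[OF hol s']])
      show "AE t in circle_angle. (\<lambda>n. log_plus (norm (h (of_real (s n) * cis t)))) \<longlonglongrightarrow> ?H t"
        using ae
      proof eventually_elim
        case (elim t)
        show ?case by (rule log_plus_radial_limit[OF elim s(2,3)])
      qed
      show "AE t in circle_angle. norm (log_plus (norm (h (of_real (s n) * cis t)))) \<le> 2 * S t" for n
        using dom[OF s(1,2)] by simp
    qed
  qed
  moreover have "integrable circle_angle (\<lambda>t. ?H t powr p)"
  proof (rule Bochner_Integration.integrable_bound)
    interpret finite_measure circle_angle by (rule finite_measure_circle_angle)
    show "integrable circle_angle (\<lambda>t. (2 * p) powr p * (1 + S t))" using S(1) by simp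
    show "AE t in circle_angle. norm (?H t powr p) \<le> norm ((2 * p) powr p * (1 + S t))"
      using ae_le
    proof eventually_elim
      case (elim t)
      have "?H t powr p \<le> (2 * p) powr p * (1 + S t)"
        by (rule log_plus_powr_square_le[OF _ S(2) elim p]) simp
      then show ?case using S(2)[of t] by simp
    qed
  qed measurable
  ultimately show ?thesis
    unfolding hardy_orlicz_def circle_integrable_iff by simp
qed

subsection \<open>Interpolation\<close>

text \<open>Multiplied by \<open>1 - (norm a)\<^sup>2\<close>, the integrand is the real part of
  \<open>(1 + cnj a * z) / (1 - cnj a * z)\<close>, whose mean is its value 1 at the origin.\<close>

lemma integral_poisson_kernel:
  assumes a: "norm a < 1"
  shows "(LINT t|circle_angle. 1 / (norm (1 - cnj a * cis t))\<^sup>2) = 2 * pi / (1 - (norm a)\<^sup>2)"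
proof -
  have a2: "(norm a)\<^sup>2 < 1" using a by (simp add: abs_square_less_1)
  let ?f = "\<lambda>z. (1 + cnj a * z) / (1 - cnj a * z)"
  have nz: "1 - cnj a * z \<noteq> 0" if "norm z \<le> 1" for z
    using one_minus_cnj_mult_nonzero[OF a that] .
  have cont: "continuous_on (cball 0 1) ?f"
    using nz by (intro continuous_intros) auto
  have "(LINT t|circle_angle. ?f (cis t)) = of_real (2 * pi) * ?f 0"
    by (rule mean_value_cis[OF cont]) (use nz in \<open>auto intro!: holomorphic_intros\<close>)
  moreover have "integrable circle_angle (\<lambda>t. ?f (cis t))"
    by (intro continuous_imp_integrable_circle_angle continuous_on_compose2[OF cont] continuous_intros) auto
  ultimately have int: "(LINT t|circle_angle. Re (?f (cis t))) = 2 * pi"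
    by simp
  have eq: "Re (?f (cis t)) = (1 - (norm a)\<^sup>2) * (1 / (norm (1 - cnj a * cis t))\<^sup>2)" for t
  proof -
    let ?w = "cnj a * cis t"
    have "?f (cis t) = (1 + ?w) * cnj (1 - ?w) / of_real ((norm (1 - ?w))\<^sup>2)"
      by (subst complex_div_cnj) simp
    then have "Re (?f (cis t)) = Re ((1 + ?w) * cnj (1 - ?w)) / (norm (1 - ?w))\<^sup>2"
      by (simp only: Re_divide_of_real)
    also have "Re ((1 + ?w) * cnj (1 - ?w)) = 1 - (norm ?w)\<^sup>2"
      unfolding cmod_power2 by (simp add: power2_eq_square algebra_simps)
    finally show ?thesis by (simp add: norm_mult)
  qed
  have "(1 - (norm a)\<^sup>2) * (LINT t|circle_angle. 1 / (norm (1 - cnj a * cis t))\<^sup>2) = 2 * pi"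
    using int unfolding eq by (simp only: integral_mult_right_zero)
  then show ?thesis using a2 by (simp only: eq_divide_eq) (simp add: mult.commute)
qed

text \<open>This expresses subadditivity of the square root: bounds on the square roots of the terms
  may simply be added.\<close>

lemma sum_power2_le:
  fixes x :: "'a \<Rightarrow> real"
  assumes "\<And>i. i \<in> I \<Longrightarrow> 0 \<le> x i"
  shows "(\<Sum>i\<in>I. (x i)\<^sup>2) \<le> (\<Sum>i\<in>I. x i)\<^sup>2"
proof (cases "finite I")
  case True
  have "(\<Sum>i\<in>I. (x i)\<^sup>2) \<le> (\<Sum>i\<in>I. x i * (\<Sum>j\<in>I. x j))"
  proof (rule sum_mono)
    fix i assume i: "i \<in> I"
    have "x i \<le> (\<Sum>j\<in>I. x j)" using True assms i by (intro member_le_sum) auto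
    then show "(x i)\<^sup>2 \<le> x i * (\<Sum>j\<in>I. x j)"
      using assms[OF i] by (simp add: power2_eq_square mult_left_mono)
  qed
  then show ?thesis by (simp add: power2_eq_square sum_distrib_right)
qed simp

lemma summable_integrable_majorant:
  fixes f :: "nat \<Rightarrow> 'a \<Rightarrow> real"
  assumes int: "\<And>n. integrable M (f n)" and nonneg: "\<And>n x. 0 \<le> f n x"
    and summ: "summable (\<lambda>n. LINT x|M. f n x)"
  obtains S where "integrable M S" "\<And>x. 0 \<le> S x" "AE x in M. \<forall>N. (\<Sum>n<N. f n x) \<le> S x"
proof -
  define u where "u = (\<lambda>x. \<Sum>n. ennreal (f n x))"
  have [measurable]: "f n \<in> borel_measurable M" for n using int by auto
  have u_meas[measurable]: "u \<in> borel_measurable M" unfolding u_def by measurable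
  have "(\<integral>\<^sup>+x. u x \<partial>M) = (\<Sum>n. \<integral>\<^sup>+x. ennreal (f n x) \<partial>M)"
    unfolding u_def by (rule nn_integral_suminf) measurable
  also have "\<dots> = (\<Sum>n. ennreal (LINT x|M. f n x))"
    using nn_integral_eq_integral[OF int] nonneg by simp
  also have "\<dots> = ennreal (\<Sum>n. LINT x|M. f n x)"
    by (rule suminf_ennreal2[OF _ summ]) (use nonneg in \<open>simp add: Bochner_Integration.integral_nonneg\<close>)
  finally have fin: "(\<integral>\<^sup>+x. u x \<partial>M) < \<infinity>" by simp
  have le_u: "ennreal (enn2real (u x)) \<le> u x" for x
    by (cases "u x") auto
  have "integrable M (\<lambda>x. enn2real (u x))"
  proof (rule integrableI_nonneg)
    show "(\<integral>\<^sup>+x. ennreal (enn2real (u x)) \<partial>M) < \<infinity>"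
      by (rule le_less_trans[OF nn_integral_mono fin]) (rule le_u)
  qed auto
  moreover have "AE x in M. u x \<noteq> \<infinity>"
    by (rule nn_integral_PInf_AE[OF u_meas]) (use fin in auto)
  then have "AE x in M. \<forall>N. (\<Sum>n<N. f n x) \<le> enn2real (u x)"
  proof eventually_elim
    case (elim x)
    show ?case
    proof
      fix N
      have "ennreal (\<Sum>n<N. f n x) = (\<Sum>n<N. ennreal (f n x))"
        using nonneg by (simp add: sum_ennreal)
      also have "\<dots> \<le> u x" unfolding u_def by (rule sum_le_suminf) auto
      also have "\<dots> = ennreal (enn2real (u x))" using elim by (simp add: less_top)
      finally show "(\<Sum>n<N. f n x) \<le> enn2real (u x)"
        by (subst (asm) ennreal_le_iff) auto
    qed
  qed
  ultimately show ?thesis using that[of "\<lambda>x. enn2real (u x)"] by auto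
qed

text \<open>Replacing \<open>w\<close> by \<open>r * w\<close> changes \<open>1 - w\<close> by at
  most \<open>1 - r\<close>, which is itself at most the modulus of \<open>1 - r * w\<close>. So the
  kernel along a radius is at most twice its boundary value.\<close>

lemma szego_kernel_radial_le:
  assumes a: "norm a < 1" and r: "0 < r" "r < 1"
  shows "norm (1 - cnj a * cis t) \<le> 2 * norm (1 - cnj a * (of_real r * cis t))"
proof -
  let ?w = "cnj a * cis t"
  have w: "norm ?w < 1" using a by (simp add: norm_mult)
  have "norm (of_real r * ?w) \<le> r" using w r by (simp add: norm_mult mult_left_le)
  then have 1: "1 - r \<le> norm (1 - of_real r * ?w)"
    using norm_triangle_ineq2[of 1 "of_real r * ?w"] by simp
  have "norm (1 - ?w) \<le> norm (1 - of_real r * ?w) + norm (of_real (1 - r) * ?w)"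
    using norm_triangle_ineq4[of "1 - of_real r * ?w" "of_real (1 - r) * ?w"] by (simp add: algebra_simps)
  also have "norm (of_real (1 - r) * ?w) \<le> 1 - r"
    using w r by (simp only: norm_mult[of "of_real (1 - r)"] norm_of_real) (simp add: mult_left_le)
  finally show ?thesis using 1 by (simp add: mult.left_commute)
qed

text \<open>The interpolating functions are built from finite Blaschke products, whose limit is
  taken by Montel's theorem. The fourth power of the normalized kernel makes the square roots
  of the terms integrable over the circle.\<close>

lemma interpolating_function:
  fixes l :: "nat \<Rightarrow> complex" and D :: "nat \<Rightarrow> real" and a :: "nat \<Rightarrow> complex"
  assumes l: "\<And>n. l n \<in> unit_disc" and D: "\<And>n. 0 < D n"
    and sep: "\<And>N n. n < N \<Longrightarrow> 1 \<le> (D n)\<^sup>2 * (\<Prod>k\<in>{..<N} - {n}. norm (blaschke (l k) (l n)))"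
    and summ: "summable (\<lambda>n. (1 - norm (l n)) * D n)"
    and a: "\<And>n. norm (a n) \<le> A"
  obtains h S where "h holomorphic_on unit_disc" "\<And>n. h (l n) = a n"
    "integrable circle_angle S" "\<And>t. 0 \<le> S t"
    "AE t in circle_angle. \<forall>r. 0 < r \<longrightarrow> r < 1 \<longrightarrow> norm (h (of_real r * cis t)) \<le> (S t)\<^sup>2"
proof -
  have ln: "norm (l n) < 1" for n using l[of n] by simp
  have A: "0 \<le> A" using order_trans[OF norm_ge_zero a] .
  have nz: "1 - cnj (l n) * z \<noteq> 0" if "norm z \<le> 1" for n z
    using one_minus_cnj_mult_nonzero[OF ln that] .
  define q where "q = (\<lambda>n. 1 - (norm (l n))\<^sup>2)"
  have q: "0 < q n" "q n \<le> 2 * (1 - norm (l n))" "q n \<le> 1" for n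
  proof -
    have "0 \<le> (1 - norm (l n))\<^sup>2" by simp
    then show "q n \<le> 2 * (1 - norm (l n))" by (simp add: q_def power2_eq_square algebra_simps)
  qed (use ln[of n] in \<open>auto simp: q_def abs_square_less_1\<close>)
  define K where "K = (\<lambda>n z. of_real (q n) / (1 - cnj (l n) * z))"
  define E where "E = (\<lambda>N n z. \<Prod>k\<in>{..<N} - {n}. blaschke (l k) z)"
  define H where "H = (\<lambda>N z. \<Sum>n<N. a n * (E N n z / E N n (l n)) * K n z ^ 4)"
  \<comment> \<open>The square root of a bound for the \<open>n\<close>-th term: \<open>A\<close>
    for the prescribed value, \<open>(D n)\<^sup>2\<close> for the quotient of Blaschke products,
    and the fourth power of the kernel.\<close>
  define x where "x = (\<lambda>n z. sqrt A * D n * (norm (K n z))\<^sup>2)"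
  have x_nonneg: "0 \<le> x n z" for n z using A D[of n] by (simp add: x_def)
  have E_pos: "1 \<le> (D n)\<^sup>2 * norm (E N n (l n))" if "n < N" for n N
    using sep[OF that] by (simp add: E_def prod_norm)
  have E_nz: "E N n (l n) \<noteq> 0" if "n < N" for n N using E_pos[OF that] by auto
  have E_le: "norm (E N n z) \<le> 1" if "norm z < 1" for N n z
  proof -
    have "norm (blaschke (l k) z) \<le> 1" for k
      by (rule less_imp_le[OF Moebius_function_norm_lt_1[OF ln that]])
    then show ?thesis
      unfolding E_def prod_norm[symmetric] by (intro prod_le_1) auto
  qed
  have hol_blaschke: "blaschke (l k) holomorphic_on unit_disc" for k
    by (rule Moebius_function_holomorphic[OF ln])
  have hol_H: "H N holomorphic_on unit_disc" for N
    unfolding H_def E_def K_def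
    using nz by (intro holomorphic_intros hol_blaschke) (auto simp: E_nz[unfolded E_def] less_imp_le)
  have H_interp: "H N (l m) = a m" if m: "m < N" for N m
  proof -
    have zero: "E N n (l m) = 0" if "n \<noteq> m" for n
      unfolding E_def using that m by (intro prod_zero bexI[of _ m]) (auto simp: Moebius_function_eq_zero)
    have "K m (l m) = 1"
    proof -
      have "1 - cnj (l m) * l m = of_real (q m)"
        using complex_norm_square[of "l m"] by (simp add: q_def mult.commute)
      then show ?thesis using q(1)[of m] by (simp add: K_def)
    qed
    then have "H N (l m) = (\<Sum>n<N. if n = m then a m else 0)"
      unfolding H_def using zero E_nz[OF m] by (intro sum.cong) auto
    then show ?thesis using m by simp
  qed
  have H_le: "norm (H N z) \<le> (\<Sum>n<N. x n z)\<^sup>2" if z: "norm z < 1" for N z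
  proof -
    have "norm (H N z) \<le> (\<Sum>n<N. norm (a n * (E N n z / E N n (l n)) * K n z ^ 4))"
      unfolding H_def by (rule norm_sum)
    also have "\<dots> \<le> (\<Sum>n<N. (x n z)\<^sup>2)"
    proof (rule sum_mono)
      fix n assume "n \<in> {..<N}"
      then have n: "n < N" by simp
      have "norm (E N n z / E N n (l n)) \<le> (D n)\<^sup>2"
      proof -
        have "norm (E N n z) \<le> (D n)\<^sup>2 * norm (E N n (l n))"
          using E_le[OF z] E_pos[OF n] order_trans by blast
        then show ?thesis using E_nz[OF n] by (simp add: norm_divide field_simps)
      qed
      then have "norm (a n * (E N n z / E N n (l n)) * K n z ^ 4) \<le> A * (D n)\<^sup>2 * norm (K n z) ^ 4"
        unfolding norm_mult norm_power using a[of n] A by (intro mult_mono mult_nonneg_nonneg) auto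
      also have "\<dots> = (x n z)\<^sup>2"
        using A by (simp add: x_def power_mult_distrib flip: power_mult)
      finally show "norm (a n * (E N n z / E N n (l n)) * K n z ^ 4) \<le> (x n z)\<^sup>2" .
    qed
    also have "\<dots> \<le> (\<Sum>n<N. x n z)\<^sup>2" by (rule sum_power2_le) (rule x_nonneg)
    finally show ?thesis .
  qed
  define T where "T = (\<Sum>n. (1 - norm (l n)) * D n)"
  have T_le: "(\<Sum>n<N. (1 - norm (l n)) * D n) \<le> T" for N
    unfolding T_def by (rule sum_le_suminf[OF summ]) (use ln D in \<open>auto simp: less_imp_le\<close>)
  \<comment> \<open>A locally uniform bound for Montel's theorem: away from the circle
    \<open>K n\<close> is of size \<open>q n\<close>, and one of the two factors \<open>q n\<close>
    in its square is estimated by 1.\<close>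
  have x_le: "x n z \<le> sqrt A * 2 / (1 - s)\<^sup>2 * ((1 - norm (l n)) * D n)" if z: "norm z \<le> s" "s < 1" for n z s
  proof -
    have "1 - s \<le> norm (1 - cnj (l n) * z)"
    proof -
      have "norm (cnj (l n) * z) \<le> 1 * norm z"
        unfolding norm_mult using ln[of n] by (intro mult_right_mono) auto
      then show ?thesis using norm_triangle_ineq2[of 1 "cnj (l n) * z"] z by simp
    qed
    then have "norm (K n z) \<le> q n / (1 - s)"
      unfolding K_def norm_divide using q(1)[of n] z by (auto intro!: frac_le)
    then have "(norm (K n z))\<^sup>2 \<le> (q n / (1 - s))\<^sup>2"
      by (intro power_mono) auto
    also have "\<dots> = q n * q n / (1 - s)\<^sup>2" by (simp add: power_divide power2_eq_square)
    also have "q n * q n \<le> 2 * (1 - norm (l n)) * 1"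
      using q[of n] ln[of n] by (intro mult_mono) auto
    finally have "(norm (K n z))\<^sup>2 \<le> 2 * (1 - norm (l n)) / (1 - s)\<^sup>2"
      by (simp add: divide_right_mono)
    then have "sqrt A * D n * (norm (K n z))\<^sup>2 \<le> sqrt A * D n * (2 * (1 - norm (l n)) / (1 - s)\<^sup>2)"
      using A D[of n] by (intro mult_left_mono) auto
    then show ?thesis by (simp add: x_def mult_ac)
  qed
  obtain h k where h: "h holomorphic_on unit_disc" "strict_mono (k :: nat \<Rightarrow> nat)"
    "\<And>x. x \<in> unit_disc \<Longrightarrow> ((\<lambda>n. H (k n) x) \<longlonglongrightarrow> h x)"
  proof (rule Montel[of unit_disc "range H" H])
    fix C :: "complex set" assume C: "compact C" "C \<subseteq> unit_disc"
    obtain s where s: "s < 1" "\<And>z. z \<in> C \<Longrightarrow> norm z \<le> s"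
    proof (cases "C = {}")
      case False
      obtain w where "w \<in> C" "\<And>z. z \<in> C \<Longrightarrow> norm z \<le> norm w"
        using continuous_attains_sup[OF C(1) False, of norm] continuous_on_norm_id by blast
      then show ?thesis using that[of "norm w"] C(2) by auto
    qed (use that[of 0] in auto)
    have "norm (H N z) \<le> (sqrt A * 2 / (1 - s)\<^sup>2 * T)\<^sup>2" if z: "z \<in> C" for N z
    proof -
      have "(\<Sum>n<N. x n z) \<le> (\<Sum>n<N. sqrt A * 2 / (1 - s)\<^sup>2 * ((1 - norm (l n)) * D n))"
        by (intro sum_mono x_le s z)
      also have "\<dots> \<le> sqrt A * 2 / (1 - s)\<^sup>2 * T"
        unfolding sum_distrib_left[symmetric] using A by (intro mult_left_mono T_le) auto
      finally have "(\<Sum>n<N. x n z)\<^sup>2 \<le> (sqrt A * 2 / (1 - s)\<^sup>2 * T)\<^sup>2"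
        by (intro power_mono sum_nonneg x_nonneg)
      moreover have "norm z < 1" using z C(2) by auto
      ultimately show ?thesis using H_le order_trans by blast
    qed
    then show "\<exists>B. \<forall>h\<in>range H. \<forall>z\<in>C. norm (h z) \<le> B" by blast
  qed (use hol_H in auto)
  have interp: "h (l m) = a m" for m
  proof (rule LIMSEQ_unique[OF h(3)[OF l]])
    have "\<forall>\<^sub>F n in sequentially. H (k n) (l m) = a m"
      using eventually_gt_at_top[of m]
    proof eventually_elim
      case (elim n)
      \<comment> \<open>So \<open>k n\<close> exceeds \<open>m\<close>, and the node
        \<open>l m\<close> is already among those interpolated by \<open>H (k n)\<close>.\<close>
      have "n \<le> k n" using h(2) by (rule seq_suble)
      then show ?case using elim by (intro H_interp) simp
    qed
    then show "(\<lambda>n. H (k n) (l m)) \<longlonglongrightarrow> a m" by (rule tendsto_eventually)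
  qed
  \<comment> \<open>The 4 is the square of the factor 2 between a kernel on the radius and at its
    end point, so \<open>f n t\<close> bounds \<open>x n\<close> along the whole radius.\<close>
  define f where "f = (\<lambda>n t. 4 * x n (cis t))"
  have cont_K: "continuous_on {0..2 * pi} (\<lambda>t. norm (K n (cis t)))" for n
    unfolding K_def using nz by (intro continuous_intros) auto
  have int_f: "integrable circle_angle (f n)" for n
    unfolding f_def x_def by (intro continuous_imp_integrable_circle_angle continuous_intros cont_K)
  have LINT_f: "(LINT t|circle_angle. f n t) = 8 * pi * sqrt A * D n * q n" for n
  proof -
    have "f n t = 4 * sqrt A * D n * (q n)\<^sup>2 * (1 / (norm (1 - cnj (l n) * cis t))\<^sup>2)" for t
      using q(1)[of n] by (simp add: f_def x_def K_def norm_divide power_divide)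
    then have "(LINT t|circle_angle. f n t) = 4 * sqrt A * D n * (q n)\<^sup>2 * (2 * pi / q n)"
      using integral_poisson_kernel[OF ln[of n]] unfolding q_def by (simp only: integral_mult_right_zero)
    then show ?thesis using q(1)[of n] by (simp add: power2_eq_square)
  qed
  have "summable (\<lambda>n. 16 * pi * sqrt A * ((1 - norm (l n)) * D n))"
    by (rule summable_mult[OF summ])
  then have "summable (\<lambda>n. LINT t|circle_angle. f n t)"
  proof (rule summable_comparison_test'[of _ 0])
    fix n :: nat
    have "8 * pi * sqrt A * D n * q n \<le> 8 * pi * sqrt A * D n * (2 * (1 - norm (l n)))"
      using A D[of n] q(2)[of n] by (intro mult_left_mono) auto
    moreover have "0 \<le> 8 * pi * sqrt A * D n * q n"
      using A D[of n] q(1)[of n] by (intro mult_nonneg_nonneg) auto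
    ultimately show "norm (LINT t|circle_angle. f n t) \<le> 16 * pi * sqrt A * ((1 - norm (l n)) * D n)"
      unfolding LINT_f by (simp add: mult_ac)
  qed
  then obtain S where S: "integrable circle_angle S" "\<And>t. 0 \<le> S t"
    "AE t in circle_angle. \<forall>N. (\<Sum>n<N. f n t) \<le> S t"
    using summable_integrable_majorant[of circle_angle f, OF int_f] x_nonneg unfolding f_def by auto
  have "AE t in circle_angle. \<forall>r. 0 < r \<longrightarrow> r < 1 \<longrightarrow> norm (h (of_real r * cis t)) \<le> (S t)\<^sup>2"
    using S(3)
  proof (eventually_elim, intro allI impI)
    fix t r :: real assume t: "\<forall>N. (\<Sum>n<N. f n t) \<le> S t" and r: "0 < r" "r < 1"
    let ?z = "of_real r * cis t"
    have z: "norm ?z < 1" using r by (simp add: norm_mult)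
    have xf: "x n ?z \<le> f n t" for n
    proof -
      have "norm (K n ?z) \<le> 2 * norm (K n (cis t))"
        using szego_kernel_radial_le[OF ln[of n] r, of t] nz[of "cis t" n] nz[of ?z n] z q(1)[of n]
        by (simp add: K_def norm_divide field_simps)
      then have "(norm (K n ?z))\<^sup>2 \<le> (2 * norm (K n (cis t)))\<^sup>2" by (intro power_mono) auto
      then have "sqrt A * D n * (norm (K n ?z))\<^sup>2 \<le> sqrt A * D n * (4 * (norm (K n (cis t)))\<^sup>2)"
        using A D[of n] by (intro mult_left_mono) (auto simp: power_mult_distrib)
      then show ?thesis by (simp add: f_def x_def)
    qed
    have "norm (H N ?z) \<le> (S t)\<^sup>2" for N
    proof -
      have "(\<Sum>n<N. x n ?z) \<le> S t"
        by (rule order_trans[OF sum_mono[OF xf] t[rule_format]])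
      then have "(\<Sum>n<N. x n ?z)\<^sup>2 \<le> (S t)\<^sup>2" by (intro power_mono sum_nonneg x_nonneg)
      then show ?thesis using H_le[OF z, of N] by simp
    qed
    moreover have "(\<lambda>n. norm (H (k n) ?z)) \<longlonglongrightarrow> norm (h ?z)"
      by (intro tendsto_norm h(3)) (use z in simp)
    ultimately show "norm (h ?z) \<le> (S t)\<^sup>2"
      by (intro tendsto_upperbound[where F = sequentially and f = "\<lambda>n. norm (H (k n) ?z)"]) auto
  qed
  then show ?thesis using that[OF h(1) interp S(1,2)] by blast
qed

subsection \<open>Random Blaschke products\<close>

text \<open>The kernel \<open>\<epsilon> (\<epsilon> + u)\<^sup>-\<^sup>3\<^sup>/\<^sup>2 u\<^sup>-\<^sup>1\<^sup>/\<^sup>2\<close> has the bounded antiderivative \<open>2 (u / (\<epsilon> + u))\<^sup>1\<^sup>/\<^sup>2\<close>.\<close>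

definition singular_kernel :: "real \<Rightarrow> real \<Rightarrow> real" where
  "singular_kernel \<epsilon> u = \<epsilon> / ((\<epsilon> + u) * sqrt (\<epsilon> + u) * sqrt u)"

lemma singular_kernel_nonneg: "0 < \<epsilon> \<Longrightarrow> 0 \<le> u \<Longrightarrow> 0 \<le> singular_kernel \<epsilon> u"
  by (simp add: singular_kernel_def)

lemma singular_kernel_measurable[measurable]: "singular_kernel \<epsilon> \<in> borel_measurable borel"
  unfolding singular_kernel_def by measurable

text \<open>The bound is free of \<open>\<epsilon>\<close>, which later is the distance of the fixed
  node to the circle; so the estimates do not degenerate as that node approaches the circle.\<close>

lemma nn_integral_singular_kernel:
  assumes e: "0 < \<epsilon>" and L: "0 \<le> L"
  shows "(\<integral>\<^sup>+u. ennreal (singular_kernel \<epsilon> u) * indicator {0..L} u \<partial>lborel) \<le> 2"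
proof -
  define F where "F = (\<lambda>u. 2 * sqrt (u / (\<epsilon> + u)))"
  have int: "(singular_kernel \<epsilon> has_integral F L - F 0) {0..L}"
  \<comment> \<open>The kernel is unbounded at 0, so the derivative is taken in the interior only
    and \<open>F\<close> is merely continuous at the ends.\<close>
  proof (rule fundamental_theorem_of_calculus_interior[OF L])
    show "continuous_on {0..L} F"
      unfolding F_def using e by (intro continuous_intros) auto
    fix u assume "u \<in> {0<..<L}"
    then have u: "0 < u" by simp
    have eq: "inverse (sqrt (u / (\<epsilon> + u))) * (\<epsilon> / (\<epsilon> + u)\<^sup>2) = singular_kernel \<epsilon> u"
    proof -
      define s where "s = sqrt (\<epsilon> + u)"
      have s: "s > 0" "\<epsilon> + u = s * s" using u e by (auto simp: s_def)
      have "sqrt (u / (\<epsilon> + u)) = sqrt u / s" by (simp add: real_sqrt_divide s_def)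
      then show ?thesis
        unfolding singular_kernel_def s_def[symmetric] using s u
        by (simp add: s(2) field_simps power2_eq_square)
    qed
    have "((\<lambda>u. u / (\<epsilon> + u)) has_real_derivative \<epsilon> / (\<epsilon> + u)\<^sup>2) (at u)"
      using u e by (auto intro!: derivative_eq_intros simp: power2_eq_square field_simps)
    then have "(F has_real_derivative 2 * (inverse (sqrt (u / (\<epsilon> + u))) / 2 * (\<epsilon> / (\<epsilon> + u)\<^sup>2))) (at u)"
      unfolding F_def using u e
      by (intro DERIV_cmult DERIV_chain2[OF DERIV_real_sqrt]) auto
    then show "(F has_vector_derivative singular_kernel \<epsilon> u) (at u)"
      unfolding eq[symmetric] by (simp add: has_real_derivative_iff_has_vector_derivative)
  qed
  let ?g = "\<lambda>u. if u \<in> {0..L} then singular_kernel \<epsilon> u else 0"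
  have "(\<integral>\<^sup>+u. ennreal (singular_kernel \<epsilon> u) * indicator {0..L} u \<partial>lborel) = (\<integral>\<^sup>+u. ennreal (?g u) \<partial>lborel)"
    by (intro nn_integral_cong) (auto simp: indicator_def)
  also have "\<dots> = ennreal (F L - F 0)"
  proof (rule nn_integral_has_integral_lborel)
    show "0 \<le> ?g u" for u using singular_kernel_nonneg[OF e] by simp
    show "(?g has_integral F L - F 0) UNIV"
      using int by (simp only: has_integral_restrict_UNIV)
  qed measurable
  also have "\<dots> \<le> ennreal 2"
  proof (rule ennreal_leI)
    have "sqrt (L / (\<epsilon> + L)) \<le> sqrt 1"
      using e L by (intro real_sqrt_le_mono) simp
    then show "F L - F 0 \<le> 2" by (simp add: F_def)
  qed
  finally show ?thesis by simp
qed

lemma nn_integral_singular_kernel_abs: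
  assumes e: "0 < \<epsilon>" and L: "0 \<le> L"
  shows "(\<integral>\<^sup>+u. ennreal (singular_kernel \<epsilon> \<bar>u\<bar>) * indicator {-L..L} u \<partial>lborel) \<le> 4"
proof -
  let ?g = "\<lambda>u. ennreal (singular_kernel \<epsilon> u) * indicator {0..L} u"
  have "(\<integral>\<^sup>+u. ennreal (singular_kernel \<epsilon> \<bar>u\<bar>) * indicator {-L..L} u \<partial>lborel) \<le> (\<integral>\<^sup>+u. ?g u + ?g (0 + -1 * u) \<partial>lborel)"
    by (intro nn_integral_mono) (auto simp: indicator_def abs_if)
  also have "\<dots> = (\<integral>\<^sup>+u. ?g u \<partial>lborel) + (\<integral>\<^sup>+u. ?g (0 + -1 * u) \<partial>lborel)"
    by (rule nn_integral_add) measurable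
  also have "(\<integral>\<^sup>+u. ?g (0 + -1 * u) \<partial>lborel) = (\<integral>\<^sup>+u. ?g u \<partial>lborel)"
    using nn_integral_real_affine[of ?g "-1" 0] by simp
  also have "(\<integral>\<^sup>+u. ?g u \<partial>lborel) + (\<integral>\<^sup>+u. ?g u \<partial>lborel) \<le> 2 + 2"
    by (intro add_mono nn_integral_singular_kernel assms)
  finally show ?thesis by simp
qed

text \<open>Bringing both points to one circle changes their distance by at most the difference of
  the moduli. The larger modulus stands on the left so that the bound survives when one of the nodes
  is the origin.\<close>

lemma norm_scaled_cis_diff_ge:
  assumes "0 \<le> a" "0 \<le> b"
  shows "max a b * norm (cis s - cis t) \<le> 2 * norm (of_real a * cis s - of_real b * cis t)"
proof -
  have *: "a * norm (cis s - cis t) \<le> 2 * norm (of_real a * cis s - of_real b * cis t)"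
    if "0 \<le> a" "0 \<le> b" for a b s t
  proof -
    let ?d = "of_real a * cis s - of_real b * cis t"
    have "\<bar>norm (of_real a * cis s) - norm (of_real b * cis t)\<bar> \<le> norm ?d"
      by (rule norm_triangle_ineq3)
    then have 1: "\<bar>a - b\<bar> \<le> norm ?d" using that by (simp add: norm_mult)
    have "a * norm (cis s - cis t) = norm (of_real a * (cis s - cis t))"
      using that by (simp add: norm_mult)
    also have "of_real a * (cis s - cis t) = ?d - of_real (a - b) * cis t"
      by (simp add: algebra_simps)
    also have "norm \<dots> \<le> norm ?d + \<bar>a - b\<bar>"
      by (rule order_trans[OF norm_triangle_ineq4]) (simp add: norm_mult flip: of_real_diff)
    finally show ?thesis using 1 by simp
  qed
  show ?thesis
    using *[OF assms] *[OF assms(2,1), of t s] by (auto simp: max_def norm_minus_commute)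
qed

text \<open>With \<open>x = P / Q\<close> the pseudohyperbolic distance, \<open>1 / sqrt x\<close>
  exceeds 1 by at most \<open>(1 - x\<^sup>2) / sqrt x\<close>, and \<open>1 - x\<^sup>2\<close>
  carries the factor \<open>1 - \<rho>\<close>. That factor is what makes products over all nodes
  converge. Lower bounds for \<open>P\<close> by \<open>d\<close> and for \<open>Q\<close> by
  \<open>\<epsilon> + d\<close> leave the singular kernel.\<close>

lemma inverse_sqrt_norm_blaschke_le:
  assumes r: "0 \<le> \<rho>" "\<rho> < 1" and s: "0 \<le> s" "s < 1" and m: "0 < m" "m \<le> max \<rho> s"
    and d: "0 < d" "d / 2 \<le> norm (cis \<theta> - cis \<psi>)"
  shows "blaschke (of_real \<rho> * cis \<theta>) (of_real s * cis \<psi>) \<noteq> 0"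
    and "1 / sqrt (norm (blaschke (of_real \<rho> * cis \<theta>) (of_real s * cis \<psi>)))
      \<le> 1 + (1 - \<rho>) * (64 * sqrt 8 / sqrt m) * singular_kernel (1 - s) d"
proof -
  let ?a = "of_real \<rho> * cis \<theta>" and ?y = "of_real s * cis \<psi>"
  have na: "norm ?a < 1" "norm ?y < 1" using r s by (auto simp: norm_mult)
  have norms: "norm ?a = \<rho>" "norm ?y = s" using r s by (auto simp: norm_mult)
  define P where "P = norm (?y - ?a)"
  define Q where "Q = norm (1 - cnj ?a * ?y)"
  define \<epsilon> where "\<epsilon> = 1 - s"
  have e: "0 < \<epsilon>" using s by (simp add: \<epsilon>_def)
  have P: "m * d / 4 \<le> P"
  proof -
    have "m * (d / 2) \<le> max \<rho> s * norm (cis \<theta> - cis \<psi>)"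
      using m d by (intro mult_mono) auto
    also have "\<dots> \<le> 2 * norm (?a - ?y)" by (rule norm_scaled_cis_diff_ge[OF r(1) s(1)])
    finally show ?thesis by (simp add: P_def norm_minus_commute)
  qed
  have "0 < m * d / 4" using m d by simp
  then have P_pos: "0 < P" using P by simp
  have eqQ: "cnj ?a * ?y = of_real (\<rho> * s) * cis (\<psi> - \<theta>)"
    by (simp add: cis_cnj cis_mult algebra_simps)
  have Q1: "\<epsilon> \<le> Q"
  proof -
    have "norm (cnj ?a * ?y) \<le> s"
      using r s by (simp add: norm_mult mult_left_le_one_le)
    then show ?thesis
      using norm_triangle_ineq2[of 1 "cnj ?a * ?y"] by (simp add: Q_def \<epsilon>_def)
  qed
  have Q2: "d / 4 \<le> Q"
  proof -
    have "1 * norm (cis 0 - cis (\<psi> - \<theta>)) \<le> max 1 (\<rho> * s) * norm (cis 0 - cis (\<psi> - \<theta>))"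
      by (intro mult_right_mono) auto
    also have "\<dots> \<le> 2 * norm (of_real 1 * cis 0 - of_real (\<rho> * s) * cis (\<psi> - \<theta>))"
      by (rule norm_scaled_cis_diff_ge) (use r s in auto)
    also have "\<dots> = 2 * Q" by (simp only: Q_def eqQ) simp
    also have "norm (cis 0 - cis (\<psi> - \<theta>)) = norm (cis \<theta> - cis \<psi>)"
      unfolding norm_cis_diff by (simp add: minus_divide_left[symmetric])
    finally show ?thesis using d(2) by simp
  qed
  have Q: "(\<epsilon> + d) / 8 \<le> Q" using Q1 Q2 d e by simp
  have Q_pos: "0 < Q" using Q1 e by simp
  define x where "x = norm (blaschke ?a ?y)"
  have x: "x = P / Q" by (simp add: x_def P_def Q_def Moebius_function_simple norm_divide)
  have x_pos: "0 < x" using P_pos Q_pos by (simp add: x)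
  then show "blaschke ?a ?y \<noteq> 0" by (auto simp: x_def)
  have x_le: "x \<le> 1"
    using Moebius_function_norm_lt_1[OF na, of 0] by (simp add: x_def)
  have "1 - x\<^sup>2 = (1 - \<rho>\<^sup>2) * (1 - s\<^sup>2) / Q\<^sup>2"
    using one_minus_norm_blaschke_squared[OF na] unfolding norms x_def Q_def .
  also have "\<dots> \<le> (2 * (1 - \<rho>)) * (2 * \<epsilon>) / Q\<^sup>2"
  proof (intro divide_right_mono mult_mono)
    show "1 - \<rho>\<^sup>2 \<le> 2 * (1 - \<rho>)" using zero_le_power2[of "1 - \<rho>"] by (simp add: power2_eq_square algebra_simps)
    show "1 - s\<^sup>2 \<le> 2 * \<epsilon>" using zero_le_power2[of "1 - s"] by (simp add: \<epsilon>_def power2_eq_square algebra_simps)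
  qed (use r s in \<open>auto simp: abs_square_le_1\<close>)
  also have "(2 * (1 - \<rho>)) * (2 * \<epsilon>) = 4 * (1 - \<rho>) * \<epsilon>" by simp
  finally have one_minus: "1 - x\<^sup>2 \<le> 4 * (1 - \<rho>) * \<epsilon> / Q\<^sup>2" .
  have "1 / sqrt x \<le> 1 + (1 - x\<^sup>2) / sqrt x"
  proof -
    have "x\<^sup>2 \<le> x" using x_pos x_le by (simp add: power2_eq_square mult_left_le)
    also have "x \<le> sqrt x" using x_pos x_le real_le_rsqrt[of x x] \<open>x\<^sup>2 \<le> x\<close> by simp
    finally show ?thesis using x_pos by (simp add: field_simps)
  qed
  also have "(1 - x\<^sup>2) / sqrt x \<le> (4 * (1 - \<rho>) * \<epsilon> / Q\<^sup>2) / sqrt x"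
    by (rule divide_right_mono[OF one_minus]) (use x_pos in simp)
  also have "\<dots> = 4 * (1 - \<rho>) * \<epsilon> / (Q * sqrt Q * sqrt P)"
  proof -
    have "Q\<^sup>2 * sqrt x = Q * sqrt Q * sqrt P"
    proof -
      have "Q\<^sup>2 * sqrt x = Q * ((Q / sqrt Q) * sqrt P)"
        by (simp add: x real_sqrt_divide power2_eq_square)
      then show ?thesis using Q_pos by (simp add: real_div_sqrt)
    qed
    then show ?thesis by simp
  qed
  also have "\<dots> \<le> 4 * (1 - \<rho>) * \<epsilon> / (((\<epsilon> + d) / 8) * sqrt ((\<epsilon> + d) / 8) * sqrt (m * d / 4))"
    using r e d m Q P Q_pos P_pos
    by (intro divide_left_mono mult_mono real_sqrt_le_mono mult_pos_pos mult_nonneg_nonneg) auto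
  \<comment> \<open>The constant collects 4 from \<open>1 - x\<^sup>2\<close>,
    \<open>8 * sqrt 8\<close> from the two factors bounding \<open>Q\<close>, and
    \<open>2 / sqrt m\<close> from the one bounding \<open>P\<close>.\<close>
  also have "\<dots> = (1 - \<rho>) * (64 * sqrt 8 / sqrt m) * singular_kernel \<epsilon> d"
  proof -
    have "4 * w * \<epsilon> / (((\<epsilon> + d) / 8) * sqrt ((\<epsilon> + d) / 8) * sqrt (m * d / 4))
        = w * (64 * sqrt 8 / sqrt m) * singular_kernel \<epsilon> d" for w
      by (simp add: singular_kernel_def real_sqrt_divide real_sqrt_mult mult_ac)
    then show ?thesis .
  qed
  finally show "1 / sqrt (norm (blaschke ?a ?y))
      \<le> 1 + (1 - \<rho>) * (64 * sqrt 8 / sqrt m) * singular_kernel (1 - s) d"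
    by (simp add: x_def \<epsilon>_def)
qed

section \<open>Expectations over independent angles\<close>

text \<open>Extended values make coincident nodes yield infinity, so that a finite bound certifies
  separation; real division by zero would yield 0 there.\<close>

definition inv_sqrt_blaschke :: "real \<Rightarrow> real \<Rightarrow> real \<Rightarrow> real \<Rightarrow> ennreal" where
  "inv_sqrt_blaschke \<rho> s x y =
     inverse (ennreal (sqrt (norm (blaschke (of_real \<rho> * cis x) (of_real s * cis y)))))"

abbreviation uniform_angle :: "real measure" where
  "uniform_angle \<equiv> uniform_measure lborel {0..<2 * pi}"

lemma prob_space_uniform_angle: "prob_space uniform_angle"
  by (rule prob_space_uniform_measure) auto

lemma inv_sqrt_blaschke_measurable:
  assumes "0 \<le> \<rho>" "\<rho> < 1" "0 \<le> s" "s < 1"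
  shows "(\<lambda>(x, y). inv_sqrt_blaschke \<rho> s x y) \<in> borel_measurable (borel \<Otimes>\<^sub>M borel)"
proof -
  have "1 - cnj (of_real \<rho> * cis x) * (of_real s * cis y) \<noteq> 0" for x y
    by (rule one_minus_cnj_mult_nonzero) (use assms in \<open>auto simp: norm_mult\<close>)
  then have "continuous_on UNIV (\<lambda>z. sqrt (norm (blaschke (of_real \<rho> * cis (fst z)) (of_real s * cis (snd z)))))"
    unfolding Moebius_function_simple by (intro continuous_intros) auto
  then have [measurable]: "(\<lambda>z. sqrt (norm (blaschke (of_real \<rho> * cis (fst z)) (of_real s * cis (snd z))))) \<in> borel_measurable (borel \<Otimes>\<^sub>M borel)"
    unfolding borel_prod by (rule borel_measurable_continuous_onI)
  show ?thesis
    unfolding inv_sqrt_blaschke_def case_prod_beta by measurable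
qed

lemma inv_sqrt_blaschke_ge_1:
  assumes "0 \<le> \<rho>" "\<rho> < 1" "0 \<le> s" "s < 1"
  shows "1 \<le> inv_sqrt_blaschke \<rho> s x y"
proof -
  have "norm (blaschke (of_real \<rho> * cis x) (of_real s * cis y)) < 1"
    by (rule Moebius_function_norm_lt_1) (use assms in \<open>auto simp: norm_mult\<close>)
  moreover have "0 \<le> norm (blaschke (of_real \<rho> * cis x) (of_real s * cis y))" by simp
  moreover have "1 \<le> inverse (ennreal (sqrt b))" if "0 \<le> b" "b < 1" for b
    using that by (cases "b = 0") (auto simp: inverse_ennreal one_le_inverse_iff)
  ultimately show ?thesis unfolding inv_sqrt_blaschke_def by blast
qed

lemma ennreal_one_plus_mult:
  assumes "0 \<le> a" "0 \<le> b"
  shows "ennreal (1 + a * b) = 1 + ennreal a * ennreal b"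
  using assms by (subst ennreal_plus) (auto simp: ennreal_mult)

text \<open>One of the three shifts brings the difference of the angles into the range where chord
  and arc are comparable. Summing over all three avoids a choice depending on \<open>x\<close> under
  the integral.\<close>

lemma inv_sqrt_blaschke_le:
  assumes r: "0 \<le> \<rho>" "\<rho> < 1" and s: "0 \<le> s" "s < 1" and m: "0 < m" "m \<le> max \<rho> s"
    and xy: "x \<in> {0..<2 * pi}" "y \<in> {0..<2 * pi}" "x \<noteq> y"
  shows "inv_sqrt_blaschke \<rho> s x y \<le> 1 + ennreal ((1 - \<rho>) * (64 * sqrt 8 / sqrt m)) *
    (\<Sum>c\<in>{- (2 * pi), 0, 2 * pi}. ennreal (singular_kernel (1 - s) \<bar>x + (c - y)\<bar>))"
proof -
  obtain c where c: "c \<in> {- (2 * pi), 0, 2 * pi}" "\<bar>x + c - y\<bar> \<le> pi" "x + c \<noteq> y"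
  proof (cases "\<bar>x - y\<bar> \<le> pi")
    case True
    then show ?thesis using that[of 0] xy by simp
  next
    case False
    show ?thesis
    proof (cases "x \<le> y")
      case True
      then have "\<bar>x + 2 * pi - y\<bar> \<le> pi" "x + 2 * pi \<noteq> y" using False xy by auto
      then show ?thesis using that[of "2 * pi"] by simp
    next
      case F: False
      then have "\<bar>x + - (2 * pi) - y\<bar> \<le> pi" "x + - (2 * pi) \<noteq> y" using False xy by auto
      then show ?thesis using that[of "- (2 * pi)"] by simp
    qed
  qed
  define d where "d = \<bar>x + (c - y)\<bar>"
  have d: "0 < d" "d \<le> pi" using c by (auto simp: d_def)
  have "cis c = 1" using c(1) by (auto simp: cis_cnj[symmetric])
  then have cis_x: "cis (x + c) = cis x" by (simp flip: cis_mult)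
  have "\<bar>x + c - y\<bar> / 2 \<le> norm (cis (x + c) - cis y)"
    by (rule norm_cis_diff_ge[OF c(2)])
  then have dc: "d / 2 \<le> norm (cis x - cis y)"
    by (simp add: cis_x d_def add_diff_eq)
  let ?b = "norm (blaschke (of_real \<rho> * cis x) (of_real s * cis y))"
  let ?C = "(1 - \<rho>) * (64 * sqrt 8 / sqrt m)"
  have b: "0 < ?b" "1 / sqrt ?b \<le> 1 + ?C * singular_kernel (1 - s) d"
    using inverse_sqrt_norm_blaschke_le[OF r s m d(1) dc] by auto
  have C: "0 \<le> ?C" using r m by simp
  have k: "0 \<le> singular_kernel (1 - s) d" using s d by (intro singular_kernel_nonneg) auto
  have "inv_sqrt_blaschke \<rho> s x y = ennreal (1 / sqrt ?b)"
    unfolding inv_sqrt_blaschke_def using b(1) by (subst inverse_ennreal) (auto simp: divide_inverse)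
  also have "\<dots> \<le> ennreal (1 + ?C * singular_kernel (1 - s) d)"
    by (rule ennreal_leI[OF b(2)])
  also have "\<dots> = 1 + ennreal ?C * ennreal (singular_kernel (1 - s) d)"
    by (rule ennreal_one_plus_mult[OF C k])
  also have "\<dots> \<le> 1 + ennreal ?C * (\<Sum>c\<in>{- (2 * pi), 0, 2 * pi}. ennreal (singular_kernel (1 - s) \<bar>x + (c - y)\<bar>))"
    unfolding d_def by (intro add_left_mono mult_left_mono member_le_sum c(1)) auto
  finally show ?thesis .
qed

lemma nn_integral_inv_sqrt_blaschke:
  assumes r: "0 \<le> \<rho>" "\<rho> < 1" and s: "0 \<le> s" "s < 1" and m: "0 < m" "m \<le> max \<rho> s"
  shows "(\<integral>\<^sup>+x. inv_sqrt_blaschke \<rho> s x y \<partial>uniform_angle)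
    \<le> ennreal (1 + (1 - \<rho>) * (64 * sqrt 8 / sqrt m * (6 / pi)))"
proof -
  \<comment> \<open>The bound is claimed for every real \<open>y\<close>, as the later conditioning
    on this angle requires; periodicity moves it into one period.\<close>
  obtain y' where y': "y' \<in> {0..<2 * pi}" "cis y = cis y'"
  proof
    show "Arg2pi (cis y) \<in> {0..<2 * pi}" using Arg2pi_ge_0 Arg2pi_lt_2pi by simp
    show "cis y = cis (Arg2pi (cis y))" using Arg2pi_eq[of "cis y"] by (simp add: cis_conv_exp)
  qed
  let ?C = "(1 - \<rho>) * (64 * sqrt 8 / sqrt m)"
  have C: "0 \<le> ?C" using r m by simp
  let ?k = "\<lambda>x. \<Sum>c\<in>{- (2 * pi), 0, 2 * pi}. ennreal (singular_kernel (1 - s) \<bar>x + (c - y')\<bar>)"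
  have int_c: "(\<integral>\<^sup>+x. ennreal (singular_kernel (1 - s) \<bar>x + (c - y')\<bar>) * indicator {0..<2 * pi} x \<partial>lborel) \<le> 4"
    if c: "c \<in> {- (2 * pi), 0, 2 * pi}" for c
  proof -
    let ?g = "\<lambda>u. ennreal (singular_kernel (1 - s) \<bar>u\<bar>) * indicator {- (4 * pi)..4 * pi} u"
    have "(\<integral>\<^sup>+x. ennreal (singular_kernel (1 - s) \<bar>x + (c - y')\<bar>) * indicator {0..<2 * pi} x \<partial>lborel)
        \<le> (\<integral>\<^sup>+x. ?g ((c - y') + 1 * x) \<partial>lborel)"
      using c y' by (intro nn_integral_mono) (auto simp: indicator_def add.commute)
    also have "\<dots> = (\<integral>\<^sup>+u. ?g u \<partial>lborel)"
      using nn_integral_real_affine[of ?g 1 "c - y'"] by simp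
    also have "\<dots> \<le> 4" by (rule nn_integral_singular_kernel_abs) (use s in auto)
    finally show ?thesis .
  qed
  have "(\<integral>\<^sup>+x. inv_sqrt_blaschke \<rho> s x y \<partial>uniform_angle) = (\<integral>\<^sup>+x. inv_sqrt_blaschke \<rho> s x y' \<partial>uniform_angle)"
    by (simp only: inv_sqrt_blaschke_def y'(2))
  also have "\<dots> \<le> (\<integral>\<^sup>+x. 1 + ennreal ?C * ?k x \<partial>uniform_angle)"
  proof (rule nn_integral_mono_AE)
    have "AE x in lborel. x \<in> {0..<2 * pi} \<longrightarrow> inv_sqrt_blaschke \<rho> s x y' \<le> 1 + ennreal ?C * ?k x"
      using AE_lborel_singleton[of y']
    proof eventually_elim
      case (elim x)
      then show ?case using inv_sqrt_blaschke_le[OF r s m _ y'(1)] by blast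
    qed
    then show "AE x in uniform_angle. inv_sqrt_blaschke \<rho> s x y' \<le> 1 + ennreal ?C * ?k x"
      by (rule AE_uniform_measureI[rotated]) simp
  qed
  also have "\<dots> = 1 + ennreal ?C * (\<integral>\<^sup>+x. ?k x \<partial>uniform_angle)"
  proof -
    interpret prob_space uniform_angle by (rule prob_space_uniform_angle)
    have "(\<integral>\<^sup>+x. 1 + ennreal ?C * ?k x \<partial>uniform_angle) = (\<integral>\<^sup>+x. 1 \<partial>uniform_angle) + (\<integral>\<^sup>+x. ennreal ?C * ?k x \<partial>uniform_angle)"
      by (rule nn_integral_add) simp_all
    also have "(\<integral>\<^sup>+x. ennreal ?C * ?k x \<partial>uniform_angle) = ennreal ?C * (\<integral>\<^sup>+x. ?k x \<partial>uniform_angle)"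
      by (rule nn_integral_cmult) simp
    finally show ?thesis by (simp add: emeasure_space_1)
  qed
  also have "(\<integral>\<^sup>+x. ?k x \<partial>uniform_angle) \<le> ennreal (6 / pi)"
  proof -
    have "(\<integral>\<^sup>+x. ?k x \<partial>uniform_angle) = (\<integral>\<^sup>+x. ?k x * indicator {0..<2 * pi} x \<partial>lborel) / ennreal (2 * pi)"
      by (subst nn_integral_uniform_measure) auto
    also have "(\<integral>\<^sup>+x. ?k x * indicator {0..<2 * pi} x \<partial>lborel) =
       (\<Sum>c\<in>{- (2 * pi), 0, 2 * pi}. \<integral>\<^sup>+x. ennreal (singular_kernel (1 - s) \<bar>x + (c - y')\<bar>) * indicator {0..<2 * pi} x \<partial>lborel)"
      unfolding sum_distrib_right by (rule nn_integral_sum) simp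
    \<comment> \<open>Three shifts of mass at most 4 give 12, and dividing by the period
      \<open>2 * pi\<close> gives the \<open>6 / pi\<close> of the statement.\<close>
    also have "\<dots> \<le> (\<Sum>c\<in>{- (2 * pi), 0, 2 * pi}. 4)"
      by (rule sum_mono[OF int_c])
    also have "\<dots> = ennreal 12" by simp
    also have "ennreal 12 / ennreal (2 * pi) = ennreal (12 / (2 * pi))"
      by (rule divide_ennreal) auto
    finally show ?thesis by (simp add: divide_right_mono_ennreal)
  qed
  also have "1 + ennreal ?C * ennreal (6 / pi) = ennreal (1 + (1 - \<rho>) * (64 * sqrt 8 / sqrt m * (6 / pi)))"
    using ennreal_one_plus_mult[OF C, of "6 / pi"] by (simp only: mult.assoc) simp
  finally show ?thesis by (simp add: add_left_mono mult_left_mono)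
qed

text \<open>The factors share \<open>\<theta> n\<close> and so are not independent. Integrating over
  coordinate \<open>n\<close> last fixes its value \<open>y\<close>; the integral of the product
  over the other coordinates then splits, and bounds uniform in \<open>y\<close> finish the
  estimate.\<close>

lemma (in prob_space) nn_integral_prod_indep_le:
  fixes \<theta> :: "nat \<Rightarrow> 'a \<Rightarrow> real" and U :: "real measure"
  assumes indep: "indep_vars (\<lambda>_. borel) \<theta> UNIV" and distr: "\<And>n. distr M borel (\<theta> n) = U"
    and J: "finite J" "n \<notin> J"
    and G: "\<And>k. (\<lambda>(x, y). G k x y) \<in> borel_measurable (borel \<Otimes>\<^sub>M borel)"
    and le: "\<And>k y. k \<in> J \<Longrightarrow> (\<integral>\<^sup>+x. G k x y \<partial>U) \<le> c k"
  shows "(\<integral>\<^sup>+\<omega>. (\<Prod>k\<in>J. G k (\<theta> k \<omega>) (\<theta> n \<omega>)) \<partial>M) \<le> (\<Prod>k\<in>J. c k)"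
proof -
  have rv[measurable]: "\<theta> i \<in> borel_measurable M" for i
    using indep by (auto simp: indep_vars_def)
  have sets_U[measurable_cong, simp]: "sets U = sets borel" using distr[of 0] by (metis sets_distr)
  have pU: "prob_space U" unfolding distr[of 0, symmetric] by (rule prob_space_distr[OF rv])
  interpret U: prob_space U by (rule pU)
  interpret P: product_sigma_finite "\<lambda>_::nat. U" by standard
  have meas_G[measurable]: "(\<lambda>z. G k (f z) (g z)) \<in> borel_measurable N"
    if "f \<in> borel_measurable N" "g \<in> borel_measurable N" for k f g and N :: "'b measure"
    using measurable_compose[OF measurable_Pair[OF that] G[of k]] by simp
  let ?I = "insert n J"
  let ?F = "\<lambda>x. \<Prod>k\<in>J. G k (x k) (x n)"
  have comp: "(\<lambda>x. x i) \<in> borel_measurable (Pi\<^sub>M ?I (\<lambda>_. U))" if "i \<in> ?I" for i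
    using measurable_component_singleton[OF that, of "\<lambda>_. U"]
    unfolding measurable_cong_sets[OF refl sets_U] .
  have F_meas: "?F \<in> borel_measurable (Pi\<^sub>M ?I (\<lambda>_. U))"
  proof (rule borel_measurable_prod_ennreal)
    fix k assume "k \<in> J"
    then show "(\<lambda>x. G k (x k) (x n)) \<in> borel_measurable (Pi\<^sub>M ?I (\<lambda>_. U))"
      using measurable_compose[OF measurable_Pair[OF comp[of k] comp[of n]] G[of k]] by simp
  qed
  have "indep_vars (\<lambda>_. borel) \<theta> ?I" using indep by (rule indep_vars_subset) simp
  then have D: "distr M (Pi\<^sub>M ?I (\<lambda>_. borel)) (\<lambda>\<omega>. \<lambda>i\<in>?I. \<theta> i \<omega>) = Pi\<^sub>M ?I (\<lambda>_. U)"
    using indep_vars_iff_distr_eq_PiM[where I = ?I and M' = "\<lambda>_. borel" and X = \<theta>] rv by (simp add: distr)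
  have "(\<integral>\<^sup>+\<omega>. (\<Prod>k\<in>J. G k (\<theta> k \<omega>) (\<theta> n \<omega>)) \<partial>M) = (\<integral>\<^sup>+\<omega>. ?F (\<lambda>i\<in>?I. \<theta> i \<omega>) \<partial>M)"
    by (intro nn_integral_cong prod.cong) auto
  also have "\<dots> = (\<integral>\<^sup>+x. ?F x \<partial>distr M (Pi\<^sub>M ?I (\<lambda>_. borel)) (\<lambda>\<omega>. \<lambda>i\<in>?I. \<theta> i \<omega>))"
  proof (rule nn_integral_distr[symmetric])
    show "(\<lambda>\<omega>. \<lambda>i\<in>?I. \<theta> i \<omega>) \<in> measurable M (Pi\<^sub>M ?I (\<lambda>_. borel))"
      by (rule measurable_restrict) (rule rv)
    show "?F \<in> borel_measurable (distr M (Pi\<^sub>M ?I (\<lambda>_. borel)) (\<lambda>\<omega>. \<lambda>i\<in>?I. \<theta> i \<omega>))"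
      unfolding D by (rule F_meas)
  qed
  also have "\<dots> = (\<integral>\<^sup>+x. ?F x \<partial>Pi\<^sub>M ?I (\<lambda>_. U))" unfolding D ..
  also have "\<dots> = (\<integral>\<^sup>+y. (\<integral>\<^sup>+x. ?F (x(n := y)) \<partial>Pi\<^sub>M J (\<lambda>_. U)) \<partial>U)"
    by (rule P.product_nn_integral_insert_rev[OF J F_meas])
  also have "\<dots> = (\<integral>\<^sup>+y. (\<integral>\<^sup>+x. (\<Prod>k\<in>J. G k (x k) y) \<partial>Pi\<^sub>M J (\<lambda>_. U)) \<partial>U)"
    using J(2) by (intro nn_integral_cong prod.cong refl) auto
  also have "\<dots> = (\<integral>\<^sup>+y. (\<Prod>k\<in>J. \<integral>\<^sup>+x. G k x y \<partial>U) \<partial>U)"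
    by (intro nn_integral_cong P.product_nn_integral_prod J(1)) simp
  also have "\<dots> \<le> (\<integral>\<^sup>+y. (\<Prod>k\<in>J. c k) \<partial>U)"
    by (intro nn_integral_mono prod_mono_ennreal) (use le in auto)
  also have "\<dots> = (\<Prod>k\<in>J. c k)" by (simp add: U.emeasure_space_1)
  finally show ?thesis .
qed

text \<open>A vanishing \<open>x j\<close> would make its factor infinite and, the others being at
  least 1, the whole product infinite. The finite bound thus forces all \<open>x k\<close> to be
  positive, and the rest is computed in the reals.\<close>

lemma one_le_if_prod_inverse_sqrt_le:
  assumes J: "finite J" and x: "\<And>k. k \<in> J \<Longrightarrow> 0 \<le> x k" "\<And>k. k \<in> J \<Longrightarrow> 1 \<le> inverse (ennreal (sqrt (x k)))"
    and le: "(\<Prod>k\<in>J. inverse (ennreal (sqrt (x k)))) \<le> ennreal d"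
  shows "1 \<le> d\<^sup>2 * (\<Prod>k\<in>J. x k)"
proof -
  have pos: "0 < x j" if j: "j \<in> J" for j
  proof (rule ccontr)
    assume "\<not> 0 < x j"
    then have "x j = 0" using x(1)[OF j] by simp
    then have "\<infinity> * (\<Prod>k\<in>J - {j}. inverse (ennreal (sqrt (x k)))) = (\<Prod>k\<in>J. inverse (ennreal (sqrt (x k))))"
      using prod.remove[OF J j, of "\<lambda>k. inverse (ennreal (sqrt (x k)))"] by simp
    moreover have "(\<Prod>k\<in>J - {j}. 1) \<le> (\<Prod>k\<in>J - {j}. inverse (ennreal (sqrt (x k))))"
      using x(2) by (intro prod_mono_ennreal) auto
    ultimately have "(\<Prod>k\<in>J. inverse (ennreal (sqrt (x k)))) = \<infinity>"
      by (auto simp: ennreal_top_mult)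
    then show False using le by (simp add: top_unique)
  qed
  define q where "q = (\<Prod>k\<in>J. sqrt (x k))"
  have q: "0 < q" unfolding q_def using pos by (intro prod_pos) auto
  have "(\<Prod>k\<in>J. inverse (ennreal (sqrt (x k)))) = (\<Prod>k\<in>J. ennreal (inverse (sqrt (x k))))"
    using pos by (intro prod.cong refl inverse_ennreal) auto
  also have "\<dots> = ennreal (\<Prod>k\<in>J. inverse (sqrt (x k)))"
    using pos by (intro prod_ennreal) (auto simp: less_imp_le)
  also have "(\<Prod>k\<in>J. inverse (sqrt (x k))) = inverse q"
    unfolding q_def using prod_inversef[of "\<lambda>k. sqrt (x k)" J] by (simp add: o_def)
  finally have "ennreal (inverse q) \<le> ennreal d" using le by simp
  then have "inverse q \<le> d" using q by (simp add: ennreal_le_iff2)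
  then have "1 \<le> d * q" using q by (simp add: field_simps)
  then have "1 \<le> (d * q)\<^sup>2" by (simp add: one_le_power)
  also have "q\<^sup>2 = (\<Prod>k\<in>J. x k)"
    unfolding q_def prod_power_distrib using x(1) by (intro prod.cong) auto
  ultimately show ?thesis by (simp add: power_mult_distrib)
qed

text \<open>The radii tend to 1, so the minimum is over finitely many. A vanishing radius is left
  out and later compensated by taking the maximum with another radius.\<close>

lemma radii_bounded_below:
  fixes r :: "nat \<Rightarrow> real"
  assumes "summable (\<lambda>n. 1 - r n)" "\<And>n. 0 \<le> r n"
  obtains m where "0 < m" "\<And>n. r n \<noteq> 0 \<Longrightarrow> m \<le> r n"
proof -
  have "(\<lambda>n. 1 - r n) \<longlonglongrightarrow> 0" by (rule summable_LIMSEQ_zero[OF assms(1)])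
  then have "\<forall>\<^sub>F n in sequentially. 1 - r n < 1 / 2" by (rule order_tendstoD) simp
  then obtain N where N: "\<And>n. n \<ge> N \<Longrightarrow> 1 / 2 < r n"
    by (auto simp: eventually_sequentially)
  define F where "F = insert (1 / 2) (r ` {n. n < N \<and> r n \<noteq> 0})"
  have F: "finite F" "F \<noteq> {}" by (auto simp: F_def)
  show ?thesis
  proof (rule that[of "Min F"])
    have "0 < x" if "x \<in> F" for x
      using that assms(2) by (auto simp: F_def less_le)
    then show "0 < Min F" using Min_in[OF F] by blast
    show "Min F \<le> r n" if "r n \<noteq> 0" for n
    proof (cases "n < N")
      case True
      then show ?thesis using that F by (intro Min_le) (auto simp: F_def)
    next
      case False
      have "Min F \<le> 1 / 2" using F by (intro Min_le) (auto simp: F_def)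
      then show ?thesis using N[of n] False by simp
    qed
  qed
qed

text \<open>The factors are at least 1, so the products increase with \<open>N\<close>, and monotone
  convergence gives their supremum the same bound on the expectation. The supremum later supplies
  one constant \<open>D n\<close> valid for all finite products.\<close>

lemma (in prob_space) AE_sum_sup_prod_inv_sqrt_blaschke:
  fixes r :: "nat \<Rightarrow> real" and \<theta> :: "nat \<Rightarrow> 'a \<Rightarrow> real"
  assumes r: "\<And>n. 0 \<le> r n" "\<And>n. r n < 1"
    and r0: "\<And>m n. r m = 0 \<Longrightarrow> r n = 0 \<Longrightarrow> m = n"
    and indep: "indep_vars (\<lambda>_. borel) \<theta> UNIV"
    and distr: "\<And>n. distr M borel (\<theta> n) = uniform_angle"
    and summ: "summable (\<lambda>n. 1 - r n)"
  shows "AE \<omega> in M. (\<Sum>n. ennreal (1 - r n) *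
    (SUP N. \<Prod>k\<in>{..<N} - {n}. inv_sqrt_blaschke (r k) (r n) (\<theta> k \<omega>) (\<theta> n \<omega>))) \<noteq> \<infinity>"
proof -
  obtain m where m: "0 < m" "\<And>n. r n \<noteq> 0 \<Longrightarrow> m \<le> r n"
    using radii_bounded_below[OF summ r(1)] by blast
  define C where "C = 64 * sqrt 8 / sqrt m * (6 / pi)"
  have C: "0 \<le> C" using m by (simp add: C_def)
  define T where "T = (\<Sum>n. 1 - r n)"
  have rv[measurable]: "\<theta> i \<in> borel_measurable M" for i
    using indep by (auto simp: indep_vars_def)
  let ?\<phi> = "\<lambda>n k \<omega>. inv_sqrt_blaschke (r k) (r n) (\<theta> k \<omega>) (\<theta> n \<omega>)"
  let ?P = "\<lambda>n N \<omega>. \<Prod>k\<in>{..<N} - {n}. ?\<phi> n k \<omega>"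
  have phi_meas: "?\<phi> n k \<in> borel_measurable M" for n k
    using measurable_compose[OF measurable_Pair[OF rv rv] inv_sqrt_blaschke_measurable[OF r r]] by simp
  have P_meas[measurable]: "?P n N \<in> borel_measurable M" for n N
    by (rule borel_measurable_prod_ennreal) (rule phi_meas)
  have P_le: "(\<integral>\<^sup>+\<omega>. ?P n N \<omega> \<partial>M) \<le> ennreal (exp (C * T))" for n N
  proof -
    have "(\<integral>\<^sup>+\<omega>. ?P n N \<omega> \<partial>M) \<le> (\<Prod>k\<in>{..<N} - {n}. ennreal (1 + (1 - r k) * C))"
    proof (rule nn_integral_prod_indep_le[OF indep distr])
      fix k y assume "k \<in> {..<N} - {n}"
      \<comment> \<open>Here it matters that at most one radius vanishes: of two distinct indices,
        one has radius at least \<open>m\<close>.\<close>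
      then have "\<not> (r k = 0 \<and> r n = 0)" using r0 by blast
      then have "m \<le> max (r k) (r n)" using m(2)[of k] m(2)[of n] by (auto simp: le_max_iff_disj)
      then show "(\<integral>\<^sup>+x. inv_sqrt_blaschke (r k) (r n) x y \<partial>uniform_angle) \<le> ennreal (1 + (1 - r k) * C)"
        unfolding C_def by (intro nn_integral_inv_sqrt_blaschke r m(1))
    qed (use inv_sqrt_blaschke_measurable r in auto)
    also have "\<dots> = ennreal (\<Prod>k\<in>{..<N} - {n}. 1 + (1 - r k) * C)"
      using r C by (intro prod_ennreal) (simp add: less_imp_le)
    also have "\<dots> \<le> ennreal (exp (C * T))"
    proof (rule ennreal_leI)
      have "(\<Prod>k\<in>{..<N} - {n}. 1 + (1 - r k) * C) \<le> (\<Prod>k\<in>{..<N} - {n}. exp ((1 - r k) * C))"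
        using r C by (intro prod_mono conjI exp_ge_add_one_self) (simp add: less_imp_le)
      also have "\<dots> = exp (\<Sum>k\<in>{..<N} - {n}. (1 - r k) * C)"
        by (rule exp_sum[symmetric]) simp
      also have "\<dots> \<le> exp (C * T)"
      proof -
        have "(\<Sum>k\<in>{..<N} - {n}. 1 - r k) \<le> T"
          unfolding T_def using r by (intro sum_le_suminf summ) (auto simp: less_imp_le)
        then have "C * (\<Sum>k\<in>{..<N} - {n}. 1 - r k) \<le> C * T" using C by (rule mult_left_mono)
        then show ?thesis by (simp add: sum_distrib_left mult.commute)
      qed
      finally show "(\<Prod>k\<in>{..<N} - {n}. 1 + (1 - r k) * C) \<le> exp (C * T)" .
    qed
    finally show ?thesis .
  qed
  have inc: "incseq (?P n)" for n
  proof (rule incseq_SucI, rule le_funI)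
    fix N \<omega>
    have "?P n (Suc N) \<omega> = (\<Prod>k\<in>({..<Suc N} - {n}) - ({..<N} - {n}). ?\<phi> n k \<omega>) * ?P n N \<omega>"
      by (rule prod.subset_diff) auto
    moreover have "(\<Prod>k\<in>({..<Suc N} - {n}) - ({..<N} - {n}). 1) \<le> (\<Prod>k\<in>({..<Suc N} - {n}) - ({..<N} - {n}). ?\<phi> n k \<omega>)"
      by (intro prod_mono_ennreal inv_sqrt_blaschke_ge_1 r)
    then have "1 * ?P n N \<omega> \<le> (\<Prod>k\<in>({..<Suc N} - {n}) - ({..<N} - {n}). ?\<phi> n k \<omega>) * ?P n N \<omega>"
      by (intro mult_right_mono) auto
    ultimately show "?P n N \<omega> \<le> ?P n (Suc N) \<omega>" by simp
  qed
  have SUP_le: "(\<integral>\<^sup>+\<omega>. (SUP N. ?P n N \<omega>) \<partial>M) \<le> ennreal (exp (C * T))" for n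
  proof -
    have "(\<integral>\<^sup>+\<omega>. (SUP N. ?P n N \<omega>) \<partial>M) = (SUP N. \<integral>\<^sup>+\<omega>. ?P n N \<omega> \<partial>M)"
      by (rule nn_integral_monotone_convergence_SUP[OF inc P_meas])
    also have "\<dots> \<le> ennreal (exp (C * T))" by (rule SUP_least) (rule P_le)
    finally show ?thesis .
  qed
  have "(\<integral>\<^sup>+\<omega>. (\<Sum>n. ennreal (1 - r n) * (SUP N. ?P n N \<omega>)) \<partial>M)
      = (\<Sum>n. \<integral>\<^sup>+\<omega>. ennreal (1 - r n) * (SUP N. ?P n N \<omega>) \<partial>M)"
    by (rule nn_integral_suminf) measurable
  also have "\<dots> = (\<Sum>n. ennreal (1 - r n) * (\<integral>\<^sup>+\<omega>. (SUP N. ?P n N \<omega>) \<partial>M))"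
    by (subst nn_integral_cmult) measurable
  also have "\<dots> \<le> (\<Sum>n. ennreal (1 - r n) * ennreal (exp (C * T)))"
    by (intro suminf_le mult_left_mono SUP_le) auto
  also have "\<dots> = (\<Sum>n. ennreal ((1 - r n) * exp (C * T)))"
    using r by (simp add: ennreal_mult less_imp_le)
  also have "\<dots> = ennreal (\<Sum>n. (1 - r n) * exp (C * T))"
    by (rule suminf_ennreal2[OF _ summable_mult2[OF summ]]) (use r in \<open>simp add: less_imp_le\<close>)
  also have "\<dots> < \<infinity>" by simp
  finally have "(\<integral>\<^sup>+\<omega>. (\<Sum>n. ennreal (1 - r n) * (SUP N. ?P n N \<omega>)) \<partial>M) \<noteq> \<infinity>" by simp
  then show ?thesis
    by (intro nn_integral_PInf_AE) measurable
qed

section \<open>From separation of the nodes to the equivalence\<close>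

text \<open>The deterministic part, for one realization of the angles. The weights
  \<open>1 - r n\<close> are positive, so finiteness of the sum makes every supremum finite, and its
  real value can serve as \<open>D n\<close>.\<close>

lemma bounded_interpolation:
  fixes r t :: "nat \<Rightarrow> real" and a :: "nat \<Rightarrow> complex"
  assumes r: "\<And>n. 0 \<le> r n" "\<And>n. r n < 1" and p: "0 < p" and a: "bounded (range a)"
    and fin: "(\<Sum>n. ennreal (1 - r n) *
      (SUP N. \<Prod>k\<in>{..<N} - {n}. inv_sqrt_blaschke (r k) (r n) (t k) (t n))) \<noteq> \<infinity>"
  obtains h where "h \<in> hardy_orlicz p" "\<And>n. h (of_real (r n) * cis (t n)) = a n"
proof -
  define l where "l = (\<lambda>n. complex_of_real (r n) * cis (t n))"
  define W where "W = (\<lambda>n. SUP N. \<Prod>k\<in>{..<N} - {n}. inv_sqrt_blaschke (r k) (r n) (t k) (t n))"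
  define D where "D = (\<lambda>n. enn2real (W n))"
  have norm_l: "norm (l n) = r n" for n using r by (simp add: l_def norm_mult)
  have W_fin: "W n \<noteq> \<infinity>" for n
  proof
    assume "W n = \<infinity>"
    then have "ennreal (1 - r n) * W n = \<infinity>" using r(2)[of n] by (simp add: ennreal_mult_top)
    moreover have "(\<Sum>n\<in>{n}. ennreal (1 - r n) * W n) \<le> (\<Sum>n. ennreal (1 - r n) * W n)"
      by (rule sum_le_suminf) auto
    ultimately show False using fin unfolding W_def by (simp add: top_unique)
  qed
  have W: "W n = ennreal (D n)" for n using W_fin[of n] by (simp add: D_def less_top)
  have W_ge: "(\<Prod>k\<in>{..<N} - {n}. inv_sqrt_blaschke (r k) (r n) (t k) (t n)) \<le> W n" for n N
    unfolding W_def by (rule SUP_upper) simp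
  have D: "0 < D n" for n
  proof -
    \<comment> \<open>For \<open>N = 0\<close> the product is empty and equals 1.\<close>
    have "ennreal 1 \<le> ennreal (D n)" using W_ge[of n 0] by (simp flip: W)
    then show ?thesis unfolding ennreal_le_iff2 by auto
  qed
  have "(\<Sum>n. ennreal (1 - r n) * W n) \<noteq> \<infinity>"
    unfolding W_def by (rule fin)
  then have "(\<Sum>n. ennreal ((1 - r n) * D n)) \<noteq> \<top>"
    unfolding W using r D by (simp add: ennreal_mult less_imp_le)
  then have summ: "summable (\<lambda>n. (1 - norm (l n)) * D n)"
    unfolding norm_l by (rule summable_suminf_not_top[rotated]) (use r D in \<open>simp add: less_imp_le\<close>)
  have sep: "1 \<le> (D n)\<^sup>2 * (\<Prod>k\<in>{..<N} - {n}. norm (blaschke (l k) (l n)))" for N n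
  proof (rule one_le_if_prod_inverse_sqrt_le)
    show "1 \<le> inverse (ennreal (sqrt (norm (blaschke (l k) (l n)))))" for k
      using inv_sqrt_blaschke_ge_1[OF r r, of k n "t k" "t n"] by (simp add: inv_sqrt_blaschke_def l_def)
    show "(\<Prod>k\<in>{..<N} - {n}. inverse (ennreal (sqrt (norm (blaschke (l k) (l n)))))) \<le> ennreal (D n)"
      using W_ge[of n N] unfolding W by (simp add: inv_sqrt_blaschke_def l_def)
  qed auto
  obtain A where A: "\<And>n. norm (a n) \<le> A" using a by (auto simp: bounded_iff)
  have l_in: "l n \<in> unit_disc" for n using norm_l r(2) by simp
  obtain h S where h: "h holomorphic_on unit_disc" "\<And>n. h (l n) = a n"
    "integrable circle_angle S" "\<And>t. 0 \<le> S t"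
    "AE t in circle_angle. \<forall>r. 0 < r \<longrightarrow> r < 1 \<longrightarrow> norm (h (of_real r * cis t)) \<le> (S t)\<^sup>2"
    by (rule interpolating_function[where a = a, OF l_in D sep summ A]) (rule that)
  have "h \<in> hardy_orlicz p" by (rule hardy_orlicz_if_dominated[OF h(1) p h(3-5)])
  then show ?thesis using that h(2) unfolding l_def by blast
qed

lemma one_in_hardy_orlicz:
  assumes "0 < p"
  shows "(\<lambda>_. 1) \<in> hardy_orlicz p"
proof (rule hardy_orlicz_if_dominated[where S = "\<lambda>_. 1"])
  show "integrable circle_angle (\<lambda>_. 1 :: real)"
    by (rule continuous_imp_integrable_circle_angle) (rule continuous_on_const)
qed (use assms in auto)

text \<open>Freeness applied to the trace of the constant 1 solves the problem for all bounded data.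
  Indicator sequences then show that the nodes are distinct, which the counting of zeros
  requires.\<close>

lemma free_interpolating_imp_blaschke:
  fixes l :: "nat \<Rightarrow> complex"
  assumes p: "0 < p" and l: "\<And>n. l n \<in> unit_disc" and free: "free_interpolating (hardy_orlicz p) l"
  shows "summable (\<lambda>n. 1 - norm (l n))"
proof -
  have ex: "\<exists>f\<in>hardy_orlicz p. \<forall>n. f (l n) = a n" if "bounded (range a)" for a
  proof -
    have "(\<lambda>n. 1) \<in> trace_space (hardy_orlicz p) l"
      unfolding trace_space_def using one_in_hardy_orlicz[OF p] by (intro image_eqI[where x = "\<lambda>_. 1"]) auto
    then have "(\<lambda>n. a n * 1) \<in> trace_space (hardy_orlicz p) l"
      using free that unfolding free_interpolating_def by blast
    then show ?thesis unfolding trace_space_def by (auto simp: fun_eq_iff)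
  qed
  have ind: "\<exists>f\<in>hardy_orlicz p. \<forall>n. f (l n) = (if n = m then 1 else 0)" for m
    by (rule ex) (auto intro!: finite_imp_bounded finite_subset[of _ "{0, 1}"])
  have "inj l"
  proof (rule injI, rule ccontr)
    fix m n assume eq: "l m = l n" "m \<noteq> n"
    obtain f where f: "\<forall>k. f (l k) = (if k = m then 1 else (0::complex))" using ind[of m] by blast
    have "f (l m) = 1" "f (l n) = 0" using f eq(2) by auto
    then show False using eq(1) by simp
  qed
  obtain f where f: "f \<in> hardy_orlicz p" "\<And>n. f (l n) = (if n = 0 then 1 else 0)"
    using ind[of 0] by blast
  \<comment> \<open>The node of index 0 is set aside: \<open>f\<close> is 1 there, so it serves as
    the point where the function does not vanish.\<close>
  have "summable (\<lambda>n. 1 - norm (l (Suc n)))"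
  proof (rule nevanlinna_zeros_blaschke[of f _ "l 0"])
    show "f \<in> nevanlinna_class" using f(1) by (simp add: hardy_orlicz_def smirnov_class_def)
    show "inj (\<lambda>n. l (Suc n))" using \<open>inj l\<close> by (auto simp: inj_def)
  qed (use l f in auto)
  then show ?thesis by (subst (asm) summable_Suc_iff)
qed

theorem theorem1p4:
  fixes M :: "'a measure" and p :: real and r :: "nat \<Rightarrow> real" and \<theta> :: "nat \<Rightarrow> 'a \<Rightarrow> real"
  assumes "prob_space M"
    and "p > 1"
    and "\<And>n. 0 \<le> r n" and "\<And>n. r n < 1"
    and "\<And>m n. r m = 0 \<Longrightarrow> r n = 0 \<Longrightarrow> m = n"
    and "prob_space.indep_vars M (\<lambda>_. borel) \<theta> UNIV"
    and "\<And>n. distr M borel (\<theta> n) = uniform_measure lborel {0..<2 * pi}"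
  shows "(AE \<omega> in M. free_interpolating (hardy_orlicz p) (\<lambda>n. of_real (r n) * cis (\<theta> n \<omega>)))
    \<longleftrightarrow> summable (\<lambda>n. 1 - r n)"
proof
  interpret prob_space M by fact
  have p: "0 < p" using assms(2) by simp
  {
    assume "AE \<omega> in M. free_interpolating (hardy_orlicz p) (\<lambda>n. of_real (r n) * cis (\<theta> n \<omega>))"
    \<comment> \<open>The Blaschke condition involves only the deterministic radii, so a single
      outcome suffices, and an almost sure event of a probability space has one.\<close>
    then obtain \<omega> where "free_interpolating (hardy_orlicz p) (\<lambda>n. of_real (r n) * cis (\<theta> n \<omega>))"
      using eventually_happens'[OF ae_filter_bot] by blast
    from free_interpolating_imp_blaschke[OF p _ this] show "summable (\<lambda>n. 1 - r n)"
      using assms(3,4) by (simp add: norm_mult)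
  }
  assume "summable (\<lambda>n. 1 - r n)"
  have "AE \<omega> in M. (\<Sum>n. ennreal (1 - r n) *
      (SUP N. \<Prod>k\<in>{..<N} - {n}. inv_sqrt_blaschke (r k) (r n) (\<theta> k \<omega>) (\<theta> n \<omega>))) \<noteq> \<infinity>"
    by (rule AE_sum_sup_prod_inv_sqrt_blaschke) fact+
  then show "AE \<omega> in M. free_interpolating (hardy_orlicz p) (\<lambda>n. of_real (r n) * cis (\<theta> n \<omega>))"
  proof eventually_elim
    case (elim \<omega>)
    show ?case
      unfolding free_interpolating_def
    proof (intro allI impI)
      fix a v :: "nat \<Rightarrow> complex"
      let ?l = "\<lambda>n. of_real (r n) * cis (\<theta> n \<omega>)"
      assume a: "bounded (range a)" and "v \<in> trace_space (hardy_orlicz p) ?l"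
      then obtain f where f: "f \<in> hardy_orlicz p" "v = (\<lambda>n. f (?l n))"
        unfolding trace_space_def by blast
      obtain h where h: "h \<in> hardy_orlicz p" "\<And>n. h (?l n) = a n"
        using bounded_interpolation[OF assms(3,4) p a elim] by blast
      show "(\<lambda>n. a n * v n) \<in> trace_space (hardy_orlicz p) ?l"
        unfolding trace_space_def
        by (rule image_eqI[OF _ hardy_orlicz_mult[OF h(1) f(1) p]]) (simp add: h(2) f(2))
    qed
  qed
qed

end
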